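(* Let $u_0\in L^2_\sigma(\mathbb{R}^3)$ and let $u(\cdot,t)$, $t>0$, be any particular Leray-Hopf solution of the incompressible Navier-Stokes equations in $\mathbb{R}^3$ with initial data $u_0$ (in the sense described in the context). Given any pair of initial times $\tilde t_0>t_0\ge 0$, let $v(\cdot,t)=e^{\Delta(t-t_0)}u(\cdot,t_0)$ and $\tilde v(\cdot,t)=e^{\Delta(t-\tilde t_0)}u(\cdot,\tilde t_0)$ be the corresponding heat flows. Then $$\|v(\cdot,t)-\tilde v(\cdot,t)\|_{L^\infty(\mathbb{R}^3)}\le \frac{\Gamma}{\sqrt2}\,\|u_0\|_{L^2(\mathbb{R}^3)}^2\,(\tilde t_0-t_0)^{1/2}\,(t-\tilde t_0)^{-3/2}$$ for all $t>\tilde t_0$, where $\Gamma=(4\pi)^{-3/2}$.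
   Context: $L^2_\sigma(\mathbb{R}^3)$ is the space of vector fields $\mathrm{u}=(\mathrm{u}_1,\mathrm{u}_2,\mathrm{u}_3)\in L^2(\mathbb{R}^3)$ with $\nabla\cdot \mathrm{u}=0$ in the distributional sense. The Navier-Stokes problem is $$u_t+u\cdot\nabla u+\nabla p=\Delta u,\qquad \nabla\cdot u(\cdot,t)=0,\qquad u(\cdot,0)=u_0\in L^2_\sigma(\mathbb{R}^3).$$ A Leray-Hopf solution is a global weak solution as constructed by Leray: $u\in L^\infty([0,\infty),L^2_\sigma(\mathbb{R}^3))\cap L^2([0,\infty),\dot H^1(\mathbb{R}^3))$, weakly continuous in $L^2(\mathbb{R}^3)$ on $[0,\infty)$, solving the equations in the distributional sense, with $\|u(\cdot,t)-u_0\|_{L^2}\to 0$ as $t\searrow 0$, and satisfying the energy inequality $\|u(\cdot,t)\|_{L^2}^2+2\int_0^t\|Du(\cdot,s)\|_{L^2}^2\,ds\le\|u_0\|_{L^2}^2$ for all $t\ge 0$. It is obtained as follows: for a nonnegative $G\in C_0^\infty(\mathbb{R}^3)$ with $\int G=1$, put $G_\delta(x)=\delta^{-3}G(x/\delta)$, and let $u_\delta,p_\delta\in C^\infty(\mathbb{R}^3\times[0,\infty))$ be the unique global classical $L^2$ solutions of $\partial_t u_\delta+(G_\delta * u_\delta)\cdot\nabla u_\delta+\nabla p_\delta=\Delta u_\delta$, $\nabla\cdot u_\delta=0$, $u_\delta(\cdot,0)=G_\delta * u_0$; then for some sequence $\delta'\to 0$ one has $u_{\delta'}(\cdot,t)\rightharpoonup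 u(\cdot,t)$ weakly in $L^2(\mathbb{R}^3)$ for every $t\ge 0$. Such a solution has the property (shown by Leray) that there is $t_*$ (depending on $u$) with $u\in C^\infty(\mathbb{R}^3\times[t_*,\infty))$ and $u\in L^\infty([t_*,T],H^m(\mathbb{R}^3))$ for each $m\ge 1$ and each $t_*<T<\infty$. $e^{\Delta\tau}$, $\tau\ge 0$, is the heat semigroup on $\mathbb{R}^3$ (acting componentwise). Norms: $\|u\|_{L^2}^2=\sum_{i}\int|u_i|^2dx$, $\|Du\|_{L^2}^2=\sum_{i,j}\int|D_ju_i|^2dx$ with $D_j=\partial/\partial x_j$, and $\|u\|_{L^\infty(\mathbb{R}^3)}=\max_{1\le i\le 3}\|u_i\|_{L^\infty(\mathbb{R}^3)}$. *)

theory Defs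
  imports "HOL-Analysis.Analysis" "HOL-Probability.Essential_Supremum"
begin

type_synonym R3 = "real^3"


section \<open>Smooth functions, test functions, distributions\<close>

text \<open>
  The derivative is taken within \<open>S\<close>, so that for \<open>S = UNIV \<times> {0..}\<close> all derivatives exist and are
  continuous up to the boundary \<open>t = 0\<close> (one-sided in time).
\<close>
primrec Ck_on :: "nat \<Rightarrow> 'a::euclidean_space set \<Rightarrow> ('a \<Rightarrow> 'b::real_normed_vector) \<Rightarrow> bool" where
  "Ck_on 0 S f \<longleftrightarrow> continuous_on S f"
| "Ck_on (Suc k) S f \<longleftrightarrow>
     (\<exists>f'. (\<forall>x\<in>S. (f has_derivative f' x) (at x within S)) \<and> (\<forall>v. Ck_on k S (\<lambda>x. f' x v)))"

definition smooth_on :: "'a::euclidean_space set \<Rightarrow> ('a \<Rightarrow> 'b::real_normed_vector) \<Rightarrow> bool" where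
  "smooth_on S f \<longleftrightarrow> (\<forall>k. Ck_on k S f)"

text \<open>\<open>C\<^sub>c\<^sup>\<infinity>\<close> functions on an open set \<open>\<Omega>\<close>, extended by zero to the whole space.\<close>
definition test_functions :: "'a::euclidean_space set \<Rightarrow> ('a \<Rightarrow> 'b::real_normed_vector) set" where
  "test_functions \<Omega> =
     {\<phi>. smooth_on UNIV \<phi> \<and> (\<exists>K. compact K \<and> K \<subseteq> \<Omega> \<and> (\<forall>x. x \<notin> K \<longrightarrow> \<phi> x = 0))}"

primrec iter_deriv ::
    "'a list \<Rightarrow> ('a::euclidean_space \<Rightarrow> 'b::real_normed_vector) \<Rightarrow> 'a \<Rightarrow> 'b" where
  "iter_deriv [] f = f"
| "iter_deriv (v # vs) f = iter_deriv vs (\<lambda>x. frechet_derivative f (at x) v)"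

text \<open>
  Only the values of \<open>P\<close> on \<open>test_functions \<Omega>\<close> matter. Continuity is expressed by the usual seminorm
  estimate on each compact \<open>K \<subseteq> \<Omega>\<close>.
\<close>
definition distribution_on :: "'a::euclidean_space set \<Rightarrow> (('a \<Rightarrow> real) \<Rightarrow> real) \<Rightarrow> bool" where
  "distribution_on \<Omega> P \<longleftrightarrow>
     (\<forall>\<phi>\<in>test_functions \<Omega>. \<forall>\<psi>\<in>test_functions \<Omega>. \<forall>a b.
        P (\<lambda>x. a * \<phi> x + b * \<psi> x) = a * P \<phi> + b * P \<psi>) \<and>
     (\<forall>K. compact K \<and> K \<subseteq> \<Omega> \<longrightarrow>
        (\<exists>C N. \<forall>\<phi> B. smooth_on UNIV \<phi> \<and> (\<forall>x. x \<notin> K \<longrightarrow> \<phi> x = 0) \<and>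
            (\<forall>vs x. set vs \<subseteq> Basis \<and> length vs \<le> N \<longrightarrow> \<bar>iter_deriv vs \<phi> x\<bar> \<le> B)
          \<longrightarrow> \<bar>P \<phi>\<bar> \<le> C * B))"


section \<open>Classical differential operators on \<open>R3\<close>\<close>

definition pderiv3 :: "3 \<Rightarrow> (R3 \<Rightarrow> 'b::real_normed_vector) \<Rightarrow> R3 \<Rightarrow> 'b" where
  "pderiv3 j f x = frechet_derivative f (at x) (axis j 1)"

definition grad :: "(R3 \<Rightarrow> real) \<Rightarrow> R3 \<Rightarrow> R3" where
  "grad p x = (\<chi> j. pderiv3 j p x)"

definition divergence :: "(R3 \<Rightarrow> R3) \<Rightarrow> R3 \<Rightarrow> real" where
  "divergence f x = (\<Sum>j\<in>UNIV. pderiv3 j f x $ j)"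

definition laplacian :: "(R3 \<Rightarrow> 'b::real_normed_vector) \<Rightarrow> R3 \<Rightarrow> 'b" where
  "laplacian f x = (\<Sum>j\<in>UNIV. pderiv3 j (pderiv3 j f) x)"

text \<open>\<open>(w \<cdot> \<nabla>) f\<close>\<close>
definition advect :: "(R3 \<Rightarrow> R3) \<Rightarrow> (R3 \<Rightarrow> R3) \<Rightarrow> R3 \<Rightarrow> R3" where
  "advect w f x = (\<Sum>j\<in>UNIV. w x $ j *\<^sub>R pderiv3 j f x)"


section \<open>Function spaces and norms\<close>

text \<open>
  Elements of \<open>L\<^sup>2\<close> and related spaces are represented by functions; every notion below is invariant
  under modification on null sets. The norms of \<open>R3\<close> and \<open>real^3^3\<close> are the Euclidean and the Frobenius
  norm, so \<open>l2norm f\<close> is the square root of the sum of \<open>\<integral>\<bar>f\<^sub>i\<bar>\<^sup>2\<close>, respectively of \<open>\<integral>\<bar>f\<^sub>i\<^sub>j\<bar>\<^sup>2\<close>.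
\<close>
definition L2 :: "(R3 \<Rightarrow> 'b::euclidean_space) set" where
  "L2 = {f \<in> borel_measurable lebesgue. integrable lebesgue (\<lambda>x. (norm (f x))\<^sup>2)}"

definition l2norm :: "(R3 \<Rightarrow> 'b::euclidean_space) \<Rightarrow> real" where
  "l2norm f = sqrt (\<integral>x. (norm (f x))\<^sup>2 \<partial>lebesgue)"

definition l2inner :: "(R3 \<Rightarrow> 'b::euclidean_space) \<Rightarrow> (R3 \<Rightarrow> 'b) \<Rightarrow> real" where
  "l2inner f g = (\<integral>x. f x \<bullet> g x \<partial>lebesgue)"

definition L2_sigma :: "(R3 \<Rightarrow> R3) set" where
  "L2_sigma = {f \<in> L2. \<forall>\<phi>\<in>test_functions UNIV. l2inner f (grad \<phi>) = 0}"

definition linf_norm :: "(R3 \<Rightarrow> R3) \<Rightarrow> ereal" where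
  "linf_norm f = (MAX i. esssup lebesgue (\<lambda>x. ereal \<bar>f x $ i\<bar>))"

text \<open>\<open>A x $ i $ j\<close> is the weak derivative \<open>D\<^sub>j f\<^sub>i\<close>.\<close>
definition has_weak_jacobian :: "(R3 \<Rightarrow> R3) \<Rightarrow> (R3 \<Rightarrow> real^3^3) \<Rightarrow> bool" where
  "has_weak_jacobian f A \<longleftrightarrow>
     (\<forall>K. compact K \<longrightarrow> set_integrable lebesgue K f \<and> set_integrable lebesgue K A) \<and>
     (\<forall>\<phi>\<in>test_functions UNIV. \<forall>i j.
        (\<integral>x. f x $ i * pderiv3 j \<phi> x \<partial>lebesgue) = - (\<integral>x. A x $ i $ j * \<phi> x \<partial>lebesgue))"

definition heat_kernel :: "real \<Rightarrow> R3 \<Rightarrow> real" where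
  "heat_kernel \<tau> x = (4 * pi * \<tau>) powr (-3/2) * exp (- (norm x)\<^sup>2 / (4 * \<tau>))"

definition convolution :: "(R3 \<Rightarrow> real) \<Rightarrow> (R3 \<Rightarrow> R3) \<Rightarrow> R3 \<Rightarrow> R3" where
  "convolution g f x = (\<integral>y. g (x - y) *\<^sub>R f y \<partial>lebesgue)"

definition heat_semigroup :: "real \<Rightarrow> (R3 \<Rightarrow> R3) \<Rightarrow> R3 \<Rightarrow> R3" where
  "heat_semigroup \<tau> f = (if \<tau> = 0 then f else convolution (heat_kernel \<tau>) f)"


section \<open>Leray--Hopf solutions\<close>

definition mollifier :: "(R3 \<Rightarrow> real) \<Rightarrow> real \<Rightarrow> R3 \<Rightarrow> real" where
  "mollifier G \<delta> x = G (x /\<^sub>R \<delta>) / \<delta> ^ 3"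

text \<open>
  A global classical \<open>L\<^sup>2\<close> solution \<open>(w, p)\<close> of the equation regularised by \<open>g\<close>, with initial value \<open>a\<close>:
  \<open>w\<close> is a continuous curve in \<open>L\<^sup>2\<close>, and \<open>p(\<cdot>,t) \<in> L\<^sup>2\<close> fixes the otherwise free additive function
  of \<open>t\<close> in the pressure.
\<close>
definition regularized_solution ::
    "(R3 \<Rightarrow> real) \<Rightarrow> (R3 \<Rightarrow> R3) \<Rightarrow> (real \<Rightarrow> R3 \<Rightarrow> R3) \<Rightarrow> (real \<Rightarrow> R3 \<Rightarrow> real) \<Rightarrow> bool" where
  "regularized_solution g a w p \<longleftrightarrow>
     smooth_on (UNIV \<times> {0..}) (\<lambda>(x, t). w t x) \<and>
     smooth_on (UNIV \<times> {0..}) (\<lambda>(x, t). p t x) \<and>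
     (\<forall>t\<ge>0. w t \<in> L2 \<and> p t \<in> L2) \<and>
     (\<forall>t\<ge>0. ((\<lambda>s. l2norm (\<lambda>x. w s x - w t x)) \<longlongrightarrow> 0) (at t within {0..})) \<and>
     (\<forall>t\<ge>0. \<forall>x.
        vector_derivative (\<lambda>s. w s x) (at t within {0..})
          + advect (convolution g (w t)) (w t) x + grad (p t) x = laplacian (w t) x) \<and>
     (\<forall>t\<ge>0. \<forall>x. divergence (w t) x = 0) \<and>
     (\<forall>x. w 0 x = a x)"

definition leray_approximable :: "(R3 \<Rightarrow> R3) \<Rightarrow> (real \<Rightarrow> R3 \<Rightarrow> R3) \<Rightarrow> bool" where
  "leray_approximable u0 u \<longleftrightarrow>
     (\<exists>G w p d.
        G \<in> test_functions UNIV \<and> (\<forall>x. 0 \<le> G x) \<and> (\<integral>x. G x \<partial>lebesgue) = 1 \<and>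
        (\<forall>\<delta>>0. regularized_solution (mollifier G \<delta>) (convolution (mollifier G \<delta>) u0) (w \<delta>) (p \<delta>)) \<and>
        (\<forall>n::nat. 0 < d n) \<and> d \<longlonglongrightarrow> 0 \<and>
        (\<forall>t\<ge>0. \<forall>h\<in>L2. (\<lambda>n. l2inner (w (d n) t) h) \<longlonglongrightarrow> l2inner (u t) h))"

text \<open>
  \<open>u\<^sub>t + u \<cdot> \<nabla>u + \<nabla>p = \<Delta>u\<close> in the sense of distributions on \<open>R3 \<times> (0,\<infinity>)\<close>, for some distribution \<open>p\<close>;
  \<open>Du\<close> is the weak Jacobian of \<open>u\<close>, so \<open>Du t x *v u t x\<close> is \<open>(u \<cdot> \<nabla>u)(x,t)\<close>.
\<close>
definition momentum_equation :: "(real \<Rightarrow> R3 \<Rightarrow> R3) \<Rightarrow> (real \<Rightarrow> R3 \<Rightarrow> real^3^3) \<Rightarrow> bool" where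
  "momentum_equation u Du \<longleftrightarrow>
     (\<exists>P. distribution_on (UNIV \<times> {0<..}) P \<and>
        (\<forall>\<phi> :: R3 \<times> real \<Rightarrow> R3. \<phi> \<in> test_functions (UNIV \<times> {0<..}) \<longrightarrow>
           has_bochner_integral (lebesgue_on {0<..})
             (\<lambda>t. \<integral>x. - (u t x \<bullet> vector_derivative (\<lambda>s. \<phi> (x, s)) (at t))
                      + (Du t x *v u t x) \<bullet> \<phi> (x, t)
                      - u t x \<bullet> laplacian (\<lambda>y. \<phi> (y, t)) x \<partial>lebesgue)
             (P (\<lambda>(x, t). divergence (\<lambda>y. \<phi> (y, t)) x))))"

text \<open>
  \<open>u t\<close> represents \<open>u(\<cdot>,t) \<in> L\<^sup>2\<close> for each single \<open>t \<ge> 0\<close>; values at negative times are irrelevant.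
  Space-time integrals are iterated ones whose inner integral depends only on the \<open>L\<^sup>2\<close> class of
  \<open>u(\<cdot>,t)\<close>, and weak continuity makes them measurable in \<open>t\<close>. So no joint measurability of the chosen
  representatives is needed.
\<close>
definition leray_hopf_solution :: "(R3 \<Rightarrow> R3) \<Rightarrow> (real \<Rightarrow> R3 \<Rightarrow> R3) \<Rightarrow> bool" where
  "leray_hopf_solution u0 u \<longleftrightarrow>
     (\<forall>t\<ge>0. u t \<in> L2_sigma) \<and>
     (\<exists>C. \<forall>t\<ge>0. l2norm (u t) \<le> C) \<and>
     (\<forall>h\<in>L2. continuous_on {0..} (\<lambda>t. l2inner (u t) h)) \<and>
     ((\<lambda>t. l2norm (\<lambda>x. u t x - u0 x)) \<longlongrightarrow> 0) (at_right 0) \<and>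
     (\<exists>Du.
        (AE t in lebesgue_on {0..}. has_weak_jacobian (u t) (Du t) \<and> Du t \<in> L2) \<and>
        integrable (lebesgue_on {0..}) (\<lambda>t. (l2norm (Du t))\<^sup>2) \<and>
        momentum_equation u Du \<and>
        (\<forall>t\<ge>0. (l2norm (u t))\<^sup>2 + 2 * (\<integral>s. (l2norm (Du s))\<^sup>2 \<partial>lebesgue_on {0..t})
                   \<le> (l2norm u0)\<^sup>2)) \<and>
     leray_approximable u0 u"

end

theory Submission
  imports Defs "HOL-Probability.Distributions"
begin

text \<open>
  By Duhamel's formula \<open>v - v'\<close> at time \<open>t\<close> is the integral over \<open>s \<in> {t0..t0'}\<close> of the heat flow for the
  time \<open>t - s\<close> applied to the Leray projection of \<open>u \<cdot> \<nabla>u\<close> at time \<open>s\<close>. The kernel of this operator, the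
  Oseen kernel, is a symmetric matrix at each point, and its norm never exceeds the peak
  \<open>(4 * pi * (t - s)) powr (-3/2)\<close> of the heat kernel. The integrand is therefore at most
  \<open>\<Gamma> * (t - t0') powr (-3/2) * l2norm (Du s) * l2norm (u s)\<close> at every point. Now \<open>l2norm (u s)\<close> is at most
  \<open>l2norm u0\<close>, and the energy inequality bounds the integral of \<open>(l2norm (Du s))\<^sup>2\<close> by
  \<open>(l2norm u0)\<^sup>2 / 2\<close>, so the Cauchy--Schwarz inequality in time gives the claim, including the constant.

  Duhamel's formula is obtained from the weak formulation, with a truncated Oseen kernel times a window
  in time as test function. For a unit vector \<open>e\<close> and any radial function \<open>g\<close>, the curl of \<open>g\<close> times
  the cross product of \<open>e\<close> and \<open>z\<close> is solenoidal, so that the pressure disappears, and differs from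
  a radial multiple of \<open>e\<close> by the gradient of \<open>g * (e \<bullet> z)\<close>, which is orthogonal to solenoidal fields
  (\<open>oseen_field_plus_grad\<close>). If \<open>g\<close> is the suitably scaled function \<open>gauss_moment 1\<close>, then this multiple is
  the heat kernel, and the curl solves the backward heat equation. If \<open>g\<close> is cut off where its
  argument, the squared distance over \<open>4 * (t - s)\<close>, is about \<open>N\<close>, then the first two properties persist
  and the backward heat equation holds up to a defect of order \<open>1 / N\<close> (\<open>cut_profile_bounds\<close>,
  \<open>DERIV_oseen_field\<close>). Its support has a volume of order \<open>N powr (3/2)\<close>, whence it tends to \<open>0\<close> in
  \<open>L\<^sup>2\<close>.

  The bound of the kernel is \<open>norm_oseen_field_le\<close>: the eigenvalues of the matrix are explicit
  in terms of \<open>g\<close> and its derivative. The weak formulation enters in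
  \<open>window_average_le\<close>. Shrinking the window (\<open>endpoint_difference_le\<close>) and letting \<open>N\<close> tend to infinity
  leads to \<open>heat_pairing_increment_le\<close>, which is the estimate for one component of \<open>v - v'\<close> at one point.
\<close>

section \<open>Calculus of \<open>C\<^sup>k\<close> functions\<close>

lemma Ck_on_SucI:
  assumes "\<And>x. x \<in> S \<Longrightarrow> (f has_derivative f' x) (at x within S)" "\<And>v. Ck_on k S (\<lambda>x. f' x v)"
  shows "Ck_on (Suc k) S f"
  using assms by auto

lemma Ck_on_cong:
  assumes "\<And>x. x \<in> S \<Longrightarrow> f x = g x"
  shows "Ck_on k S f \<longleftrightarrow> Ck_on k S g"
proof (cases k)
  case 0
  then show ?thesis using assms by (simp cong: continuous_on_cong)
next
  case (Suc m)
  have "(f has_derivative f') (at x within S) \<longleftrightarrow> (g has_derivative f') (at x within S)"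
    if "x \<in> S" for x f'
    using assms that by (metis has_derivative_transform)
  with Suc show ?thesis by auto
qed

lemma Ck_on_Suc_imp: "Ck_on (Suc k) S f \<Longrightarrow> Ck_on k S f"
proof (induction k arbitrary: f)
  case 0
  then show ?case by (auto intro: has_derivative_continuous_on)
next
  case (Suc k)
  then obtain f' where "\<And>x. x \<in> S \<Longrightarrow> (f has_derivative f' x) (at x within S)"
    "\<And>v. Ck_on (Suc k) S (\<lambda>x. f' x v)"
    by (auto simp del: Ck_on.simps simp: Ck_on.simps(2)[of "Suc k"])
  with Suc.IH show ?case by (intro Ck_on_SucI) blast+
qed

lemma Ck_on_subset: "Ck_on k S f \<Longrightarrow> T \<subseteq> S \<Longrightarrow> Ck_on k T f"
proof (induction k arbitrary: f)
  case 0
  then show ?case by (auto intro: continuous_on_subset)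
next
  case (Suc k)
  then obtain f' where "\<And>x. x \<in> S \<Longrightarrow> (f has_derivative f' x) (at x within S)"
    "\<And>v. Ck_on k S (\<lambda>x. f' x v)" by auto
  with Suc show ?case by (intro Ck_on_SucI[of T f f']) (auto intro: has_derivative_subset)
qed

lemma Ck_on_const: "Ck_on k S (\<lambda>x. c)"
proof (induction k arbitrary: c)
  case (Suc k)
  then show ?case by (intro Ck_on_SucI[where f'="\<lambda>x v. 0"]) auto
qed simp

lemma Ck_on_bounded_linear: "bounded_linear f \<Longrightarrow> Ck_on k S f"
proof (cases k)
  case 0
  assume "bounded_linear f"
  with 0 show ?thesis by (auto intro: linear_continuous_on)
next
  case (Suc m)
  assume "bounded_linear f"
  with Suc show ?thesis
    by (auto intro!: exI[of _ "\<lambda>x. f"] bounded_linear_imp_has_derivative Ck_on_const)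
qed

lemma Ck_on_add: "Ck_on k S f \<Longrightarrow> Ck_on k S g \<Longrightarrow> Ck_on k S (\<lambda>x. f x + g x)"
proof (induction k arbitrary: f g)
  case 0
  then show ?case by (auto intro: continuous_intros)
next
  case (Suc k)
  obtain f' where f: "\<And>x. x \<in> S \<Longrightarrow> (f has_derivative f' x) (at x within S)"
    "\<And>v. Ck_on k S (\<lambda>x. f' x v)" using Suc.prems by auto
  obtain g' where g: "\<And>x. x \<in> S \<Longrightarrow> (g has_derivative g' x) (at x within S)"
    "\<And>v. Ck_on k S (\<lambda>x. g' x v)" using Suc.prems by auto
  show ?case
    by (rule Ck_on_SucI[where f'="\<lambda>x v. f' x v + g' x v"])
       (auto intro: f g Suc.IH has_derivative_add)
qed

lemma Ck_on_bilinear: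
  assumes "bounded_bilinear pr"
  shows "Ck_on k S f \<Longrightarrow> Ck_on k S g \<Longrightarrow> Ck_on k S (\<lambda>x. pr (f x) (g x))"
proof (induction k arbitrary: f g)
  case 0
  then show ?case by (auto intro: bounded_bilinear.continuous_on[OF assms])
next
  case (Suc k)
  obtain f' where f: "\<And>x. x \<in> S \<Longrightarrow> (f has_derivative f' x) (at x within S)"
    "\<And>v. Ck_on k S (\<lambda>x. f' x v)" using Suc.prems by auto
  obtain g' where g: "\<And>x. x \<in> S \<Longrightarrow> (g has_derivative g' x) (at x within S)"
    "\<And>v. Ck_on k S (\<lambda>x. g' x v)" using Suc.prems by auto
  note low = Ck_on_Suc_imp[OF Suc.prems(1)] Ck_on_Suc_imp[OF Suc.prems(2)]
  show ?case
    by (rule Ck_on_SucI[where f'="\<lambda>x v. pr (f x) (g' x v) + pr (f' x v) (g x)"])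
       (auto intro!: f g low Suc.IH Ck_on_add bounded_bilinear.FDERIV[OF assms])
qed

lemmas Ck_on_mult = Ck_on_bilinear[OF bounded_bilinear_mult]
lemmas Ck_on_scaleR = Ck_on_bilinear[OF bounded_bilinear_scaleR]
lemmas Ck_on_inner = Ck_on_bilinear[OF bounded_bilinear_inner]

lemma Ck_on_minus: "Ck_on k S f \<Longrightarrow> Ck_on k S (\<lambda>x. - f x)"
  using Ck_on_scaleR[OF Ck_on_const[of k S "-1::real"], of f] by simp

lemma Ck_on_diff: "Ck_on k S f \<Longrightarrow> Ck_on k S g \<Longrightarrow> Ck_on k S (\<lambda>x. f x - g x)"
  using Ck_on_add[OF _ Ck_on_minus, of k S f g] by simp

lemma Ck_on_compose_real:
  fixes p :: "real \<Rightarrow> real"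
  shows "Ck_on k T p \<Longrightarrow> Ck_on k S f \<Longrightarrow> f ` S \<subseteq> T \<Longrightarrow> Ck_on k S (\<lambda>x. p (f x))"
proof (induction k arbitrary: p)
  case 0
  then show ?case by (auto intro: continuous_on_compose2)
next
  case (Suc k)
  obtain f' where f: "\<And>x. x \<in> S \<Longrightarrow> (f has_derivative f' x) (at x within S)"
    "\<And>v. Ck_on k S (\<lambda>x. f' x v)" using Suc.prems(2) by auto
  obtain p' where p: "\<And>x. x \<in> T \<Longrightarrow> (p has_derivative p' x) (at x within T)"
    "\<And>v. Ck_on k T (\<lambda>x. p' x v)" using Suc.prems(1) by auto
  show ?case
  proof (rule Ck_on_SucI[where f'="\<lambda>x v. f' x v * p' (f x) 1"])
    fix x assume x: "x \<in> S"
    then have fx: "f x \<in> T" using Suc.prems by auto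
    have "((\<lambda>x. p (f x)) has_derivative (\<lambda>v. p' (f x) (f' x v))) (at x within S)"
      by (rule has_derivative_in_compose[OF f(1)[OF x] has_derivative_subset[OF p(1)[OF fx] Suc.prems(3)]])
    moreover have "p' (f x) c = c * p' (f x) 1" for c
      using linear.scaleR[OF has_derivative_linear[OF p(1)[OF fx]], of c 1] by simp
    then have "(\<lambda>v. p' (f x) (f' x v)) = (\<lambda>v. f' x v * p' (f x) 1)" by metis
    ultimately show "((\<lambda>x. p (f x)) has_derivative (\<lambda>v. f' x v * p' (f x) 1)) (at x within S)"
      by simp
  next
    fix v
    have "Ck_on k S (\<lambda>x. p' (f x) 1)"
      by (rule Suc.IH[OF p(2) Ck_on_Suc_imp[OF Suc.prems(2)] Suc.prems(3)])
    then show "Ck_on k S (\<lambda>x. f' x v * p' (f x) 1)"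
      by (intro Ck_on_mult f(2))
  qed
qed

text \<open>
  On the real line a single function carries the derivative, so every family of functions that is
  closed under differentiation consists of smooth functions, by induction on \<open>k\<close>.
\<close>
lemma Ck_on_real_SucI:
  fixes f :: "real \<Rightarrow> real"
  assumes "\<And>x. x \<in> S \<Longrightarrow> (f has_real_derivative f' x) (at x within S)" "Ck_on k S f'"
  shows "Ck_on (Suc k) S f"
  by (rule Ck_on_SucI[where f'="\<lambda>x v. f' x * v"])
     (use assms in \<open>auto simp: has_field_derivative_def intro: Ck_on_mult Ck_on_const\<close>)

text \<open>
  A kernel that is smooth only before a final time becomes a test function in this way, once it is
  multiplied by a window in time. The induction goes through because the derivatives are again of
  this form: they vanish off \<open>C\<close>, since \<open>f\<close> is zero on the open set \<open>- C\<close>.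
\<close>
lemma Ck_on_extend_by_zero:
  assumes "open U" "closed C" "C \<subseteq> U" "Ck_on k U f" "\<And>x. x \<notin> C \<Longrightarrow> f x = 0"
  shows "Ck_on k UNIV f"
  using assms(4,5)
proof (induction k arbitrary: f)
  case 0
  have "continuous (at x) f" for x
  proof (cases "x \<in> C")
    case True
    with 0 assms(1,3) show ?thesis by (auto simp: continuous_on_eq_continuous_at)
  next
    case False
    then have "eventually (\<lambda>y. y \<in> - C) (nhds x)"
      using assms(2) by (intro eventually_nhds_in_open) auto
    then have "eventually (\<lambda>y. f y = 0) (nhds x)"
      by eventually_elim (use 0 in auto)
    then show ?thesis by (simp add: isCont_cong)
  qed
  then show ?case by (simp add: continuous_at_imp_continuous_on)
next
  case (Suc k)
  obtain f' where f: "\<And>x. x \<in> U \<Longrightarrow> (f has_derivative f' x) (at x within U)"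
    "\<And>v. Ck_on k U (\<lambda>x. f' x v)" using Suc.prems by auto
  have off: "(f has_derivative (\<lambda>v. 0)) (at x)" if "x \<notin> C" for x
    by (rule has_derivative_transform_within_open[where s="-C" and f="\<lambda>x. 0"])
       (use that assms(2) Suc.prems(2) in auto)
  have on: "(f has_derivative f' x) (at x)" if "x \<in> U" for x
    using f(1)[OF that] by (simp add: at_within_open[OF that assms(1)])
  have zero: "f' x = (\<lambda>v. 0)" if "x \<in> U" "x \<notin> C" for x
    by (rule has_derivative_unique[OF on[OF that(1)] off[OF that(2)]])
  show ?case
  proof (rule Ck_on_SucI[where f'="\<lambda>x v. if x \<in> U then f' x v else 0"])
    show "(f has_derivative (\<lambda>v. if x \<in> U then f' x v else 0)) (at x)" for x
    proof (cases "x \<in> U")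
      case True
      then show ?thesis using on[OF True] by simp
    next
      case False
      then show ?thesis using off[of x] assms(3) by auto
    qed
    fix v
    have "Ck_on k U (\<lambda>x. if x \<in> U then f' x v else 0)"
      using f(2)[of v] by (subst Ck_on_cong[of U _ "\<lambda>x. f' x v"]) auto
    then show "Ck_on k UNIV (\<lambda>x. if x \<in> U then f' x v else 0)"
      by (rule Suc.IH) (use zero in auto)
  qed
qed

lemma smooth_on_deriv:
  fixes f :: "real \<Rightarrow> real"
  assumes "smooth_on UNIV f"
  shows "(f has_real_derivative deriv f x) (at x)" "smooth_on UNIV (deriv f)"
proof -
  have *: "((f has_real_derivative deriv f x) (at x)) \<and> Ck_on k UNIV (deriv f)" for k x
  proof -
    have "Ck_on (Suc k) UNIV f" using assms by (simp add: smooth_on_def del: Ck_on.simps)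
    then obtain f' where f: "\<And>x. (f has_derivative f' x) (at x)" "\<And>v. Ck_on k UNIV (\<lambda>x. f' x v)"
      by auto
    have D: "(f has_real_derivative f' x 1) (at x)" for x
    proof -
      have "f' x v = f' x 1 * v" for v
        using linear.scaleR[OF has_derivative_linear[OF f(1)], of x v 1] by simp
      then have "f' x = (*) (f' x 1)" by blast
      then show ?thesis using f(1)[of x] unfolding has_field_derivative_def by simp
    qed
    then have "deriv f = (\<lambda>x. f' x 1)" by (auto intro: DERIV_imp_deriv)
    with D f(2) show ?thesis by simp
  qed
  then show "(f has_real_derivative deriv f x) (at x)" "smooth_on UNIV (deriv f)"
    by (auto simp: smooth_on_def)
qed

lemma Ck_on_powr: "Ck_on k {0<..} (\<lambda>x::real. x powr r)"
proof (induction k arbitrary: r)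
  case 0
  show ?case by (auto intro!: continuous_intros)
next
  case (Suc k)
  show ?case
    by (rule Ck_on_real_SucI[where f'="\<lambda>x. r * x powr (r - 1)"])
       (auto intro!: has_real_derivative_powr' Ck_on_mult Ck_on_const Suc.IH
             has_real_derivative_powr[THEN DERIV_subset])
qed

section \<open>A smooth step\<close>

text \<open>
  The denominators \<open>x ^ n\<close> are included to have a family that is closed under differentiation, up to
  linear combinations; \<open>flat_exp 0\<close> is the classical smooth function that is flat at \<open>0\<close>.
\<close>
definition flat_exp :: "nat \<Rightarrow> real \<Rightarrow> real" where
  "flat_exp n x = (if x \<le> 0 then 0 else exp (- (1 / x)) / x ^ n)"

lemma flat_exp_tendsto_0: "(flat_exp n \<longlongrightarrow> 0) (at_right 0)"
proof -
  have "((\<lambda>x::real. x ^ n / exp x) \<longlongrightarrow> 0) at_top" by (rule tendsto_power_div_exp_0)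
  then have "((\<lambda>x::real. (inverse x) ^ n / exp (inverse x)) \<longlongrightarrow> 0) (at_right 0)"
    by (rule filterlim_compose[OF _ filterlim_inverse_at_top_right])
  then show ?thesis
    by (rule Lim_transform_eventually)
       (auto simp: eventually_at_filter flat_exp_def exp_minus field_simps)
qed

lemma flat_exp_deriv:
  "(flat_exp n has_real_derivative flat_exp (n + 2) x - n * flat_exp (n + 1) x) (at x)"
proof -
  consider "x < 0" | "x = 0" | "x > 0" by linarith
  then show ?thesis
  proof cases
    case 1
    have "((\<lambda>x. 0) has_real_derivative 0) (at x)" by simp
    then have "(flat_exp n has_real_derivative 0) (at x)"
      by (rule has_field_derivative_transform_within_open[where S="{..<0}"])
         (use 1 in \<open>auto simp: flat_exp_def\<close>)
    then show ?thesis using 1 by (simp add: flat_exp_def)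
  next
    case 2
    have "((\<lambda>y. flat_exp n y / y) \<longlongrightarrow> 0) (at_right 0)"
      by (rule Lim_transform_eventually[OF flat_exp_tendsto_0[of "n+1"]])
         (auto simp: eventually_at_filter flat_exp_def field_simps)
    moreover have "((\<lambda>y. flat_exp n y / y) \<longlongrightarrow> 0) (at_left 0)"
      by (rule Lim_transform_eventually[OF tendsto_const])
         (auto simp: eventually_at_filter flat_exp_def)
    ultimately have "((\<lambda>y. flat_exp n y / y) \<longlongrightarrow> 0) (at 0)"
      by (simp add: filterlim_split_at)
    then show ?thesis using 2 by (simp add: has_field_derivative_iff flat_exp_def)
  next
    case 3
    have "((\<lambda>x. exp (- (1 / x)) / x ^ n) has_real_derivative
        flat_exp (n + 2) x - n * flat_exp (n + 1) x) (at x)"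
      using 3 by (auto intro!: derivative_eq_intros simp: flat_exp_def)
         (cases n; simp add: field_simps power2_eq_square)
    then show ?thesis
      by (rule has_field_derivative_transform_within_open[where S="{0<..}"])
         (use 3 in \<open>auto simp: flat_exp_def\<close>)
  qed
qed

lemma Ck_on_flat_exp: "Ck_on k UNIV (flat_exp n)"
proof (induction k arbitrary: n)
  case 0
  then show ?case
    by (auto intro!: continuous_at_imp_continuous_on DERIV_isCont[OF flat_exp_deriv])
next
  case (Suc k)
  show ?case
    by (rule Ck_on_real_SucI[where f'="\<lambda>x. flat_exp (n + 2) x - n * flat_exp (n + 1) x"])
       (rule flat_exp_deriv Ck_on_diff[OF Suc.IH Ck_on_mult[OF Ck_on_const Suc.IH]])+
qed

text \<open>
  A normalised antiderivative of the bump \<open>b\<close>, which is positive exactly between \<open>1\<close> and \<open>2\<close>.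
\<close>
lemma smooth_step_exists:
  "\<exists>S :: real \<Rightarrow> real. smooth_on UNIV S \<and> mono S \<and> (\<forall>x\<le>1. S x = 0) \<and> (\<forall>x\<ge>2. S x = 1)"
proof -
  define b where "b x = flat_exp 0 (x - 1) * flat_exp 0 (2 - x)" for x :: real
  have bCk: "Ck_on k UNIV b" for k
    unfolding b_def
    by (intro Ck_on_mult Ck_on_compose_real[OF Ck_on_flat_exp] Ck_on_diff Ck_on_const
        Ck_on_bounded_linear bounded_linear_ident) auto
  have bcont: "continuous_on A b" for A
    using Ck_on_subset[OF bCk[of 0], of A] by simp
  have b0: "b x \<ge> 0" for x by (simp add: b_def flat_exp_def)
  have b_out: "b x = 0" if "x \<le> 1 \<or> x \<ge> 2" for x using that by (auto simp: b_def flat_exp_def)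
  define B where "B x = integral {0..x} b" for x
  have B0: "B x = 0" if "x \<le> 1" for x
    unfolding B_def using integral_cong[of "{0..x}" b "\<lambda>x. 0"] b_out that by simp
  have BD: "(B has_real_derivative b x) (at x)" for x
  proof (cases "x < 1")
    case True
    have "((\<lambda>x. 0) has_real_derivative 0) (at x)" by simp
    then have "(B has_real_derivative 0) (at x)"
      by (rule has_field_derivative_transform_within_open[where S="{..<1}"])
         (use True B0 in auto)
    then show ?thesis using b_out True by simp
  next
    case False
    have "(B has_real_derivative b x) (at x within {0..x+1})"
      unfolding B_def by (rule integral_has_real_derivative) (use False bcont in auto)
    then show ?thesis using False by (simp add: at_within_Icc_at)
  qed
  have Bmono: "B x \<le> B y" if "x \<le> y" for x y
    by (rule DERIV_nonneg_imp_nondecreasing[OF that]) (use BD b0 in blast)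
  have B2: "B x = B 2" if "x \<ge> 2" for x
  proof (cases "x = 2")
    case False
    with that have x: "2 < x" by simp
    have c: "continuous_on {2..x} B"
      by (intro continuous_at_imp_continuous_on ballI DERIV_isCont[OF BD])
    have d: "(B has_real_derivative 0) (at y)" if "2 < y" "y < x" for y
      using BD[of y] b_out[of y] that by simp
    show ?thesis by (rule DERIV_isconst_end[OF x c d])
  qed simp
  have "B 1 < B 2"
  proof (rule DERIV_pos_imp_increasing_open[of 1 2])
    show "\<exists>y. (B has_real_derivative y) (at x) \<and> y > 0" if "1 < x" "x < 2" for x
      using BD[of x] that by (intro exI[of _ "b x"]) (auto simp: b_def flat_exp_def)
  qed (auto intro!: continuous_at_imp_continuous_on DERIV_isCont[OF BD])
  then have pos: "B 2 > 0" using B0 by simp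
  have "Ck_on k UNIV (\<lambda>x. B x / B 2)" for k
  proof -
    have "Ck_on (Suc k) UNIV B" by (rule Ck_on_real_SucI[OF _ bCk]) (use BD in auto)
    then have "Ck_on k UNIV (\<lambda>x. inverse (B 2) * B x)"
      by (intro Ck_on_mult[OF Ck_on_const Ck_on_Suc_imp])
    then show ?thesis by (simp add: field_simps)
  qed
  then have "smooth_on UNIV (\<lambda>x. B x / B 2)" by (simp add: smooth_on_def)
  moreover have "mono (\<lambda>x. B x / B 2)"
    using pos Bmono by (intro monoI divide_right_mono) auto
  moreover have "B x / B 2 = 1" if "x \<ge> 2" for x
    unfolding B2[OF that] using pos by simp
  moreover have "B x / B 2 = 0" if "x \<le> 1" for x
    using B0[OF that] by simp
  ultimately show ?thesis by blast
qed

definition smooth_step :: "real \<Rightarrow> real" where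
  "smooth_step = (SOME S. smooth_on UNIV S \<and> mono S \<and> (\<forall>x\<le>1. S x = 0) \<and> (\<forall>x\<ge>2. S x = 1))"

definition step_deriv :: "nat \<Rightarrow> real \<Rightarrow> real" where
  "step_deriv j = (deriv ^^ j) smooth_step"

lemma smooth_step:
  shows smooth_on_step: "smooth_on UNIV smooth_step" and mono_step: "mono smooth_step"
    and step_eq_0: "x \<le> 1 \<Longrightarrow> smooth_step x = 0" and step_eq_1: "x \<ge> 2 \<Longrightarrow> smooth_step x = 1"
  using someI_ex[OF smooth_step_exists] unfolding smooth_step_def[symmetric] by auto

lemma step_bounds: "0 \<le> smooth_step x" "smooth_step x \<le> 1"
  using monoD[OF mono_step, of "min x 1" x] monoD[OF mono_step, of x "max x 2"]
    step_eq_0[of "min x 1"] step_eq_1[of "max x 2"] by auto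

lemma smooth_on_step_deriv: "smooth_on UNIV (step_deriv j)"
  by (induction j) (auto simp: step_deriv_def intro: smooth_on_step smooth_on_deriv)

lemma DERIV_step_deriv:
  "(step_deriv j has_real_derivative step_deriv (Suc j) x) (at x)"
  using smooth_on_deriv(1)[OF smooth_on_step_deriv, of j x] by (simp add: step_deriv_def)

lemma step_deriv_0: "step_deriv 0 = smooth_step"
  by (simp add: step_deriv_def)

lemma step_deriv_outside:
  assumes "x < 1 \<or> x > 2"
  shows "step_deriv (Suc j) x = 0"
  using assms
proof (induction j arbitrary: x)
  case 0
  define c :: real where "c = (if x < 1 then 0 else 1)"
  have "((\<lambda>x. c) has_real_derivative 0) (at x)" by simp
  then have "(smooth_step has_real_derivative 0) (at x)"
    by (rule has_field_derivative_transform_within_open[where S="if x < 1 then {..<1} else {2<..}"])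
       (use 0 in \<open>auto simp: c_def step_eq_0 step_eq_1\<close>)
  then show ?case
    using DERIV_step_deriv[of 0 x] by (auto simp: step_deriv_0 intro: DERIV_unique)
next
  case (Suc j)
  have "((\<lambda>x. 0) has_real_derivative 0) (at x)" by simp
  then have "(step_deriv (Suc j) has_real_derivative 0) (at x)"
    by (rule has_field_derivative_transform_within_open[where S="if x < 1 then {..<1} else {2<..}"])
       (use Suc in auto)
  then show ?case using DERIV_step_deriv[of "Suc j" x] by (auto intro: DERIV_unique)
qed

lemma step_deriv_nonneg: "step_deriv 1 x \<ge> 0"
proof -
  have "(smooth_step has_real_derivative step_deriv 1 x) (at x)"
    using DERIV_step_deriv[of 0 x] by (simp add: step_deriv_0)
  from mono_on_imp_deriv_nonneg[OF mono_step this] show ?thesis by simp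
qed

lemma continuous_step_deriv: "continuous_on A (step_deriv j)"
  by (intro continuous_at_imp_continuous_on ballI DERIV_isCont[OF DERIV_step_deriv])

lemma step_deriv_bounded: "\<exists>C. \<forall>x. \<bar>step_deriv j x\<bar> \<le> C"
proof (cases j)
  case 0
  have "\<bar>smooth_step x\<bar> \<le> 1" for x using step_bounds[of x] by linarith
  with 0 show ?thesis unfolding step_deriv_0[symmetric] by blast
next
  case (Suc i)
  have "bounded (step_deriv j ` {1..2})"
    by (rule compact_imp_bounded[OF compact_continuous_image[OF continuous_step_deriv]]) simp
  then obtain C where "\<forall>y\<in>step_deriv j ` {1..2}. \<bar>y\<bar> \<le> C"
    by (auto simp: bounded_iff)
  then have C: "\<bar>step_deriv j x\<bar> \<le> C" if "1 \<le> x" "x \<le> 2" for x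
    using that by auto
  have "\<bar>step_deriv j x\<bar> \<le> max C 0" for x
    using C[of x] step_deriv_outside[of x i] unfolding Suc by (cases "1 \<le> x \<and> x \<le> 2") auto
  then show ?thesis by (intro exI allI)
qed

section \<open>The radial profile\<close>

text \<open>
  In the variable \<open>a = (norm x)\<^sup>2\<close>, \<open>gauss_moment 1 a\<close> is a third of the mean of the Gaussian
  \<open>exp (- (norm y)\<^sup>2)\<close> over the ball of radius \<open>norm x\<close>. Hence \<open>gauss_moment 1 ((norm x)\<^sup>2) *\<^sub>R x\<close> is
  the radial vector field whose divergence is the Gaussian. The higher moments are, up to sign, the
  derivatives of this one.
\<close>
definition gauss_moment :: "nat \<Rightarrow> real \<Rightarrow> real" where
  "gauss_moment k a = integral {0..1} (\<lambda>\<sigma>. \<sigma> ^ (2 * k) * exp (- (\<sigma>\<^sup>2 * a)))"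

lemma gauss_moment_integrable:
  "(\<lambda>\<sigma>::real. \<sigma> ^ (2 * k) * exp (- (\<sigma>\<^sup>2 * a))) integrable_on {0..1}"
  by (intro integrable_continuous_interval continuous_intros)

lemma DERIV_gauss_moment:
  "(gauss_moment k has_real_derivative - gauss_moment (Suc k) a) (at a)"
proof -
  have "((\<lambda>a. integral (cbox 0 1) (\<lambda>\<sigma>. \<sigma> ^ (2 * k) * exp (- (\<sigma>\<^sup>2 * a)))) has_real_derivative
      integral (cbox 0 1) (\<lambda>\<sigma>. - (\<sigma> ^ (2 * Suc k) * exp (- (\<sigma>\<^sup>2 * a))))) (at a within UNIV)"
  proof (rule leibniz_rule_field_derivative)
    show "((\<lambda>a. \<sigma> ^ (2 * k) * exp (- (\<sigma>\<^sup>2 * a))) has_real_derivative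
        - (\<sigma> ^ (2 * Suc k) * exp (- (\<sigma>\<^sup>2 * a)))) (at a)" for a \<sigma> :: real
      by (auto intro!: derivative_eq_intros simp: power2_eq_square)
    show "(\<lambda>\<sigma>. \<sigma> ^ (2 * k) * exp (- (\<sigma>\<^sup>2 * a))) integrable_on cbox 0 1" for a :: real
      using gauss_moment_integrable by simp
    show "continuous_on (UNIV \<times> cbox 0 1)
        (\<lambda>(a, \<sigma>). - (\<sigma> ^ (2 * Suc k) * exp (- (\<sigma>\<^sup>2 * (a::real)))))"
      by (auto simp: case_prod_unfold intro!: continuous_intros)
  qed auto
  then show ?thesis by (simp add: gauss_moment_def[abs_def] integral_neg)
qed

lemma Ck_on_gauss_moment: "Ck_on m UNIV (gauss_moment k)"
proof (induction m arbitrary: k)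
  case 0
  then show ?case
    by (auto intro!: continuous_at_imp_continuous_on DERIV_isCont[OF DERIV_gauss_moment])
next
  case (Suc m)
  show ?case
    by (rule Ck_on_real_SucI[OF DERIV_gauss_moment Ck_on_minus[OF Suc.IH]])
qed

text \<open>
  Integration by parts. All exact cancellations rest on this identity: for \<open>g = gauss_moment 1\<close> it says
  that \<open>3 * g a + 2 * a * g' a = exp (- a)\<close>, and it makes \<open>a * g'' a + (a + 5/2) * g' a + 3/2 * g a\<close>
  vanish, which is the backward heat equation for the kernel built from \<open>g\<close>.
\<close>
lemma gauss_moment_rec:
  "2 * (a * gauss_moment (Suc k) a) = (2 * k + 1) * gauss_moment k a - exp (- a)"
proof -
  have "((\<lambda>\<sigma>. (2 * k + 1) * (\<sigma> ^ (2 * k) * exp (- (\<sigma>\<^sup>2 * a)))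
           - 2 * a * (\<sigma> ^ (2 * Suc k) * exp (- (\<sigma>\<^sup>2 * a)))) has_integral
         1 ^ (2 * k + 1) * exp (- (1\<^sup>2 * a)) - 0 ^ (2 * k + 1) * exp (- (0\<^sup>2 * a))) {0..1}"
  proof (rule fundamental_theorem_of_calculus)
    fix \<sigma> :: real
    show "((\<lambda>\<sigma>. \<sigma> ^ (2 * k + 1) * exp (- (\<sigma>\<^sup>2 * a))) has_vector_derivative
        (2 * k + 1) * (\<sigma> ^ (2 * k) * exp (- (\<sigma>\<^sup>2 * a)))
           - 2 * a * (\<sigma> ^ (2 * Suc k) * exp (- (\<sigma>\<^sup>2 * a)))) (at \<sigma> within {0..1})"
      unfolding has_real_derivative_iff_has_vector_derivative[symmetric]
      by (auto intro!: derivative_eq_intros simp: power2_eq_square algebra_simps) (cases k; simp)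
  qed simp
  moreover have "((\<lambda>\<sigma>. (2 * k + 1) * (\<sigma> ^ (2 * k) * exp (- (\<sigma>\<^sup>2 * a)))
           - 2 * a * (\<sigma> ^ (2 * Suc k) * exp (- (\<sigma>\<^sup>2 * a)))) has_integral
         (2 * k + 1) * gauss_moment k a - 2 * a * gauss_moment (Suc k) a) {0..1}"
    unfolding gauss_moment_def
    by (intro has_integral_diff has_integral_mult_right integrable_integral gauss_moment_integrable)
  ultimately have "1 ^ (2 * k + 1) * exp (- (1\<^sup>2 * a)) - 0 ^ (2 * k + 1) * exp (- (0\<^sup>2 * a))
      = (2 * k + 1) * gauss_moment k a - 2 * a * gauss_moment (Suc k) a"
    by (rule has_integral_unique)
  then show ?thesis by (simp add: algebra_simps)
qed

lemma gauss_moment_nonneg: "0 \<le> gauss_moment k a"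
  unfolding gauss_moment_def by (intro integral_nonneg gauss_moment_integrable) auto

lemma gauss_moment_le:
  assumes "0 \<le> a" shows "gauss_moment k a \<le> 1 / (2 * k + 1)"
proof -
  have "((\<lambda>\<sigma>::real. \<sigma> ^ (2 * k)) has_integral
      1 ^ (2 * k + 1) / (2 * k + 1) - 0 ^ (2 * k + 1) / (2 * k + 1)) {0..1}"
    by (rule fundamental_theorem_of_calculus)
       (auto intro!: derivative_eq_intros simp: has_real_derivative_iff_has_vector_derivative[symmetric]
         simp flip: power_Suc of_nat_Suc)
  moreover have "gauss_moment k a \<le> integral {0..1} (\<lambda>\<sigma>::real. \<sigma> ^ (2 * k))"
    unfolding gauss_moment_def
    by (rule integral_le[OF gauss_moment_integrable])
       (use assms in \<open>auto intro!: mult_left_le integrable_continuous_interval continuous_intros\<close>)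
  ultimately show ?thesis by (auto dest: integral_unique simp: add.commute)
qed

text \<open>
  The index \<open>j\<close> is the order of the derivative; the cutoff itself equals \<open>1\<close> up to \<open>N\<close> and \<open>0\<close> from
  \<open>2 * N\<close> on.
\<close>
definition cutoff :: "real \<Rightarrow> nat \<Rightarrow> real \<Rightarrow> real" where
  "cutoff N j a = (if j = 0 then 1 - smooth_step (a / N) else - step_deriv j (a / N) / N ^ j)"

lemma DERIV_cutoff: "(cutoff N j has_real_derivative cutoff N (Suc j) a) (at a)"
proof -
  have *: "((\<lambda>a. step_deriv j (a / N)) has_real_derivative step_deriv (Suc j) (a / N) * (1 / N)) (at a)"
    by (rule DERIV_chain2[OF DERIV_step_deriv DERIV_cdivide[OF DERIV_ident]])
  show ?thesis
  proof (cases "j = 0")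
    case True
    then have "cutoff N j = (\<lambda>a. 1 - step_deriv j (a / N))"
      by (auto simp: cutoff_def step_deriv_0)
    moreover have "((\<lambda>a. 1 - step_deriv j (a / N)) has_real_derivative cutoff N (Suc j) a) (at a)"
      by (rule derivative_eq_intros * refl)+ (use True in \<open>simp add: cutoff_def\<close>)
    ultimately show ?thesis by simp
  next
    case False
    then have "cutoff N j = (\<lambda>a. - step_deriv j (a / N) / N ^ j)"
      by (auto simp: cutoff_def)
    moreover have "((\<lambda>a. - step_deriv j (a / N) / N ^ j) has_real_derivative cutoff N (Suc j) a) (at a)"
      using DERIV_cdivide[OF DERIV_minus[OF *], of "N ^ j"] by (simp add: cutoff_def divide_simps mult.commute)
    ultimately show ?thesis by simp
  qed
qed

lemma Ck_on_cutoff: "Ck_on m UNIV (cutoff N j)"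
proof (induction m arbitrary: j)
  case 0
  then show ?case
    by (auto intro!: continuous_at_imp_continuous_on DERIV_isCont[OF DERIV_cutoff])
next
  case (Suc m)
  show ?case
    by (rule Ck_on_real_SucI[OF DERIV_cutoff Suc.IH])
qed

lemma cutoff_0_bounds: "0 \<le> cutoff N 0 a" "cutoff N 0 a \<le> 1"
  using step_bounds[of "a / N"] by (auto simp: cutoff_def)

lemma cutoff_eq_1: "0 < N \<Longrightarrow> a \<le> N \<Longrightarrow> cutoff N 0 a = 1"
  by (simp add: cutoff_def step_eq_0)

lemma cutoff_eq_0: "0 < N \<Longrightarrow> 2 * N < a \<Longrightarrow> cutoff N j a = 0"
  using step_deriv_outside[of "a / N" "j - 1"] by (auto simp: cutoff_def step_eq_1 field_simps)

text \<open>
  Each derivative gains a factor \<open>1 / N\<close>. On the support \<open>a\<close> is at most \<open>2 * N\<close>, so that a factor \<open>a\<close>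
  costs one of these gains, and for \<open>j \<ge> 2\<close> one of them is left.
\<close>
lemma cutoff_deriv_bound:
  "\<exists>C\<ge>0. \<forall>N\<ge>1. \<forall>a\<ge>0. \<forall>j\<in>{1,2,3}. \<bar>cutoff N j a\<bar> \<le> C / N \<and> (j \<noteq> 1 \<longrightarrow> \<bar>a * cutoff N j a\<bar> \<le> 2 * (C / N))"
proof -
  obtain C1 C2 C3 where C: "\<And>x. \<bar>step_deriv 1 x\<bar> \<le> C1" "\<And>x. \<bar>step_deriv 2 x\<bar> \<le> C2"
      "\<And>x. \<bar>step_deriv 3 x\<bar> \<le> C3"
    using step_deriv_bounded by metis
  define C where "C = max C1 (max C2 C3)"
  have CC: "\<bar>step_deriv j x\<bar> \<le> C" if "j \<in> {1,2,3}" for j x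
    using that C(1)[of x] C(2)[of x] C(3)[of x] by (auto simp: C_def)
  have C0: "C \<ge> 0" using CC[of 1 0] by (simp add: order_trans[OF abs_ge_zero])
  have "\<bar>cutoff N j a\<bar> \<le> C / N \<and> (j \<noteq> 1 \<longrightarrow> \<bar>a * cutoff N j a\<bar> \<le> 2 * (C / N))"
    if N: "N \<ge> 1" "a \<ge> 0" and j: "j \<in> {1,2,3}" for N a j
  proof
    have abs: "\<bar>cutoff N j a\<bar> = \<bar>step_deriv j (a / N)\<bar> / N ^ j"
      using j N by (auto simp: cutoff_def abs_divide)
    have le: "\<bar>cutoff N j a\<bar> \<le> C / N ^ j"
      unfolding abs using CC[OF j] N by (intro divide_right_mono) auto
    have "N ^ 1 \<le> N ^ j" using j N by (intro power_increasing) auto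
    then have "C / N ^ j \<le> C / N" using N C0 by (intro divide_left_mono) auto
    with le show "\<bar>cutoff N j a\<bar> \<le> C / N" by linarith
    show "j \<noteq> 1 \<longrightarrow> \<bar>a * cutoff N j a\<bar> \<le> 2 * (C / N)"
    proof
      assume "j \<noteq> 1"
      then have "N ^ 2 \<le> N ^ j" using j N by (intro power_increasing) auto
      then have "C / N ^ j \<le> C / N ^ 2" using N C0 by (intro divide_left_mono) auto
      with le have le2: "\<bar>cutoff N j a\<bar> \<le> C / N ^ 2" by linarith
      show "\<bar>a * cutoff N j a\<bar> \<le> 2 * (C / N)"
      proof (cases "2 * N < a")
        case True
        then show ?thesis using cutoff_eq_0[of N a j] N C0 by simp
      next
        case False
        then have "\<bar>a * cutoff N j a\<bar> \<le> 2 * N * (C / N ^ 2)"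
          unfolding abs_mult using N le2 by (intro mult_mono) auto
        also have "\<dots> = 2 * (C / N)" using N by (simp add: power2_eq_square)
        finally show ?thesis .
      qed
    qed
  qed
  with C0 show ?thesis by blast
qed

text \<open>
  The Leibniz rule for the \<open>j\<close>-th derivative of the product of \<open>cutoff N 0\<close> and \<open>gauss_moment 1\<close>; the
  signs come from the derivatives of the moments.
\<close>
definition cut_profile :: "real \<Rightarrow> nat \<Rightarrow> real \<Rightarrow> real" where
  "cut_profile N j a = (\<Sum>i\<le>j. (-1) ^ (j - i) * real (j choose i) * cutoff N i a * gauss_moment (Suc (j - i)) a)"

lemma cut_profile_0: "cut_profile N 0 a = cutoff N 0 a * gauss_moment 1 a"
  and cut_profile_1: "cut_profile N 1 a = cutoff N 1 a * gauss_moment 1 a - cutoff N 0 a * gauss_moment 2 a"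
  and cut_profile_2: "cut_profile N 2 a = cutoff N 2 a * gauss_moment 1 a - 2 * cutoff N 1 a * gauss_moment 2 a
      + cutoff N 0 a * gauss_moment 3 a"
  and cut_profile_3: "cut_profile N 3 a = cutoff N 3 a * gauss_moment 1 a - 3 * cutoff N 2 a * gauss_moment 2 a
      + 3 * cutoff N 1 a * gauss_moment 3 a - cutoff N 0 a * gauss_moment 4 a"
  by (simp_all add: cut_profile_def eval_nat_numeral algebra_simps)

lemma DERIV_cut_profile:
  assumes "j \<in> {0,1,2}"
  shows "(cut_profile N j has_real_derivative cut_profile N (Suc j) a) (at a)"
proof -
  have c: "(cutoff N 0 has_real_derivative cutoff N 1 a) (at a)"
    "(cutoff N 1 has_real_derivative cutoff N 2 a) (at a)"
    "(cutoff N 2 has_real_derivative cutoff N 3 a) (at a)"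
    using DERIV_cutoff[of N 0 a] DERIV_cutoff[of N 1 a] DERIV_cutoff[of N 2 a]
    by (simp_all add: eval_nat_numeral)
  have g: "(gauss_moment 1 has_real_derivative - gauss_moment 2 a) (at a)"
    "(gauss_moment 2 has_real_derivative - gauss_moment 3 a) (at a)"
    "(gauss_moment 3 has_real_derivative - gauss_moment 4 a) (at a)"
    using DERIV_gauss_moment[of 1 a] DERIV_gauss_moment[of 2 a] DERIV_gauss_moment[of 3 a]
    by (simp_all add: eval_nat_numeral)
  note eqs = cut_profile_0[abs_def] cut_profile_1[abs_def] cut_profile_2[abs_def] cut_profile_3[abs_def]
  have "(cut_profile N 0 has_real_derivative cut_profile N 1 a) (at a)"
    unfolding eqs by (rule derivative_eq_intros c g refl)+ (simp add: algebra_simps)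
  moreover have "(cut_profile N 1 has_real_derivative cut_profile N 2 a) (at a)"
    unfolding eqs by (rule derivative_eq_intros c g refl)+ (simp add: algebra_simps)
  moreover have "(cut_profile N 2 has_real_derivative cut_profile N 3 a) (at a)"
    unfolding eqs by (rule derivative_eq_intros c g refl)+ (simp add: algebra_simps)
  ultimately show ?thesis using assms by (auto simp: eval_nat_numeral)
qed

lemma cut_profile_eq_0: "0 < N \<Longrightarrow> 2 * N < a \<Longrightarrow> cut_profile N j a = 0"
  by (simp add: cut_profile_def cutoff_eq_0)

lemma Ck_on_cut_profile: "Ck_on k UNIV (cut_profile N j)"
proof -
  have "Ck_on k UNIV (\<lambda>a. \<Sum>i\<in>I. (-1) ^ (j - i) * real (j choose i) * cutoff N i a * gauss_moment (Suc (j - i)) a)"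
    if "finite I" for I
    using that
  proof induction
    case empty
    then show ?case by (simp add: Ck_on_const)
  next
    case (insert i I)
    have "Ck_on k UNIV (\<lambda>a. (-1) ^ (j - i) * real (j choose i) * cutoff N i a * gauss_moment (Suc (j - i)) a)"
      by (intro Ck_on_mult[OF Ck_on_mult[OF Ck_on_const Ck_on_cutoff] Ck_on_gauss_moment])
    from Ck_on_add[OF this insert.IH] insert.hyps show ?case by simp
  qed
  then show ?thesis unfolding cut_profile_def[abs_def] by simp
qed

lemma abs_mult_le: "\<bar>x\<bar> \<le> p \<Longrightarrow> \<bar>y\<bar> \<le> q \<Longrightarrow> \<bar>x * y\<bar> \<le> p * (q::real)"
  unfolding abs_mult by (intro mult_mono) auto

text \<open>
  The uncut profile \<open>gauss_moment 1\<close> gives exactly the Gaussian and solves the backward heat equation.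
  Therefore the last three expressions contain only terms with a derivative of the cutoff, and these
  are of order \<open>1 / N\<close>. The first two expressions are the absolute values of the eigenvalues in
  \<open>norm_axial_field_le\<close>; that they are at most \<open>1\<close> in the limit gives the factor \<open>\<Gamma>\<close> of the theorem.
\<close>
lemma cut_profile_bounds:
  "\<exists>C\<ge>0. \<forall>N\<ge>1. \<forall>a\<ge>0.
     2 * \<bar>cut_profile N 0 a\<bar> \<le> 1 \<and>
     2 * \<bar>cut_profile N 0 a + a * cut_profile N 1 a\<bar> \<le> 1 + C / N \<and>
     \<bar>3 * cut_profile N 0 a + 2 * a * cut_profile N 1 a - cutoff N 0 a * exp (- a)\<bar> \<le> C / N \<and>
     \<bar>a * cut_profile N 2 a + (a + 5/2) * cut_profile N 1 a + 3/2 * cut_profile N 0 a\<bar> \<le> C / N \<and>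
     \<bar>a * (a * cut_profile N 3 a + (a + 7/2) * cut_profile N 2 a + 5/2 * cut_profile N 1 a)\<bar> \<le> C / N"
proof -
  obtain C where "C \<ge> 0" and C: "\<And>N a j. N \<ge> 1 \<Longrightarrow> a \<ge> 0 \<Longrightarrow> j \<in> {1,2,3} \<Longrightarrow>
     \<bar>cutoff N j a\<bar> \<le> C / N \<and> (j \<noteq> 1 \<longrightarrow> \<bar>a * cutoff N j a\<bar> \<le> 2 * (C / N))"
    using cutoff_deriv_bound by blast
  show ?thesis
  proof (intro exI[of _ "40 * C"] conjI allI impI)
    show "0 \<le> 40 * C" using \<open>C \<ge> 0\<close> by simp
    fix N a :: real assume N: "1 \<le> N" and a: "0 \<le> a"
    define c where "c = C / N"
    define w where "w k = gauss_moment k a" for k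
    define x where "x j = cutoff N j a" for j
    have c0: "c \<ge> 0" using N \<open>C \<ge> 0\<close> by (simp add: c_def)
    have x: "\<bar>x 1\<bar> \<le> c" "\<bar>x 2\<bar> \<le> c" "\<bar>x 3\<bar> \<le> c" "\<bar>a * x 2\<bar> \<le> 2 * c" "\<bar>a * x 3\<bar> \<le> 2 * c"
      using C[OF N a] by (auto simp: x_def c_def)
    have x0: "0 \<le> x 0" "x 0 \<le> 1" using cutoff_0_bounds by (auto simp: x_def)
    have rec: "2 * (a * w 1) = w 0 - exp (-a)" "2 * (a * w 2) = 3 * w 1 - exp (-a)"
       "2 * (a * w 3) = 5 * w 2 - exp (-a)" "2 * (a * w 4) = 7 * w 3 - exp (-a)"
      using gauss_moment_rec[of a 0] gauss_moment_rec[of a 1] gauss_moment_rec[of a 2]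
        gauss_moment_rec[of a 3] by (simp_all add: w_def eval_nat_numeral)
    have w0: "w k \<ge> 0" for k by (simp add: w_def gauss_moment_nonneg)
    have w1: "w 0 \<le> 1" "w 1 \<le> 1/3" "w 2 \<le> 1" "w 3 \<le> 1"
      using gauss_moment_le[OF a, of 0] gauss_moment_le[OF a, of 1] gauss_moment_le[OF a, of 2]
         gauss_moment_le[OF a, of 3] by (auto simp: w_def)
    have e: "exp (-a) > 0" "exp (-a) \<le> 1" using a by auto
    have aw0: "0 \<le> a * w k" for k using a w0 by simp
    have aw: "\<bar>w 1\<bar> \<le> 1" "\<bar>w 2\<bar> \<le> 1" "\<bar>w 3\<bar> \<le> 1" "\<bar>a * w 1\<bar> \<le> 1" "\<bar>a * w 2\<bar> \<le> 1" "\<bar>a * w 3\<bar> \<le> 5/2"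
      using rec w0[of 1] w0[of 2] w0[of 3] w1 e aw0[of 1] aw0[of 2] aw0[of 3] unfolding abs_le_iff
      by linarith+
    have "2 * (a * (a * w 2)) = 3 * (a * w 1) - a * exp (-a)"
         "2 * (a * (a * w 3)) = 5 * (a * w 2) - a * exp (-a)"
      using arg_cong[OF rec(2), of "(*) a"] arg_cong[OF rec(3), of "(*) a"] by (simp_all add: algebra_simps)
    moreover have "0 \<le> a * exp (-a)" "0 \<le> a * (a * w 2)" "0 \<le> a * (a * w 3)" using a aw0 by auto
    ultimately have aaw: "\<bar>a * (a * w 2)\<bar> \<le> 3/2" "\<bar>a * (a * w 3)\<bar> \<le> 5/2"
      using aw by linarith+
    have p: "cut_profile N 0 a = x 0 * w 1" "cut_profile N 1 a = x 1 * w 1 - x 0 * w 2"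
      "cut_profile N 2 a = x 2 * w 1 - 2 * x 1 * w 2 + x 0 * w 3"
      "cut_profile N 3 a = x 3 * w 1 - 3 * x 2 * w 2 + 3 * x 1 * w 3 - x 0 * w 4"
      by (simp_all only: cut_profile_0 cut_profile_1 cut_profile_2 cut_profile_3 x_def w_def)
    note t = abs_mult_le
    have xw: "\<bar>x 0 * w 1\<bar> \<le> 1 * (1/3)"
      by (rule t) (use x0 w1 w0[of 1] in auto)
    then show "2 * \<bar>cut_profile N 0 a\<bar> \<le> 1" by (simp add: p)
    have y1: "\<bar>x 1 * (a * w 1)\<bar> \<le> c * 1" by (rule t[OF x(1) aw(4)])
    \<comment> \<open>without the cutoff, the second eigenvalue is \<open>exp (-a) - w 1\<close>, which has values in \<open>{-1..1}\<close>\<close>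
    have "\<bar>exp (-a) - w 1\<bar> \<le> 1" "\<bar>x 0\<bar> \<le> 1" using e w1 w0[of 1] x0 by linarith+
    then have "\<bar>x 0 * (exp (-a) - w 1)\<bar> \<le> 1 * 1" by (intro t)
    moreover have "2 * (cut_profile N 0 a + a * cut_profile N 1 a) = x 0 * (exp (-a) - w 1) + 2 * (x 1 * (a * w 1))"
      using arg_cong[OF rec(2), of "(*) (x 0)"] by (simp add: p algebra_simps del: One_nat_def)
    ultimately have "2 * \<bar>cut_profile N 0 a + a * cut_profile N 1 a\<bar> \<le> 1 + 40 * c"
      using y1 c0 by linarith
    then show "2 * \<bar>cut_profile N 0 a + a * cut_profile N 1 a\<bar> \<le> 1 + 40 * C / N" by (simp add: c_def)
    have "3 * cut_profile N 0 a + 2 * a * cut_profile N 1 a - x 0 * exp (-a) = 2 * (x 1 * (a * w 1))"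
      using arg_cong[OF rec(2), of "(*) (x 0)"] by (simp add: p algebra_simps del: One_nat_def)
    then have "\<bar>3 * cut_profile N 0 a + 2 * a * cut_profile N 1 a - x 0 * exp (-a)\<bar> \<le> 40 * c"
      using y1 c0 by linarith
    then show "\<bar>3 * cut_profile N 0 a + 2 * a * cut_profile N 1 a - cutoff N 0 a * exp (-a)\<bar> \<le> 40 * C / N"
      by (simp add: c_def x_def)
    have y: "\<bar>x 2 * (a * w 1)\<bar> \<le> c * 1" "\<bar>x 1 * (a * w 2)\<bar> \<le> c * 1" "\<bar>x 1 * w 1\<bar> \<le> c * 1"
      by (rule t[OF x(2) aw(4)] t[OF x(1) aw(5)] t[OF x(1) aw(1)])+
    have "a * cut_profile N 2 a + (a + 5/2) * cut_profile N 1 a + 3/2 * cut_profile N 0 a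
        = x 2 * (a * w 1) - 2 * (x 1 * (a * w 2)) + x 1 * (a * w 1) + 5/2 * (x 1 * w 1)"
      using arg_cong[OF rec(2), of "(*) (x 0)"] arg_cong[OF rec(3), of "(*) (x 0)"]
      by (simp add: p algebra_simps del: One_nat_def)
    then have "\<bar>a * cut_profile N 2 a + (a + 5/2) * cut_profile N 1 a + 3/2 * cut_profile N 0 a\<bar> \<le> 40 * c"
      using y y1 c0 by linarith
    then show "\<bar>a * cut_profile N 2 a + (a + 5/2) * cut_profile N 1 a + 3/2 * cut_profile N 0 a\<bar> \<le> 40 * C / N"
      by (simp add: c_def)
    have z: "\<bar>(a * x 3) * (a * w 1)\<bar> \<le> 2 * c * 1" "\<bar>(a * x 2) * (a * w 2)\<bar> \<le> 2 * c * 1"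
       "\<bar>x 1 * (a * (a * w 3))\<bar> \<le> c * (5/2)" "\<bar>(a * x 2) * (a * w 1)\<bar> \<le> 2 * c * 1"
       "\<bar>x 1 * (a * (a * w 2))\<bar> \<le> c * (3/2)"
      by (rule t[OF x(5) aw(4)] t[OF x(4) aw(5)] t[OF x(1) aaw(2)] t[OF x(4) aw(4)] t[OF x(1) aaw(1)])+
    have "a * cut_profile N 3 a + (a + 7/2) * cut_profile N 2 a + 5/2 * cut_profile N 1 a
      = a * x 3 * w 1 - 3 * (a * x 2 * w 2) + 3 * (x 1 * (a * w 3)) + a * x 2 * w 1 + 7/2 * (x 2 * w 1)
        - 2 * (x 1 * (a * w 2)) - 7 * (x 1 * w 2) + 5/2 * (x 1 * w 1)"
      using arg_cong[OF rec(3), of "(*) (x 0)"] arg_cong[OF rec(4), of "(*) (x 0)"]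
      by (simp add: p algebra_simps del: One_nat_def)
    then have "a * (a * cut_profile N 3 a + (a + 7/2) * cut_profile N 2 a + 5/2 * cut_profile N 1 a)
      = a * (a * x 3 * w 1 - 3 * (a * x 2 * w 2) + 3 * (x 1 * (a * w 3)) + a * x 2 * w 1 + 7/2 * (x 2 * w 1)
        - 2 * (x 1 * (a * w 2)) - 7 * (x 1 * w 2) + 5/2 * (x 1 * w 1))"
      by (simp only:)
    also have "\<dots> = (a * x 3) * (a * w 1) - 3 * ((a * x 2) * (a * w 2)) + 3 * (x 1 * (a * (a * w 3)))
        + (a * x 2) * (a * w 1) + 7/2 * (x 2 * (a * w 1))
        - 2 * (x 1 * (a * (a * w 2))) - 7 * (x 1 * (a * w 2)) + 5/2 * (x 1 * (a * w 1))"
      by (simp add: algebra_simps)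
    finally have "\<bar>a * (a * cut_profile N 3 a + (a + 7/2) * cut_profile N 2 a + 5/2 * cut_profile N 1 a)\<bar> \<le> 40 * c"
      using z[THEN abs_le_D1] z[THEN abs_le_D2] y[THEN abs_le_D1] y[THEN abs_le_D2]
        y1[THEN abs_le_D1] y1[THEN abs_le_D2] c0
      by (intro abs_leI) linarith+
    then show "\<bar>a * (a * cut_profile N 3 a + (a + 7/2) * cut_profile N 2 a + 5/2 * cut_profile N 1 a)\<bar> \<le> 40 * C / N"
      by (simp add: c_def)
  qed
qed

section \<open>Axially symmetric vector fields\<close>

text \<open>
  The curl of a radial multiple of the cross product of \<open>e\<close> and \<open>z\<close> and the gradient of a radial multiple of \<open>e \<bullet> z\<close>
  both have this form, with radial functions written in the variable \<open>\<beta> * (z \<bullet> z)\<close>.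
\<close>
definition axial_field :: "R3 \<Rightarrow> real \<Rightarrow> (real \<Rightarrow> real) \<Rightarrow> (real \<Rightarrow> real) \<Rightarrow> R3 \<Rightarrow> R3" where
  "axial_field e \<beta> P Q z = P (\<beta> * (z \<bullet> z)) *\<^sub>R e + (Q (\<beta> * (z \<bullet> z)) * (e \<bullet> z)) *\<^sub>R z"

lemma pderiv3_eqI:
  "(f has_derivative f') (at x) \<Longrightarrow> pderiv3 j f x = f' (axis j 1)"
  by (simp add: pderiv3_def frechet_derivative_at[symmetric])

lemma DERIV_radial:
  fixes x x0 :: R3
  assumes "\<And>a. (P has_real_derivative P1 a) (at a)"
  shows "((\<lambda>x. P (\<beta> * ((x - x0) \<bullet> (x - x0)))) has_derivative
    (\<lambda>v. P1 (\<beta> * ((x - x0) \<bullet> (x - x0))) * (2 * \<beta> * ((x - x0) \<bullet> v)))) (at x)"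
proof -
  have "((\<lambda>x. \<beta> * ((x - x0) \<bullet> (x - x0))) has_derivative (\<lambda>v. 2 * \<beta> * ((x - x0) \<bullet> v))) (at x)"
    by (auto intro!: derivative_eq_intros simp: inner_commute)
  from has_derivative_compose[OF this assms[unfolded has_field_derivative_def]]
  show ?thesis by simp
qed

lemma pderiv3_axial_field:
  assumes P: "\<And>a. (P has_real_derivative P1 a) (at a)"
    and Q: "\<And>a. (Q has_real_derivative Q1 a) (at a)"
  shows "pderiv3 j (\<lambda>x. axial_field e \<beta> P Q (x - x0)) x =
    (let z = x - x0; a = \<beta> * (z \<bullet> z) in
      (P1 a * (2 * \<beta> * z $ j)) *\<^sub>R e + (Q1 a * (2 * \<beta> * z $ j) * (e \<bullet> z) + Q a * e $ j) *\<^sub>R z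
      + (Q a * (e \<bullet> z)) *\<^sub>R axis j 1)"
proof -
  have "((\<lambda>x. axial_field e \<beta> P Q (x - x0)) has_derivative
    (\<lambda>v. (P1 (\<beta> * ((x - x0) \<bullet> (x - x0))) * (2 * \<beta> * ((x - x0) \<bullet> v))) *\<^sub>R e
      + (Q1 (\<beta> * ((x - x0) \<bullet> (x - x0))) * (2 * \<beta> * ((x - x0) \<bullet> v)) * (e \<bullet> (x - x0))
         + Q (\<beta> * ((x - x0) \<bullet> (x - x0))) * (e \<bullet> v)) *\<^sub>R (x - x0)
      + (Q (\<beta> * ((x - x0) \<bullet> (x - x0))) * (e \<bullet> (x - x0))) *\<^sub>R v)) (at x)"
    unfolding axial_field_def
    by (rule derivative_eq_intros DERIV_radial[OF P] DERIV_radial[OF Q] refl)+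
       (simp add: algebra_simps fun_eq_iff)
  from pderiv3_eqI[OF this, of j] show ?thesis
    by (simp add: inner_axis Let_def)
qed

lemma divergence_axial_field:
  assumes P: "\<And>a. (P has_real_derivative P1 a) (at a)"
    and Q: "\<And>a. (Q has_real_derivative Q1 a) (at a)"
  shows "divergence (\<lambda>x. axial_field e \<beta> P Q (x - x0)) x =
    (let z = x - x0; a = \<beta> * (z \<bullet> z) in (2 * \<beta> * P1 a + 2 * a * Q1 a + 4 * Q a) * (e \<bullet> z))"
  unfolding divergence_def pderiv3_axial_field[OF P Q] Let_def
  by (simp add: inner_vec_def sum_3 axis_def) (simp add: algebra_simps)

text \<open>
  The radial Laplacian in dimension three is \<open>\<beta> * (4 * a * P2 a + 6 * P1 a)\<close> in the variable \<open>a\<close>. For the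
  second part, the quadratic polynomial \<open>(e \<bullet> z) *\<^sub>R z\<close> raises \<open>6\<close> to \<open>14\<close> because of its homogeneity,
  and its own Laplacian \<open>2 *\<^sub>R e\<close> contributes to the component along \<open>e\<close>.
\<close>
lemma laplacian_axial_field:
  assumes P: "\<And>a. (P has_real_derivative P1 a) (at a)" "\<And>a. (P1 has_real_derivative P2 a) (at a)"
    and Q: "\<And>a. (Q has_real_derivative Q1 a) (at a)" "\<And>a. (Q1 has_real_derivative Q2 a) (at a)"
  shows "laplacian (\<lambda>x. axial_field e \<beta> P Q (x - x0)) x =
    axial_field e \<beta> (\<lambda>a. \<beta> * (4 * a * P2 a + 6 * P1 a) + 2 * Q a)
      (\<lambda>a. \<beta> * (4 * a * Q2 a + 14 * Q1 a)) (x - x0)"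
proof -
  define z where "z = x - x0"
  define a where "a = \<beta> * (z \<bullet> z)"
  have second: "pderiv3 j (pderiv3 j (\<lambda>x. axial_field e \<beta> P Q (x - x0))) x =
     (P2 a * (2 * \<beta> * z $ j)\<^sup>2 + P1 a * (2 * \<beta>)) *\<^sub>R e
     + (Q2 a * (2 * \<beta> * z $ j)\<^sup>2 * (e \<bullet> z) + Q1 a * (2 * \<beta>) * (e \<bullet> z)
        + 2 * (Q1 a * (2 * \<beta> * z $ j) * e $ j)) *\<^sub>R z
     + (2 * (Q1 a * (2 * \<beta> * z $ j) * (e \<bullet> z) + Q a * e $ j)) *\<^sub>R axis j 1" for j
  proof -
    have "((\<lambda>x. x $ j - x0 $ j) has_derivative (\<lambda>v. v $ j - 0)) (at x)" for x :: R3
      by (rule has_derivative_diff has_derivative_const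
          bounded_linear_imp_has_derivative[OF bounded_linear_vec_nth])+
    then have comp: "((\<lambda>x. (x - x0) $ j) has_derivative (\<lambda>v. v $ j)) (at x)"
        "((\<lambda>x. x $ j - x0 $ j) has_derivative (\<lambda>v. v $ j)) (at x)" for x :: R3
      by simp_all
    have eq: "pderiv3 j (\<lambda>x. axial_field e \<beta> P Q (x - x0)) =
      (\<lambda>x. (P1 (\<beta> * ((x - x0) \<bullet> (x - x0))) * (2 * \<beta> * (x - x0) $ j)) *\<^sub>R e
        + (Q1 (\<beta> * ((x - x0) \<bullet> (x - x0))) * (2 * \<beta> * (x - x0) $ j) * (e \<bullet> (x - x0))
            + Q (\<beta> * ((x - x0) \<bullet> (x - x0))) * e $ j) *\<^sub>R (x - x0)
        + (Q (\<beta> * ((x - x0) \<bullet> (x - x0))) * (e \<bullet> (x - x0))) *\<^sub>R axis j 1)"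
      by (simp add: fun_eq_iff pderiv3_axial_field[OF P(1) Q(1)] Let_def)
    have "(pderiv3 j (\<lambda>x. axial_field e \<beta> P Q (x - x0)) has_derivative
      (\<lambda>v. (P2 a * (2 * \<beta> * (z \<bullet> v)) * (2 * \<beta> * z $ j) + P1 a * (2 * \<beta> * v $ j)) *\<^sub>R e
       + ((Q2 a * (2 * \<beta> * (z \<bullet> v)) * (2 * \<beta> * z $ j) + Q1 a * (2 * \<beta> * v $ j)) * (e \<bullet> z)
          + Q1 a * (2 * \<beta> * z $ j) * (e \<bullet> v) + Q1 a * (2 * \<beta> * (z \<bullet> v)) * e $ j) *\<^sub>R z
       + (Q1 a * (2 * \<beta> * z $ j) * (e \<bullet> z) + Q a * e $ j) *\<^sub>R v
       + (Q1 a * (2 * \<beta> * (z \<bullet> v)) * (e \<bullet> z) + Q a * (e \<bullet> v)) *\<^sub>R axis j 1)) (at x)"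
      unfolding eq
      by (rule comp derivative_eq_intros DERIV_radial[OF P(2)] DERIV_radial[OF Q(1)]
            DERIV_radial[OF Q(2)] refl)+
         (simp add: algebra_simps fun_eq_iff z_def a_def)
    from pderiv3_eqI[OF this, of j] show ?thesis
      by (simp add: inner_axis vec_eq_iff power2_eq_square) (simp add: algebra_simps)
  qed
  show ?thesis
    unfolding laplacian_def second
    unfolding axial_field_def z_def[symmetric] a_def[symmetric]
    by (simp add: vec_eq_iff forall_3 sum_3 axis_def,
        simp add: inner_vec_def sum_3 a_def power2_eq_square,
        simp add: algebra_simps)
qed

text \<open>
  The vector is the image of \<open>e\<close> under a symmetric matrix with eigenvalue \<open>2 * p\<close> in the direction of
  \<open>z\<close> and \<open>2 * (p + a * d)\<close> orthogonally to it. Accordingly its squared norm is affine in the quantity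
  \<open>w\<close> of the proof, which ranges from \<open>0\<close> to \<open>a\<close>, and is estimated by its values at the two ends.
\<close>
lemma norm_axial_field_le:
  assumes "norm e = 1" "0 \<le> \<beta>" and a: "a = \<beta> * (z \<bullet> z)"
    and p: "2 * \<bar>p\<bar> \<le> B" and pd: "2 * \<bar>p + a * d\<bar> \<le> B"
  shows "norm ((2 * (p + a * d)) *\<^sub>R e - (2 * \<beta> * d * (e \<bullet> z)) *\<^sub>R z) \<le> B" (is "norm ?W \<le> B")
proof -
  define w where "w = \<beta> * (e \<bullet> z)\<^sup>2"
  have B0: "0 \<le> B" using p by simp
  have ee: "e \<bullet> e = 1" using assms(1) by (simp add: dot_square_norm)
  have "(e \<bullet> z)\<^sup>2 \<le> z \<bullet> z" using Cauchy_Schwarz_ineq[of e z] ee by simp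
  then have w: "0 \<le> w" "w \<le> a" unfolding w_def a using assms(2) by (auto intro: mult_left_mono)
  have "(norm ?W)\<^sup>2 = 4 * ((p + a * d)\<^sup>2 - 2 * (p + a * d) * d * w + d\<^sup>2 * w * a)"
    unfolding power2_norm_eq_inner w_def a
    by (simp add: inner_diff_left inner_diff_right ee inner_commute[of z e] algebra_simps power2_eq_square)
  also have "\<dots> \<le> B\<^sup>2"
  proof (cases "a = 0")
    case True
    then show ?thesis using w p power_mono[of "2 * \<bar>p\<bar>" B 2] by (simp add: power_mult_distrib)
  next
    case False
    then have "a > 0" using w by simp
    have sq: "4 * p\<^sup>2 \<le> B\<^sup>2" "4 * (p + a * d)\<^sup>2 \<le> B\<^sup>2"
      using power_mono[OF p, of 2] power_mono[OF pd, of 2] by (simp_all add: power_mult_distrib)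
    have "a * (4 * ((p + a * d)\<^sup>2 - 2 * (p + a * d) * d * w + d\<^sup>2 * w * a))
        = (a - w) * (4 * (p + a * d)\<^sup>2) + w * (4 * p\<^sup>2)"
      by (simp add: algebra_simps power2_eq_square)
    also have "\<dots> \<le> (a - w) * B\<^sup>2 + w * B\<^sup>2"
      using w sq by (intro add_mono mult_left_mono) auto
    also have "\<dots> = a * B\<^sup>2" by (simp add: algebra_simps)
    finally show ?thesis using \<open>a > 0\<close> by simp
  qed
  finally show ?thesis using B0 by (rule power2_le_imp_le)
qed


section \<open>The truncated Oseen kernel\<close>

text \<open>
  The heat kernel for the time \<open>t - s\<close> is \<open>gauss_height t s\<close> times the exponential of
  \<open>- gauss_rate t s * (norm x)\<^sup>2\<close>. Here \<open>t\<close> is the fixed final time and \<open>s\<close> the running time.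
\<close>
definition gauss_rate :: "real \<Rightarrow> real \<Rightarrow> real" where
  "gauss_rate t s = 1 / (4 * (t - s))"

definition gauss_height :: "real \<Rightarrow> real \<Rightarrow> real" where
  "gauss_height t s = (4 * pi * (t - s)) powr (- 3 / 2)"

lemma gauss_rate_pos: "s < t \<Longrightarrow> 0 < gauss_rate t s"
  by (simp add: gauss_rate_def)

lemma gauss_height_pos: "s < t \<Longrightarrow> 0 < gauss_height t s"
  by (simp add: gauss_height_def)

lemma DERIV_gauss_rate: "s < t \<Longrightarrow> (gauss_rate t has_real_derivative 4 * (gauss_rate t s)\<^sup>2) (at s)"
  unfolding gauss_rate_def[abs_def]
  by (auto intro!: derivative_eq_intros simp: power2_eq_square field_simps)

lemma DERIV_gauss_height:
  assumes "s < t"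
  shows "(gauss_height t has_real_derivative 6 * gauss_rate t s * gauss_height t s) (at s)"
proof -
  have pos: "0 < 4 * pi * (t - s)" using assms by simp
  have "((\<lambda>s. 4 * pi * (t - s)) has_real_derivative - (4 * pi)) (at s)"
    by (auto intro!: derivative_eq_intros)
  from DERIV_chain2[OF has_real_derivative_powr[OF pos, of "-3/2"] this]
  have "(gauss_height t has_real_derivative
      (- 3 / 2) * (4 * pi * (t - s)) powr (- 3 / 2 - 1) * - (4 * pi)) (at s)"
    by (simp add: gauss_height_def[abs_def])
  moreover have "(4 * pi * (t - s)) powr (- 3 / 2 - 1) = gauss_height t s / (4 * pi * (t - s))"
    unfolding gauss_height_def using pos by (subst powr_diff) simp
  moreover have "(- 3 / 2) * (h / (4 * pi * (t - s))) * - (4 * pi) = 6 * gauss_rate t s * h" for h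
    using assms by (simp add: gauss_rate_def divide_simps)
  ultimately show ?thesis by metis
qed

lemma Ck_on_gauss_rate: "Ck_on k (UNIV \<times> {..<t}) (\<lambda>(x :: R3, s). gauss_rate t s)"
proof -
  have "Ck_on k (UNIV \<times> {..<t}) (\<lambda>p :: R3 \<times> real. (4 * (t - snd p)) powr (- 1))"
    by (intro Ck_on_compose_real[OF Ck_on_powr] Ck_on_mult Ck_on_diff Ck_on_const
        Ck_on_bounded_linear bounded_linear_snd) auto
  then show ?thesis
    by (subst Ck_on_cong[where g="\<lambda>p. (4 * (t - snd p)) powr (- 1)"])
       (auto simp: gauss_rate_def powr_minus_divide)
qed

lemma Ck_on_gauss_height: "Ck_on k (UNIV \<times> {..<t}) (\<lambda>(x :: R3, s). gauss_height t s)"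
  unfolding gauss_height_def case_prod_unfold
  by (intro Ck_on_compose_real[OF Ck_on_powr] Ck_on_mult Ck_on_diff Ck_on_const
      Ck_on_bounded_linear bounded_linear_snd) auto

text \<open>
  The function \<open>G j\<close> is the \<open>j\<close>-th derivative of the profile \<open>G 0\<close>, whose argument is
  \<open>gauss_rate t s\<close> times the squared distance from the centre \<open>x0\<close>. Cutting off the profile in this
  self-similar variable, rather than a vector field in space, keeps the identities below exact.
\<close>
locale radial_profile =
  fixes G :: "nat \<Rightarrow> real \<Rightarrow> real" and L :: real
  assumes DERIV_G: "j \<in> {0,1,2} \<Longrightarrow> (G j has_real_derivative G (Suc j) a) (at a)"
    and Ck_on_G: "Ck_on k UNIV (G j)"
    and G_eq_0: "L < a \<Longrightarrow> G j a = 0"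
    and L_pos: "0 < L"
begin

text \<open>
  This is the curl of \<open>gauss_height t s * G 0 a\<close> times the cross product of \<open>e\<close> and \<open>x - x0\<close>, for
  \<open>a = gauss_rate t s * (norm (x - x0))\<^sup>2\<close>. With the profile \<open>gauss_moment 1\<close> it would be the Oseen
  kernel, that is, the Leray projection of the heat kernel times \<open>e\<close>.
\<close>
definition oseen_field :: "R3 \<Rightarrow> R3 \<Rightarrow> real \<Rightarrow> real \<Rightarrow> R3 \<Rightarrow> R3" where
  "oseen_field e x0 t s x = axial_field e (gauss_rate t s)
     (\<lambda>a. 2 * gauss_height t s * (G 0 a + a * G 1 a))
     (\<lambda>a. - 2 * gauss_height t s * gauss_rate t s * G 1 a) (x - x0)"

text \<open>
  Under \<open>\<partial>\<^sub>s + \<Delta>\<close> the field with profile \<open>G 0\<close> turns into \<open>4 * gauss_rate t s\<close> times the field with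
  profile \<open>heat_defect\<close>. The derivative of this profile is \<open>heat_defect'\<close>.
\<close>
definition heat_defect :: "real \<Rightarrow> real" where
  "heat_defect a = a * G 2 a + (a + 5/2) * G 1 a + 3/2 * G 0 a"

definition heat_defect' :: "real \<Rightarrow> real" where
  "heat_defect' a = a * G 3 a + (a + 7/2) * G 2 a + 5/2 * G 1 a"

definition defect_field :: "R3 \<Rightarrow> R3 \<Rightarrow> real \<Rightarrow> real \<Rightarrow> R3 \<Rightarrow> R3" where
  "defect_field e x0 t s x = (4 * gauss_rate t s) *\<^sub>R axial_field e (gauss_rate t s)
     (\<lambda>a. 2 * gauss_height t s * (heat_defect a + a * heat_defect' a))
     (\<lambda>a. - 2 * gauss_height t s * gauss_rate t s * heat_defect' a) (x - x0)"

definition oseen_potential :: "R3 \<Rightarrow> R3 \<Rightarrow> real \<Rightarrow> real \<Rightarrow> R3 \<Rightarrow> real" where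
  "oseen_potential e x0 t s x =
     gauss_height t s * (G 0 (gauss_rate t s * ((x - x0) \<bullet> (x - x0))) * (e \<bullet> (x - x0)))"

lemma G_derivs:
  "(G 0 has_real_derivative G 1 a) (at a)" "(G 1 has_real_derivative G 2 a) (at a)"
  "(G 2 has_real_derivative G 3 a) (at a)"
  using DERIV_G[of 0 a] DERIV_G[of 1 a] DERIV_G[of 2 a] by (simp_all add: eval_nat_numeral)

lemma coeff_derivs:
  "((\<lambda>a. c * (G 0 a + a * G 1 a)) has_real_derivative c * (2 * G 1 a + a * G 2 a)) (at a)"
  "((\<lambda>a. c * (2 * G 1 a + a * G 2 a)) has_real_derivative c * (3 * G 2 a + a * G 3 a)) (at a)"
  "((\<lambda>a. c * G 1 a) has_real_derivative c * G 2 a) (at a)"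
  "((\<lambda>a. c * G 2 a) has_real_derivative c * G 3 a) (at a)"
  by (rule derivative_eq_intros G_derivs refl | simp add: algebra_simps)+

lemma laplacian_oseen_field:
  "laplacian (oseen_field e x0 t s) x =
    (4 * gauss_rate t s) *\<^sub>R axial_field e (gauss_rate t s)
      (\<lambda>a. gauss_height t s * (2 * a * (3 * G 2 a + a * G 3 a) + 3 * (2 * G 1 a + a * G 2 a) - G 1 a))
      (\<lambda>a. - gauss_height t s * gauss_rate t s * (2 * a * G 3 a + 7 * G 2 a)) (x - x0)"
  unfolding oseen_field_def[abs_def]
  by (subst laplacian_axial_field[OF coeff_derivs(1,2,3,4)])
     (simp add: axial_field_def algebra_simps)

text \<open>
  The backward heat equation up to \<open>defect_field\<close>. The Laplacian is left as it stands since it cancels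
  against the viscous term of the weak formulation.
\<close>
lemma DERIV_oseen_field:
  assumes "s < t"
  shows "((\<lambda>s. oseen_field e x0 t s x) has_vector_derivative
    defect_field e x0 t s x - laplacian (oseen_field e x0 t s) x) (at s)"
proof -
  define z where "z = x - x0"
  define q where "q = z \<bullet> z"
  define \<beta> where "\<beta> = gauss_rate t s"
  define h where "h = gauss_height t s"
  define a where "a = \<beta> * q"
  have b: "(gauss_rate t has_real_derivative 4 * \<beta>\<^sup>2) (at s)"
    unfolding \<beta>_def by (rule DERIV_gauss_rate[OF assms])
  have h: "(gauss_height t has_real_derivative 6 * \<beta> * h) (at s)"
    unfolding \<beta>_def h_def by (rule DERIV_gauss_height[OF assms])
  have g: "((\<lambda>s. G 0 (gauss_rate t s * q)) has_real_derivative G 1 a * (4 * \<beta>\<^sup>2 * q)) (at s)"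
    "((\<lambda>s. G 1 (gauss_rate t s * q)) has_real_derivative G 2 a * (4 * \<beta>\<^sup>2 * q)) (at s)"
    using DERIV_chain2[OF G_derivs(1) DERIV_cmult_right[OF b, of q]]
      DERIV_chain2[OF G_derivs(2) DERIV_cmult_right[OF b, of q]]
    by (simp_all add: a_def \<beta>_def)
  have 1: "((\<lambda>s. 2 * gauss_height t s * (G 0 (gauss_rate t s * q) + gauss_rate t s * q * G 1 (gauss_rate t s * q)))
     has_real_derivative h * (12 * \<beta> * (G 0 a + a * G 1 a) + 8 * \<beta> * a * (2 * G 1 a + a * G 2 a))) (at s)"
    by (rule g b h derivative_eq_intros refl)+
       (unfold \<beta>_def[symmetric] h_def[symmetric] a_def[symmetric],
        simp add: a_def algebra_simps power2_eq_square)
  have 2: "((\<lambda>s. - 2 * gauss_height t s * gauss_rate t s * G 1 (gauss_rate t s * q))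
     has_real_derivative - (h * \<beta>\<^sup>2 * (20 * G 1 a + 8 * a * G 2 a))) (at s)"
    by (rule g b h derivative_eq_intros refl)+
       (unfold \<beta>_def[symmetric] h_def[symmetric] a_def[symmetric],
        simp add: a_def algebra_simps power2_eq_square)
  have "((\<lambda>s. oseen_field e x0 t s x) has_vector_derivative
      (h * (12 * \<beta> * (G 0 a + a * G 1 a) + 8 * \<beta> * a * (2 * G 1 a + a * G 2 a))) *\<^sub>R e
      + (- (h * \<beta>\<^sup>2 * (20 * G 1 a + 8 * a * G 2 a)) * (e \<bullet> z)) *\<^sub>R z) (at s)"
    unfolding oseen_field_def axial_field_def z_def[symmetric] q_def[symmetric]
    using has_vector_derivative_add[OF
        has_vector_derivative_scaleR[OF 1 has_vector_derivative_const[of e]]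
        has_vector_derivative_scaleR[OF DERIV_cmult_right[OF 2, of "e \<bullet> z"] has_vector_derivative_const[of z]]]
    by simp
  moreover have "defect_field e x0 t s x - laplacian (oseen_field e x0 t s) x =
      (h * (12 * \<beta> * (G 0 a + a * G 1 a) + 8 * \<beta> * a * (2 * G 1 a + a * G 2 a))) *\<^sub>R e
      + (- (h * \<beta>\<^sup>2 * (20 * G 1 a + 8 * a * G 2 a)) * (e \<bullet> z)) *\<^sub>R z"
    unfolding laplacian_oseen_field defect_field_def axial_field_def z_def[symmetric] q_def[symmetric]
      \<beta>_def[symmetric] h_def[symmetric] a_def[symmetric] heat_defect_def heat_defect'_def
    by (simp add: vec_eq_iff) (simp add: algebra_simps power2_eq_square)
  ultimately show ?thesis by simp
qed

text \<open>
  At no point is the kernel larger than \<open>B\<close> times the peak \<open>gauss_height t s\<close> of the heat kernel. For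
  the cut profiles \<open>B\<close> tends to \<open>1\<close>, which accounts for the factor \<open>\<Gamma>\<close> of the theorem.
\<close>
lemma norm_oseen_field_le:
  assumes "norm e = 1" "s < t" and
    "\<And>a. 0 \<le> a \<Longrightarrow> 2 * \<bar>G 0 a\<bar> \<le> B" "\<And>a. 0 \<le> a \<Longrightarrow> 2 * \<bar>G 0 a + a * G 1 a\<bar> \<le> B"
  shows "norm (oseen_field e x0 t s x) \<le> gauss_height t s * B"
proof -
  define z where "z = x - x0"
  define a where "a = gauss_rate t s * (z \<bullet> z)"
  have a: "0 \<le> a" using gauss_rate_pos[OF assms(2)] by (simp add: a_def)
  have "norm ((2 * (G 0 a + a * G 1 a)) *\<^sub>R e - (2 * gauss_rate t s * G 1 a * (e \<bullet> z)) *\<^sub>R z) \<le> B"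
    by (rule norm_axial_field_le[OF assms(1) _ a_def assms(3,4)[OF a]])
       (use gauss_rate_pos[OF assms(2)] in simp)
  moreover have "oseen_field e x0 t s x = gauss_height t s *\<^sub>R
      ((2 * (G 0 a + a * G 1 a)) *\<^sub>R e - (2 * gauss_rate t s * G 1 a * (e \<bullet> z)) *\<^sub>R z)"
    by (simp add: oseen_field_def axial_field_def a_def z_def algebra_simps)
  ultimately show ?thesis
    using gauss_height_pos[OF assms(2)] by (simp add: mult_left_mono)
qed

lemma norm_defect_field_le:
  assumes "norm e = 1" "s < t" and
    "\<And>a. 0 \<le> a \<Longrightarrow> \<bar>heat_defect a\<bar> \<le> B" "\<And>a. 0 \<le> a \<Longrightarrow> \<bar>a * heat_defect' a\<bar> \<le> B"
  shows "norm (defect_field e x0 t s x) \<le> 4 * gauss_rate t s * gauss_height t s * (4 * B)"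
proof -
  define z where "z = x - x0"
  define a where "a = gauss_rate t s * (z \<bullet> z)"
  have a: "0 \<le> a" using gauss_rate_pos[OF assms(2)] by (simp add: a_def)
  have d: "\<bar>heat_defect a\<bar> \<le> B" "\<bar>a * heat_defect' a\<bar> \<le> B"
    using assms(3,4)[OF a] by blast+
  have "\<bar>heat_defect a + a * heat_defect' a\<bar> \<le> B + B"
    by (rule order_trans[OF abs_triangle_ineq add_mono[OF d]])
  then have *: "2 * \<bar>heat_defect a\<bar> \<le> 4 * B" "2 * \<bar>heat_defect a + a * heat_defect' a\<bar> \<le> 4 * B"
    using d(1) by simp_all
  have "norm ((2 * (heat_defect a + a * heat_defect' a)) *\<^sub>R e
      - (2 * gauss_rate t s * heat_defect' a * (e \<bullet> z)) *\<^sub>R z) \<le> 4 * B"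
    by (rule norm_axial_field_le[OF assms(1) _ a_def *])
       (use gauss_rate_pos[OF assms(2)] in simp)
  moreover have "defect_field e x0 t s x = (4 * gauss_rate t s * gauss_height t s) *\<^sub>R
      ((2 * (heat_defect a + a * heat_defect' a)) *\<^sub>R e
      - (2 * gauss_rate t s * heat_defect' a * (e \<bullet> z)) *\<^sub>R z)"
    by (simp add: defect_field_def axial_field_def a_def z_def algebra_simps)
  ultimately show ?thesis
    using gauss_height_pos[OF assms(2)] gauss_rate_pos[OF assms(2)] by (simp add: mult_left_mono)
qed

lemma oseen_field_eq_0:
  "L < gauss_rate t s * ((x - x0) \<bullet> (x - x0)) \<Longrightarrow> oseen_field e x0 t s x = 0"
  by (simp add: oseen_field_def axial_field_def G_eq_0)

lemma defect_field_eq_0: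
  "L < gauss_rate t s * ((x - x0) \<bullet> (x - x0)) \<Longrightarrow> defect_field e x0 t s x = 0"
  by (simp add: defect_field_def axial_field_def heat_defect_def heat_defect'_def G_eq_0)

text \<open>
  The gradient cancels the component along \<open>x - x0\<close>. The remaining multiple of \<open>e\<close> is the heat kernel
  if the profile is \<open>gauss_moment 1\<close>.
\<close>
lemma oseen_field_plus_grad:
  "oseen_field e x0 t s x + grad (oseen_potential e x0 t s) x =
    (let a = gauss_rate t s * ((x - x0) \<bullet> (x - x0))
     in (gauss_height t s * (3 * G 0 a + 2 * a * G 1 a)) *\<^sub>R e)"
proof -
  define z where "z = x - x0"
  define a where "a = gauss_rate t s * (z \<bullet> z)"
  have "(oseen_potential e x0 t s has_derivative
     (\<lambda>v. gauss_height t s * (G 0 a * (e \<bullet> v) + G 1 a * (2 * gauss_rate t s * (z \<bullet> v)) * (e \<bullet> z)))) (at x)"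
    unfolding oseen_potential_def[abs_def]
    by (rule derivative_eq_intros DERIV_radial[OF G_derivs(1)] refl)+
       (simp add: a_def z_def fun_eq_iff)
  note D = pderiv3_eqI[OF this]
  have "grad (oseen_potential e x0 t s) x =
      gauss_height t s *\<^sub>R (G 0 a *\<^sub>R e + (2 * gauss_rate t s * G 1 a * (e \<bullet> z)) *\<^sub>R z)"
    by (simp add: grad_def D inner_axis vec_eq_iff)
  then show ?thesis
    unfolding oseen_field_def axial_field_def z_def[symmetric] Let_def a_def[symmetric]
    by (simp add: vec_eq_iff) (simp add: algebra_simps)
qed

lemma Ck_on_oseen_field: "Ck_on k (UNIV \<times> {..<t}) (\<lambda>(x, s). oseen_field e x0 t s x)"
proof -
  note gr = Ck_on_gauss_rate[unfolded case_prod_unfold] and gh = Ck_on_gauss_height[unfolded case_prod_unfold]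
  have z: "Ck_on k S (\<lambda>p :: R3 \<times> real. fst p - x0)" for S
    by (intro Ck_on_diff Ck_on_const Ck_on_bounded_linear bounded_linear_fst)
  have a: "Ck_on k (UNIV \<times> {..<t}) (\<lambda>p. gauss_rate t (snd p) * ((fst p - x0) \<bullet> (fst p - x0)))"
    by (intro Ck_on_mult Ck_on_inner gr z)
  have g: "Ck_on k (UNIV \<times> {..<t}) (\<lambda>p. G j (gauss_rate t (snd p) * ((fst p - x0) \<bullet> (fst p - x0))))"
    for j
    by (rule Ck_on_compose_real[OF Ck_on_G a]) simp
  show ?thesis
    unfolding oseen_field_def axial_field_def case_prod_unfold
    by (intro Ck_on_add Ck_on_scaleR Ck_on_mult Ck_on_inner Ck_on_const gr gh z a g)
qed

lemma Ck_on_oseen_potential: "Ck_on k UNIV (oseen_potential e x0 t s)"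
proof -
  have z: "Ck_on k UNIV (\<lambda>x :: R3. x - x0)"
    by (intro Ck_on_diff Ck_on_const Ck_on_bounded_linear bounded_linear_ident)
  have a: "Ck_on k UNIV (\<lambda>x. gauss_rate t s * ((x - x0) \<bullet> (x - x0)))"
    by (intro Ck_on_mult Ck_on_inner Ck_on_const z)
  have g: "Ck_on k UNIV (\<lambda>x. G 0 (gauss_rate t s * ((x - x0) \<bullet> (x - x0))))"
    by (rule Ck_on_compose_real[OF Ck_on_G a]) auto
  show ?thesis
    unfolding oseen_potential_def[abs_def]
    by (intro Ck_on_mult Ck_on_inner Ck_on_const z g)
qed

end

section \<open>Square integrable functions\<close>

lemma Cauchy_Schwarz_integral:
  fixes f g :: "'a \<Rightarrow> real"
  assumes [measurable]: "f \<in> borel_measurable M" "g \<in> borel_measurable M"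
    and f2: "integrable M (\<lambda>x. (f x)\<^sup>2)" and g2: "integrable M (\<lambda>x. (g x)\<^sup>2)"
  shows integrable_product: "integrable M (\<lambda>x. f x * g x)"
    and "\<bar>\<integral>x. f x * g x \<partial>M\<bar> \<le> sqrt (\<integral>x. (f x)\<^sup>2 \<partial>M) * sqrt (\<integral>x. (g x)\<^sup>2 \<partial>M)"
proof -
  have bound: "\<bar>f x * g x\<bar> \<le> (f x)\<^sup>2 + (g x)\<^sup>2" for x
  proof -
    have "2 * (\<bar>f x\<bar> * \<bar>g x\<bar>) \<le> (f x)\<^sup>2 + (g x)\<^sup>2"
      using sum_squares_bound[of "\<bar>f x\<bar>" "\<bar>g x\<bar>"] by (simp add: mult.assoc)
    moreover have "0 \<le> \<bar>f x\<bar> * \<bar>g x\<bar>" by simp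
    ultimately show ?thesis unfolding abs_mult by linarith
  qed
  show fg: "integrable M (\<lambda>x. f x * g x)"
    by (rule Bochner_Integration.integrable_bound[OF Bochner_Integration.integrable_add[OF f2 g2]])
       (use bound in \<open>auto intro!: AE_I2\<close>)
  define A where "A = (\<integral>x. (f x)\<^sup>2 \<partial>M)"
  define B where "B = (\<integral>x. f x * g x \<partial>M)"
  define C where "C = (\<integral>x. (g x)\<^sup>2 \<partial>M)"
  have AC: "A \<ge> 0" "C \<ge> 0" by (simp_all add: A_def C_def)
  have quad: "2 * l * B \<le> A + l\<^sup>2 * C" for l
  proof -
    have "0 \<le> (\<integral>x. (f x - l * g x)\<^sup>2 \<partial>M)" by simp
    also have "\<dots> = (\<integral>x. (f x)\<^sup>2 - 2 * l * (f x * g x) + l\<^sup>2 * (g x)\<^sup>2 \<partial>M)"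
      by (simp add: power2_diff power_mult_distrib algebra_simps)
    also have "\<dots> = A - 2 * l * B + l\<^sup>2 * C"
      unfolding A_def B_def C_def using f2 g2 fg by simp
    finally show ?thesis by simp
  qed
  have "B\<^sup>2 \<le> A * C"
  proof (cases "C = 0")
    case True
    have "B = 0"
    proof (rule ccontr)
      assume "B \<noteq> 0"
      then show False using quad[of "(A + 1) / (2 * B)"] True AC by simp
    qed
    then show ?thesis using True by simp
  next
    case False
    then have "C > 0" using AC by simp
    then show ?thesis using quad[of "B / C"] by (simp add: power2_eq_square field_simps)
  qed
  then have "\<bar>B\<bar> \<le> sqrt (A * C)" using real_sqrt_le_mono[of "B\<^sup>2"] by simp
  then show "\<bar>\<integral>x. f x * g x \<partial>M\<bar> \<le> sqrt (\<integral>x. (f x)\<^sup>2 \<partial>M) * sqrt (\<integral>x. (g x)\<^sup>2 \<partial>M)"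
    by (simp add: A_def B_def C_def real_sqrt_mult)
qed

lemma L2_D:
  assumes "f \<in> L2"
  shows "f \<in> borel_measurable lebesgue" "integrable lebesgue (\<lambda>x. (norm (f x))\<^sup>2)"
  using assms by (auto simp: L2_def)

lemma l2norm_nonneg: "0 \<le> l2norm f"
  by (simp add: l2norm_def)

lemma L2_norm_product:
  assumes f: "f \<in> L2" and g: "g \<in> L2"
  shows "integrable lebesgue (\<lambda>x. norm (f x) * norm (g x))"
    and "(\<integral>x. norm (f x) * norm (g x) \<partial>lebesgue) \<le> l2norm f * l2norm g"
proof -
  note m = measurable_compose[OF L2_D(1)[OF f] borel_measurable_norm]
    measurable_compose[OF L2_D(1)[OF g] borel_measurable_norm]
  show "integrable lebesgue (\<lambda>x. norm (f x) * norm (g x))"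
    by (rule integrable_product[OF m L2_D(2)[OF f] L2_D(2)[OF g]])
  show "(\<integral>x. norm (f x) * norm (g x) \<partial>lebesgue) \<le> l2norm f * l2norm g"
    using Cauchy_Schwarz_integral(2)[OF m L2_D(2)[OF f] L2_D(2)[OF g]]
    by (simp add: l2norm_def)
qed

lemma L2_inner:
  fixes f g :: "R3 \<Rightarrow> 'b::euclidean_space"
  assumes f: "f \<in> L2" and g: "g \<in> L2"
  shows "integrable lebesgue (\<lambda>x. f x \<bullet> g x)" and "\<bar>l2inner f g\<bar> \<le> l2norm f * l2norm g"
proof -
  have m: "(\<lambda>x. f x \<bullet> g x) \<in> borel_measurable lebesgue"
    using L2_D(1)[OF f] L2_D(1)[OF g] by (rule borel_measurable_inner)
  show i: "integrable lebesgue (\<lambda>x. f x \<bullet> g x)"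
    by (rule Bochner_Integration.integrable_bound[OF L2_norm_product(1)[OF f g] m])
       (auto intro!: AE_I2 Cauchy_Schwarz_ineq2)
  have "\<bar>l2inner f g\<bar> \<le> (\<integral>x. norm (f x) * norm (g x) \<partial>lebesgue)"
    unfolding l2inner_def
    by (rule order_trans[OF integral_abs_bound integral_mono[OF integrable_abs[OF i] L2_norm_product(1)[OF f g]]])
       (rule Cauchy_Schwarz_ineq2)
  then show "\<bar>l2inner f g\<bar> \<le> l2norm f * l2norm g"
    using L2_norm_product(2)[OF f g] by linarith
qed

lemma L2_add:
  assumes f: "f \<in> L2" and g: "g \<in> L2"
  shows "(\<lambda>x. f x + g x) \<in> L2"
proof -
  have m: "(\<lambda>x. f x + g x) \<in> borel_measurable lebesgue"
    using L2_D(1)[OF f] L2_D(1)[OF g] by (rule borel_measurable_add)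
  have "(norm (f x + g x))\<^sup>2 \<le> 2 * (norm (f x))\<^sup>2 + 2 * (norm (g x))\<^sup>2" for x
  proof -
    have "(norm (f x + g x))\<^sup>2 \<le> (norm (f x) + norm (g x))\<^sup>2"
      by (intro power_mono norm_triangle_ineq) auto
    also have "\<dots> \<le> 2 * (norm (f x))\<^sup>2 + 2 * (norm (g x))\<^sup>2"
      using sum_squares_bound[of "norm (f x)" "norm (g x)"] by (simp add: power2_sum)
    finally show ?thesis .
  qed
  moreover have "integrable lebesgue (\<lambda>x. 2 * (norm (f x))\<^sup>2 + 2 * (norm (g x))\<^sup>2)"
    using L2_D(2)[OF f] L2_D(2)[OF g] by simp
  ultimately have "integrable lebesgue (\<lambda>x. (norm (f x + g x))\<^sup>2)"
    using m by (rule_tac Bochner_Integration.integrable_bound) (auto intro!: AE_I2)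
  with m show ?thesis by (simp add: L2_def)
qed

lemma L2_scaleR: "f \<in> L2 \<Longrightarrow> (\<lambda>x. c *\<^sub>R f x) \<in> L2"
  by (auto simp: L2_def power_mult_distrib)

lemma L2_diff: "f \<in> L2 \<Longrightarrow> g \<in> L2 \<Longrightarrow> (\<lambda>x. f x - g x) \<in> L2"
  using L2_add[of f "\<lambda>x. (-1) *\<^sub>R g x"] L2_scaleR[of g "-1"] by simp

lemma l2inner_add_right:
  "f \<in> L2 \<Longrightarrow> g \<in> L2 \<Longrightarrow> h \<in> L2 \<Longrightarrow> l2inner f (\<lambda>x. g x + h x) = l2inner f g + l2inner f h"
  by (simp add: l2inner_def inner_add_right L2_inner(1))

lemma l2inner_diff_right:
  "f \<in> L2 \<Longrightarrow> g \<in> L2 \<Longrightarrow> h \<in> L2 \<Longrightarrow> l2inner f (\<lambda>x. g x - h x) = l2inner f g - l2inner f h"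
  by (simp add: l2inner_def inner_diff_right L2_inner(1))

lemma L2_bounded_support:
  fixes g :: "R3 \<Rightarrow> 'b::euclidean_space"
  assumes m: "g \<in> borel_measurable lebesgue"
    and le: "\<And>x. norm (g x) \<le> B" and supp: "\<And>x. x \<notin> cball x0 r \<Longrightarrow> g x = 0"
  shows "g \<in> L2" and "l2norm g \<le> B * sqrt (measure lebesgue (cball x0 r))"
proof -
  have B0: "0 \<le> B" using le[of x0] norm_ge_zero order_trans by blast
  have int: "integrable lebesgue (\<lambda>x. indicator (cball x0 r) x * B\<^sup>2 :: real)"
    using emeasure_bounded_finite[OF bounded_cball, of x0 r]
    by (intro integrable_mult_left integrable_real_indicator) auto
  have pt: "(norm (g x))\<^sup>2 \<le> indicator (cball x0 r) x * B\<^sup>2" for x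
  proof (cases "x \<in> cball x0 r")
    case True
    then show ?thesis using power_mono[OF le[of x], of 2] by simp
  next
    case False
    then show ?thesis using supp[OF False] by simp
  qed
  have i: "integrable lebesgue (\<lambda>x. (norm (g x))\<^sup>2)"
    by (rule Bochner_Integration.integrable_bound[OF int]) (use m pt in \<open>auto intro!: AE_I2\<close>)
  then show "g \<in> L2" using m by (simp add: L2_def)
  have "(\<integral>x. (norm (g x))\<^sup>2 \<partial>lebesgue) \<le> (\<integral>x. indicator (cball x0 r) x * B\<^sup>2 \<partial>lebesgue)"
    by (rule integral_mono[OF i int pt])
  also have "\<dots> = measure lebesgue (cball x0 r) * B\<^sup>2" by simp
  finally show "l2norm g \<le> B * sqrt (measure lebesgue (cball x0 r))"
    using B0 real_sqrt_le_mono unfolding l2norm_def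
    by (fastforce simp: real_sqrt_mult mult.commute)
qed

lemma continuous_imp_lebesgue_measurable:
  fixes g :: "R3 \<Rightarrow> 'b::euclidean_space"
  assumes "continuous_on UNIV g" shows "g \<in> borel_measurable lebesgue"
  by (intro measurable_completion) (use borel_measurable_continuous_onI[OF assms] in simp)

text \<open>
  Weak continuity takes care of the increment of \<open>u\<close>, paired with a fixed \<open>\<Psi> (_, s)\<close>. The increment of
  \<open>\<Psi>\<close> is small in \<open>L\<^sup>2\<close> by uniform continuity on a compact set.
\<close>
lemma continuous_on_l2inner:
  fixes u :: "real \<Rightarrow> R3 \<Rightarrow> R3" and \<Psi> :: "R3 \<times> real \<Rightarrow> R3"
  assumes T: "compact T"
    and u: "\<And>s. s \<in> T \<Longrightarrow> u s \<in> L2" "\<And>s. s \<in> T \<Longrightarrow> l2norm (u s) \<le> C"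
    and weak: "\<And>h. h \<in> L2 \<Longrightarrow> continuous_on T (\<lambda>s. l2inner (u s) h)"
    and \<Psi>: "continuous_on (UNIV \<times> T) \<Psi>"
    and supp: "\<And>x s. s \<in> T \<Longrightarrow> x \<notin> cball x0 r \<Longrightarrow> \<Psi> (x, s) = 0"
  shows "continuous_on T (\<lambda>s. l2inner (u s) (\<lambda>x. \<Psi> (x, s)))"
proof -
  define V where "V = sqrt (measure lebesgue (cball x0 r))"
  have V0: "V \<ge> 0" by (simp add: V_def)
  have meas: "(\<lambda>x. \<Psi> (x, s)) \<in> borel_measurable lebesgue" if "s \<in> T" for s
    by (rule continuous_imp_lebesgue_measurable)
       (rule continuous_on_compose2[OF \<Psi>], use that in \<open>auto intro!: continuous_intros\<close>)
  have comp: "compact (cball x0 r \<times> T)" using T by (simp add: compact_Times)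
  have uc: "uniformly_continuous_on (cball x0 r \<times> T) \<Psi>"
    by (rule compact_uniformly_continuous[OF continuous_on_subset[OF \<Psi>] comp]) auto
  have "bounded (\<Psi> ` (cball x0 r \<times> T))"
    by (rule compact_imp_bounded[OF compact_continuous_image[OF continuous_on_subset[OF \<Psi>] comp]]) auto
  then obtain b where b: "\<forall>y\<in>\<Psi> ` (cball x0 r \<times> T). norm y \<le> b" by (auto simp: bounded_iff)
  have L2: "(\<lambda>x. \<Psi> (x, s)) \<in> L2" if "s \<in> T" for s
  proof (rule L2_bounded_support(1)[OF meas[OF that]])
    show "norm (\<Psi> (x, s)) \<le> max b 0" for x
      using b supp[OF that, of x] that by (cases "x \<in> cball x0 r") (force simp del: mem_cball)+
  qed (use supp that in auto)
  show ?thesis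
    unfolding continuous_on_iff
  proof (intro ballI allI impI)
    fix s :: real and \<kappa> :: real assume s: "s \<in> T" and \<kappa>: "0 < \<kappa>"
    define k where "k = \<kappa> / (2 * (\<bar>C\<bar> * V + 1))"
    have pos: "0 < 2 * (\<bar>C\<bar> * V + 1)" using V0 by (simp add: add_nonneg_pos)
    have k: "0 < k" using pos \<kappa> by (simp add: k_def)
    obtain d1 where d1: "d1 > 0" "\<And>p p'. p \<in> cball x0 r \<times> T \<Longrightarrow> p' \<in> cball x0 r \<times> T \<Longrightarrow>
        dist p' p < d1 \<Longrightarrow> dist (\<Psi> p') (\<Psi> p) < k"
      using uc k unfolding uniformly_continuous_on_def by metis
    obtain d2 where d2: "d2 > 0" "\<And>s'. s' \<in> T \<Longrightarrow> dist s' s < d2 \<Longrightarrow>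
        dist (l2inner (u s') (\<lambda>x. \<Psi> (x, s))) (l2inner (u s) (\<lambda>x. \<Psi> (x, s))) < \<kappa> / 2"
      using weak[OF L2[OF s]] s \<kappa> unfolding continuous_on_iff by (meson half_gt_zero)
    show "\<exists>d>0. \<forall>s'\<in>T. dist s' s < d \<longrightarrow>
        dist (l2inner (u s') (\<lambda>x. \<Psi> (x, s'))) (l2inner (u s) (\<lambda>x. \<Psi> (x, s))) < \<kappa>"
    proof (intro exI[of _ "min d1 d2"] conjI ballI impI)
      show "0 < min d1 d2" using d1 d2 by simp
      fix s' assume s': "s' \<in> T" and d: "dist s' s < min d1 d2"
      have le: "norm (\<Psi> (x, s') - \<Psi> (x, s)) \<le> k" for x
      proof (cases "x \<in> cball x0 r")
        case True
        have "dist (x, s') (x, s) < d1" using d by (simp add: dist_Pair_Pair)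
        then have "dist (\<Psi> (x, s')) (\<Psi> (x, s)) < k" using d1(2) True s s' by blast
        then show ?thesis by (simp add: dist_norm)
      next
        case False
        then show ?thesis using supp s s' k by simp
      qed
      have dL2: "(\<lambda>x. \<Psi> (x, s') - \<Psi> (x, s)) \<in> L2" by (rule L2_diff[OF L2[OF s'] L2[OF s]])
      have "l2norm (\<lambda>x. \<Psi> (x, s') - \<Psi> (x, s)) \<le> k * V"
        unfolding V_def
        by (rule L2_bounded_support(2)[OF L2_D(1)[OF dL2] le]) (use supp s s' in auto)
      then have "l2norm (u s') * l2norm (\<lambda>x. \<Psi> (x, s') - \<Psi> (x, s)) \<le> \<bar>C\<bar> * (k * V)"
        using u(2)[OF s'] by (intro mult_mono l2norm_nonneg) auto
      with L2_inner(2)[OF u(1)[OF s'] dL2]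
      have "\<bar>l2inner (u s') (\<lambda>x. \<Psi> (x, s') - \<Psi> (x, s))\<bar> \<le> \<bar>C\<bar> * (k * V)"
        by linarith
      also have "\<bar>C\<bar> * (k * V) \<le> k * (\<bar>C\<bar> * V + 1)" using k by (simp add: algebra_simps)
      also have "\<dots> = \<kappa> / 2" using pos by (simp add: k_def field_simps)
      finally have "\<bar>l2inner (u s') (\<lambda>x. \<Psi> (x, s')) - l2inner (u s') (\<lambda>x. \<Psi> (x, s))\<bar> \<le> \<kappa> / 2"
        by (simp add: l2inner_diff_right[OF u(1)[OF s'] L2[OF s'] L2[OF s]])
      moreover have "\<bar>l2inner (u s') (\<lambda>x. \<Psi> (x, s)) - l2inner (u s) (\<lambda>x. \<Psi> (x, s))\<bar> < \<kappa> / 2"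
        using d2(2)[OF s'] d by (simp add: dist_real_def)
      ultimately show "dist (l2inner (u s') (\<lambda>x. \<Psi> (x, s'))) (l2inner (u s) (\<lambda>x. \<Psi> (x, s))) < \<kappa>"
        unfolding dist_real_def by linarith
    qed
  qed
qed

section \<open>Smooth time windows\<close>

definition window :: "real \<Rightarrow> real \<Rightarrow> real \<Rightarrow> real \<Rightarrow> real" where
  "window \<tau>0 \<tau>1 \<epsilon> s = smooth_step ((s - \<tau>0) / \<epsilon>) * smooth_step ((\<tau>1 - s) / \<epsilon>)"

definition window' :: "real \<Rightarrow> real \<Rightarrow> real \<Rightarrow> real \<Rightarrow> real" where
  "window' \<tau>0 \<tau>1 \<epsilon> s =
     (step_deriv 1 ((s - \<tau>0) / \<epsilon>) * smooth_step ((\<tau>1 - s) / \<epsilon>)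
      - smooth_step ((s - \<tau>0) / \<epsilon>) * step_deriv 1 ((\<tau>1 - s) / \<epsilon>)) / \<epsilon>"

lemma DERIV_window: "(window \<tau>0 \<tau>1 \<epsilon> has_real_derivative window' \<tau>0 \<tau>1 \<epsilon> s) (at s)"
proof -
  have d: "(smooth_step has_real_derivative step_deriv 1 x) (at x)" for x
    using DERIV_step_deriv[of 0 x] by (simp add: step_deriv_0)
  have "((\<lambda>s. (s - \<tau>0) / \<epsilon>) has_real_derivative 1 / \<epsilon>) (at s)"
       "((\<lambda>s. (\<tau>1 - s) / \<epsilon>) has_real_derivative - 1 / \<epsilon>) (at s)"
    using DERIV_cdivide[OF DERIV_diff[OF DERIV_ident DERIV_const]]
       DERIV_cdivide[OF DERIV_diff[OF DERIV_const DERIV_ident]] by fastforce+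
  from DERIV_mult[OF DERIV_chain2[OF d this(1)] DERIV_chain2[OF d this(2)]]
  show ?thesis by (simp add: window_def[abs_def] window'_def diff_divide_distrib mult.commute)
qed

lemma Ck_on_window: "Ck_on k UNIV (window \<tau>0 \<tau>1 \<epsilon>)"
proof -
  have s: "Ck_on k UNIV smooth_step" using smooth_on_step by (simp add: smooth_on_def)
  have "Ck_on k UNIV (\<lambda>s. smooth_step ((s - \<tau>0) * inverse \<epsilon>) * smooth_step ((\<tau>1 - s) * inverse \<epsilon>))"
    by (intro Ck_on_mult Ck_on_compose_real[OF s] Ck_on_diff Ck_on_const Ck_on_bounded_linear
        bounded_linear_ident) auto
  then show ?thesis by (simp add: window_def[abs_def] divide_inverse)
qed

lemma window_bounds: "0 \<le> window \<tau>0 \<tau>1 \<epsilon> s" "window \<tau>0 \<tau>1 \<epsilon> s \<le> 1"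
  using step_bounds by (auto simp: window_def intro: mult_le_one)

lemma window_eq_0:
  "0 < \<epsilon> \<Longrightarrow> s \<notin> {\<tau>0 + \<epsilon>..\<tau>1 - \<epsilon>} \<Longrightarrow> window \<tau>0 \<tau>1 \<epsilon> s = 0"
  by (auto simp: window_def step_eq_0 field_simps)

lemma continuous_window': "continuous_on A (window' \<tau>0 \<tau>1 \<epsilon>)"
proof -
  have "continuous_on UNIV smooth_step" using continuous_step_deriv[of UNIV 0] by (simp add: step_deriv_0)
  note c = continuous_on_compose2[OF this] continuous_on_compose2[OF continuous_step_deriv[of UNIV 1]]
  have "continuous_on A (\<lambda>s. (step_deriv 1 ((s - \<tau>0) * inverse \<epsilon>) * smooth_step ((\<tau>1 - s) * inverse \<epsilon>)
      - smooth_step ((s - \<tau>0) * inverse \<epsilon>) * step_deriv 1 ((\<tau>1 - s) * inverse \<epsilon>)) * inverse \<epsilon>)"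
    by (intro continuous_intros c) auto
  then show ?thesis by (simp add: window'_def[abs_def] divide_inverse)
qed

lemma weighted_average_close:
  fixes w a :: "real \<Rightarrow> real"
  assumes "p \<le> q" and w: "continuous_on {p..q} w" "\<And>s. s \<in> {p..q} \<Longrightarrow> 0 \<le> w s" "integral {p..q} w = 1"
    and a: "continuous_on {p..q} a" "\<And>s. s \<in> {p..q} \<Longrightarrow> w s \<noteq> 0 \<Longrightarrow> \<bar>a s - c\<bar> \<le> \<kappa>"
  shows "\<bar>integral {p..q} (\<lambda>s. w s * a s) - c\<bar> \<le> \<kappa>"
proof -
  have i: "(\<lambda>s. w s * a s) integrable_on {p..q}" "w integrable_on {p..q}"
    using w a by (auto intro!: integrable_continuous_interval continuous_intros)
  have "((\<lambda>s. w s * a s - w s * c) has_integral integral {p..q} (\<lambda>s. w s * a s) - 1 * c) {p..q}"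
    using i w(3) by (intro has_integral_diff has_integral_mult_left) (auto simp: has_integral_integral)
  then have eq: "integral {p..q} (\<lambda>s. w s * (a s - c)) = integral {p..q} (\<lambda>s. w s * a s) - c"
    by (simp add: integral_unique right_diff_distrib)
  have "norm (integral {p..q} (\<lambda>s. w s * (a s - c))) \<le> integral {p..q} (\<lambda>s. w s * \<kappa>)"
  proof (rule integral_norm_bound_integral)
    show "norm (w s * (a s - c)) \<le> w s * \<kappa>" if "s \<in> {p..q}" for s
      using a(2)[OF that] w(2)[OF that] by (cases "w s = 0") (auto simp: abs_mult intro: mult_left_mono)
  qed (use w a in \<open>auto intro!: integrable_continuous_interval continuous_intros\<close>)
  then show ?thesis using w(3) by (simp add: eq)
qed

text \<open>
  As \<open>\<epsilon>\<close> tends to \<open>0\<close>, \<open>window' \<tau>0 \<tau>1 \<epsilon>\<close> tends to the difference of the unit masses at \<open>\<tau>0\<close> and \<open>\<tau>1\<close>.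
  The window opens strictly after \<open>\<tau>0\<close>, so that \<open>\<tau>0 = 0\<close> is admissible for test functions that
  are supported in positive times.
\<close>
lemma endpoint_difference_le:
  fixes a :: "real \<Rightarrow> real"
  assumes "\<tau>0 < \<tau>1" and a: "continuous_on {\<tau>0..\<tau>1} a"
    and M: "\<And>\<epsilon>. 0 < \<epsilon> \<Longrightarrow> 4 * \<epsilon> < \<tau>1 - \<tau>0 \<Longrightarrow>
       \<bar>integral {\<tau>0..\<tau>1} (\<lambda>s. window' \<tau>0 \<tau>1 \<epsilon> s * a s)\<bar> \<le> M"
  shows "\<bar>a \<tau>0 - a \<tau>1\<bar> \<le> M"
proof (rule field_le_epsilon)
  fix \<kappa> :: real assume "0 < \<kappa>"
  then have k2: "0 < \<kappa> / 2" by simp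
  obtain d where d: "0 < d" "\<And>s s'. s \<in> {\<tau>0..\<tau>1} \<Longrightarrow> s' \<in> {\<tau>0..\<tau>1} \<Longrightarrow> dist s' s < d \<Longrightarrow> dist (a s') (a s) < \<kappa> / 2"
    using compact_uniformly_continuous[OF a] k2 unfolding uniformly_continuous_on_def
    by (metis compact_Icc)
  define \<epsilon> where "\<epsilon> = min (d / 4) ((\<tau>1 - \<tau>0) / 8)"
  have \<epsilon>: "0 < \<epsilon>" "4 * \<epsilon> < \<tau>1 - \<tau>0" "2 * \<epsilon> < d" using d assms(1) by (auto simp: \<epsilon>_def min_def)
  \<comment> \<open>before the midpoint the window only opens, after it the window only closes\<close>
  define m where "m = (\<tau>0 + \<tau>1) / 2"
  have m: "\<tau>0 < m" "m < \<tau>1" "m - \<tau>0 > 2 * \<epsilon>" "\<tau>1 - m > 2 * \<epsilon>"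
    using assms(1) \<epsilon> by (auto simp: m_def field_simps)
  let ?w = "window' \<tau>0 \<tau>1 \<epsilon>"
  have left: "?w s = step_deriv 1 ((s - \<tau>0) / \<epsilon>) / \<epsilon>" if "s \<le> m" for s
  proof -
    have "2 < (\<tau>1 - s) / \<epsilon>" using that m \<epsilon>(1) by (simp add: field_simps)
    then show ?thesis
      using step_deriv_outside[of "(\<tau>1 - s) / \<epsilon>" 0] by (simp add: window'_def step_eq_1)
  qed
  have right: "?w s = - step_deriv 1 ((\<tau>1 - s) / \<epsilon>) / \<epsilon>" if "m \<le> s" for s
  proof -
    have "2 < (s - \<tau>0) / \<epsilon>" using that m \<epsilon>(1) by (simp add: field_simps)
    then show ?thesis
      using step_deriv_outside[of "(s - \<tau>0) / \<epsilon>" 0] by (simp add: window'_def step_eq_1)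
  qed
  have ftc: "(?w has_integral window \<tau>0 \<tau>1 \<epsilon> q - window \<tau>0 \<tau>1 \<epsilon> p) {p..q}" if "p \<le> q" for p q
    by (rule fundamental_theorem_of_calculus[OF that])
       (use DERIV_window in \<open>auto simp: has_real_derivative_iff_has_vector_derivative
          intro: has_vector_derivative_at_within\<close>)
  have w1: "window \<tau>0 \<tau>1 \<epsilon> m = 1"
  proof -
    have "2 \<le> (m - \<tau>0) / \<epsilon>" "2 \<le> (\<tau>1 - m) / \<epsilon>" using m \<epsilon>(1) by (auto simp: field_simps)
    then show ?thesis by (simp add: window_def step_eq_1)
  qed
  have w0: "window \<tau>0 \<tau>1 \<epsilon> \<tau>0 = 0" "window \<tau>0 \<tau>1 \<epsilon> \<tau>1 = 0"
    using window_eq_0[of \<epsilon> \<tau>0 \<tau>0 \<tau>1] window_eq_0[of \<epsilon> \<tau>1 \<tau>0 \<tau>1] \<epsilon> by auto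
  have ac: "continuous_on {\<tau>0..m} a" "continuous_on {m..\<tau>1} a"
    using m by (auto intro: continuous_on_subset[OF a])
  have L: "\<bar>integral {\<tau>0..m} (\<lambda>s. ?w s * a s) - a \<tau>0\<bar> \<le> \<kappa> / 2"
  proof (rule weighted_average_close[OF _ continuous_window' _ _ ac(1)])
    show "integral {\<tau>0..m} ?w = 1" using ftc[of \<tau>0 m] m w1 w0 by (simp add: integral_unique)
    show "0 \<le> ?w s" if "s \<in> {\<tau>0..m}" for s
      using that left step_deriv_nonneg[of "(s - \<tau>0) / \<epsilon>"] \<epsilon>(1) by simp
    show "\<bar>a s - a \<tau>0\<bar> \<le> \<kappa> / 2" if s: "s \<in> {\<tau>0..m}" and nz: "?w s \<noteq> 0" for s
    proof -
      have "(s - \<tau>0) / \<epsilon> \<le> 2"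
        using nz left[of s] s step_deriv_outside[of "(s - \<tau>0) / \<epsilon>" 0] by (cases "(s - \<tau>0) / \<epsilon> \<le> 2") auto
      then have "dist s \<tau>0 < d" using \<epsilon> s by (simp add: dist_real_def field_simps)
      then show ?thesis using d(2)[of \<tau>0 s] s m by (simp add: dist_real_def)
    qed
  qed (use m in auto)
  have R: "\<bar>integral {m..\<tau>1} (\<lambda>s. - ?w s * a s) - a \<tau>1\<bar> \<le> \<kappa> / 2"
  proof (rule weighted_average_close[OF _ continuous_on_minus[OF continuous_window'] _ _ ac(2)])
    show "integral {m..\<tau>1} (\<lambda>s. - ?w s) = 1" using ftc[of m \<tau>1] m w1 w0 by (simp add: integral_unique)
    show "0 \<le> - ?w s" if "s \<in> {m..\<tau>1}" for s
      using that right step_deriv_nonneg[of "(\<tau>1 - s) / \<epsilon>"] \<epsilon>(1) by simp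
    show "\<bar>a s - a \<tau>1\<bar> \<le> \<kappa> / 2" if s: "s \<in> {m..\<tau>1}" and nz: "- ?w s \<noteq> 0" for s
    proof -
      have "(\<tau>1 - s) / \<epsilon> \<le> 2"
        using nz right[of s] s step_deriv_outside[of "(\<tau>1 - s) / \<epsilon>" 0] by (cases "(\<tau>1 - s) / \<epsilon> \<le> 2") auto
      then have "dist s \<tau>1 < d" using \<epsilon> s by (simp add: dist_real_def field_simps)
      then show ?thesis using d(2)[of \<tau>1 s] s m by (simp add: dist_real_def)
    qed
  qed (use m in auto)
  have "integral {\<tau>0..m} (\<lambda>s. ?w s * a s) + integral {m..\<tau>1} (\<lambda>s. ?w s * a s)
      = integral {\<tau>0..\<tau>1} (\<lambda>s. ?w s * a s)"
    by (rule Henstock_Kurzweil_Integration.integral_combine)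
       (use m a in \<open>auto intro!: integrable_continuous_interval continuous_intros continuous_window'\<close>)
  moreover have "integral {m..\<tau>1} (\<lambda>s. - ?w s * a s) = - integral {m..\<tau>1} (\<lambda>s. ?w s * a s)"
    by simp
  ultimately show "\<bar>a \<tau>0 - a \<tau>1\<bar> \<le> M + \<kappa>"
    using L R M[OF \<epsilon>(1,2)] by linarith
qed

section \<open>Testing the momentum equation\<close>

text \<open>
  The pressure only sees the divergence of the test function.
\<close>
lemma momentum_equation_solenoidal:
  fixes \<phi> :: "R3 \<times> real \<Rightarrow> R3"
  assumes mom: "momentum_equation u Du"
    and \<phi>: "\<phi> \<in> test_functions (UNIV \<times> {0<..})"
    and div: "\<And>x t. divergence (\<lambda>y. \<phi> (y, t)) x = 0"
  shows "has_bochner_integral (lebesgue_on {0<..})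
    (\<lambda>t. \<integral>x. - (u t x \<bullet> vector_derivative (\<lambda>s. \<phi> (x, s)) (at t))
        + (Du t x *v u t x) \<bullet> \<phi> (x, t) - u t x \<bullet> laplacian (\<lambda>y. \<phi> (y, t)) x \<partial>lebesgue) 0"
proof -
  obtain P where P: "distribution_on (UNIV \<times> {0<..}) P"
    and int: "has_bochner_integral (lebesgue_on {0<..})
      (\<lambda>t. \<integral>x. - (u t x \<bullet> vector_derivative (\<lambda>s. \<phi> (x, s)) (at t))
        + (Du t x *v u t x) \<bullet> \<phi> (x, t) - u t x \<bullet> laplacian (\<lambda>y. \<phi> (y, t)) x \<partial>lebesgue)
      (P (\<lambda>(x, t). divergence (\<lambda>y. \<phi> (y, t)) x))"
    using mom \<phi> unfolding momentum_equation_def by blast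
  have zero: "(\<lambda>_. 0) \<in> test_functions (UNIV \<times> {0<..} :: (R3 \<times> real) set)"
    by (auto simp: test_functions_def smooth_on_def Ck_on_const intro!: exI[of _ "{}"])
  have "\<forall>\<phi>\<in>test_functions (UNIV \<times> {0<..}). \<forall>\<psi>\<in>test_functions (UNIV \<times> {0<..}). \<forall>a b.
      P (\<lambda>x. a * \<phi> x + b * \<psi> x) = a * P \<phi> + b * P \<psi>"
    using P unfolding distribution_on_def by (rule conjunct1)
  from this[rule_format, OF zero zero, of 0 0] have "P (\<lambda>_. 0) = 0" by simp
  then have "P (\<lambda>(x, t). divergence (\<lambda>y. \<phi> (y, t)) x) = 0" by (simp add: div case_prod_unfold)
  with int show ?thesis by simp
qed

lemma norm_matrix_vector_mult_le:
  fixes A :: "real^'n^'m" and x :: "real^'n"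
  shows "norm (A *v x) \<le> norm A * norm x"
proof -
  have "norm (A *v x) = L2_set (\<lambda>i. norm ((A *v x) $ i)) UNIV" by (simp add: norm_vec_def)
  also have "\<dots> \<le> L2_set (\<lambda>i. norm x * norm (A $ i)) UNIV"
  proof (rule L2_set_mono)
    show "norm ((A *v x) $ i) \<le> norm x * norm (A $ i)" for i
      using Cauchy_Schwarz_ineq2[of "A $ i" x]
      by (simp add: matrix_vector_mul_component mult.commute)
  qed simp
  also have "\<dots> = norm A * norm x"
    by (simp add: norm_vec_def[of A] L2_set_right_distrib mult.commute)
  finally show ?thesis .
qed

lemma borel_measurable_matrix_vector_mult:
  fixes A :: "'a \<Rightarrow> real^3^3" and f :: "'a \<Rightarrow> R3"
  assumes "A \<in> borel_measurable M" "f \<in> borel_measurable M"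
  shows "(\<lambda>x. A x *v f x) \<in> borel_measurable M"
proof (rule borel_measurable_continuous_Pair[OF assms, where H="(*v)"])
  show "continuous_on UNIV (\<lambda>p :: (real^3^3) \<times> R3. fst p *v snd p)"
    unfolding matrix_vector_mult_def by (intro continuous_intros)
qed

lemma matrix_vector_pairing:
  fixes A :: "R3 \<Rightarrow> real^3^3" and f g :: "R3 \<Rightarrow> R3"
  assumes A: "A \<in> L2" and f: "f \<in> L2" and g: "g \<in> borel_measurable lebesgue"
    and b: "\<And>x. norm (g x) \<le> b"
  shows "integrable lebesgue (\<lambda>x. (A x *v f x) \<bullet> g x)"
    and "\<bar>\<integral>x. (A x *v f x) \<bullet> g x \<partial>lebesgue\<bar> \<le> b * (l2norm A * l2norm f)"
proof -
  have b0: "0 \<le> b" using b[of 0] norm_ge_zero order_trans by blast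
  have m: "(\<lambda>x. (A x *v f x) \<bullet> g x) \<in> borel_measurable lebesgue"
    using borel_measurable_matrix_vector_mult[OF L2_D(1)[OF A] L2_D(1)[OF f]] g
    by (rule borel_measurable_inner)
  have pt: "\<bar>(A x *v f x) \<bullet> g x\<bar> \<le> b * (norm (A x) * norm (f x))" for x
  proof -
    have "\<bar>(A x *v f x) \<bullet> g x\<bar> \<le> norm (A x *v f x) * norm (g x)" by (rule Cauchy_Schwarz_ineq2)
    also have "\<dots> \<le> (norm (A x) * norm (f x)) * b"
      by (intro mult_mono norm_matrix_vector_mult_le b) auto
    finally show ?thesis by (simp add: mult.commute)
  qed
  have i: "integrable lebesgue (\<lambda>x. b * (norm (A x) * norm (f x)))"
    by (intro integrable_mult_right L2_norm_product A f)
  show I: "integrable lebesgue (\<lambda>x. (A x *v f x) \<bullet> g x)"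
    by (rule Bochner_Integration.integrable_bound[OF i m])
       (use pt b0 in \<open>auto intro!: AE_I2 simp: abs_mult\<close>)
  have "\<bar>\<integral>x. (A x *v f x) \<bullet> g x \<partial>lebesgue\<bar> \<le> (\<integral>x. b * (norm (A x) * norm (f x)) \<partial>lebesgue)"
    by (rule order_trans[OF integral_abs_bound integral_mono[OF integrable_abs[OF I] i pt]])
  also have "\<dots> \<le> b * (l2norm A * l2norm f)"
    using L2_norm_product(2)[OF A f] b0 by (simp add: mult_left_mono)
  finally show "\<bar>\<integral>x. (A x *v f x) \<bullet> g x \<partial>lebesgue\<bar> \<le> b * (l2norm A * l2norm f)" .
qed

lemma scaleR_axial_field:
  "c *\<^sub>R axial_field e \<beta> P Q z = axial_field e \<beta> (\<lambda>a. c * P a) (\<lambda>a. c * Q a) z"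
  by (simp add: axial_field_def algebra_simps)

lemma gauss_rate_mono: "s \<le> s' \<Longrightarrow> s' < t \<Longrightarrow> gauss_rate t s \<le> gauss_rate t s'"
  by (simp add: gauss_rate_def frac_le)

lemma gauss_height_mono: "s \<le> s' \<Longrightarrow> s' < t \<Longrightarrow> gauss_height t s \<le> gauss_height t s'"
  unfolding gauss_height_def by (intro powr_mono2') auto

context radial_profile
begin

lemma laplacian_scaleR_oseen_field:
  "laplacian (\<lambda>x. c *\<^sub>R oseen_field e x0 t s x) x = c *\<^sub>R laplacian (oseen_field e x0 t s) x"
proof -
  note d = DERIV_cmult[OF coeff_derivs(1), of c] DERIV_cmult[OF coeff_derivs(2), of c]
    DERIV_cmult[OF coeff_derivs(3), of c] DERIV_cmult[OF coeff_derivs(4), of c]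
  show ?thesis
    unfolding oseen_field_def[abs_def] scaleR_axial_field
    by (subst laplacian_axial_field[OF d(1,2,3,4)], subst laplacian_axial_field[OF coeff_derivs(1,2,3,4)])
       (simp add: axial_field_def algebra_simps)
qed

lemma divergence_scaleR_oseen_field: "divergence (\<lambda>x. c *\<^sub>R oseen_field e x0 t s x) x = 0"
  unfolding oseen_field_def[abs_def] scaleR_axial_field
  by (subst divergence_axial_field[OF DERIV_cmult[OF coeff_derivs(1)] DERIV_cmult[OF coeff_derivs(3)]])
     (simp add: Let_def algebra_simps)

text \<open>
  The rate is smallest at the earliest time, so one ball contains the supports for all later times.
\<close>
lemma outside_support:
  assumes "t0 \<le> s" "s < t" "x \<notin> cball x0 (sqrt (4 * L * (t - t0)))"
  shows "L < gauss_rate t s * ((x - x0) \<bullet> (x - x0))"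
proof -
  have "sqrt (4 * L * (t - t0)) < norm (x - x0)"
    using assms(3) by (simp add: dist_norm norm_minus_commute)
  moreover have "0 \<le> sqrt (4 * L * (t - t0))" using assms L_pos by simp
  ultimately have "(sqrt (4 * L * (t - t0)))\<^sup>2 < (norm (x - x0))\<^sup>2" by (intro power_strict_mono) auto
  then have "4 * L * (t - t0) < (x - x0) \<bullet> (x - x0)"
    using assms L_pos by (simp add: power2_norm_eq_inner)
  moreover have "4 * L * (t - s) \<le> 4 * L * (t - t0)" using assms L_pos by simp
  moreover have "L * (4 * (t - s)) = 4 * L * (t - s)" by simp
  ultimately have "L * (4 * (t - s)) < (x - x0) \<bullet> (x - x0)" by linarith
  then show ?thesis using assms by (simp add: gauss_rate_def pos_less_divide_eq)
qed

lemma window_oseen_test_function: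
  assumes "0 \<le> t0" "t0 < t1" "t1 < t" "0 < \<epsilon>"
  shows "(\<lambda>(x, s). window t0 t1 \<epsilon> s *\<^sub>R oseen_field e x0 t s x) \<in> test_functions (UNIV \<times> {0<..})"
proof -
  let ?f = "\<lambda>(x, s). window t0 t1 \<epsilon> s *\<^sub>R oseen_field e x0 t s x"
  have "Ck_on k UNIV ?f" for k
  proof (rule Ck_on_extend_by_zero)
    show "open (UNIV \<times> {..<t} :: (R3 \<times> real) set)" by (intro open_Times) auto
    show "closed (UNIV \<times> {t0 + \<epsilon>..t1 - \<epsilon>} :: (R3 \<times> real) set)" by (intro closed_Times) auto
    show "UNIV \<times> {t0 + \<epsilon>..t1 - \<epsilon>} \<subseteq> (UNIV \<times> {..<t} :: (R3 \<times> real) set)" using assms by auto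
    have "Ck_on k (UNIV \<times> {..<t}) (\<lambda>p :: R3 \<times> real. window t0 t1 \<epsilon> (snd p))"
      by (rule Ck_on_compose_real[OF Ck_on_window Ck_on_bounded_linear[OF bounded_linear_snd]]) simp
    from Ck_on_scaleR[OF this Ck_on_oseen_field[unfolded case_prod_unfold]]
    show "Ck_on k (UNIV \<times> {..<t}) ?f" by (simp add: case_prod_unfold)
    show "?f p = 0" if "p \<notin> UNIV \<times> {t0 + \<epsilon>..t1 - \<epsilon>}" for p
      using that window_eq_0[OF assms(4), of "snd p" t0 t1] by (cases p) auto
  qed
  moreover have "compact (cball x0 (sqrt (4 * L * (t - t0))) \<times> {t0 + \<epsilon>..t1 - \<epsilon>})"
    by (intro compact_Times) auto
  moreover have "cball x0 (sqrt (4 * L * (t - t0))) \<times> {t0 + \<epsilon>..t1 - \<epsilon>} \<subseteq> UNIV \<times> {0<..}"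
    using assms by auto
  moreover have "?f p = 0" if "p \<notin> cball x0 (sqrt (4 * L * (t - t0))) \<times> {t0 + \<epsilon>..t1 - \<epsilon>}" for p
  proof (cases "snd p \<in> {t0 + \<epsilon>..t1 - \<epsilon>}")
    case True
    then have "fst p \<notin> cball x0 (sqrt (4 * L * (t - t0)))" using that by (cases p) auto
    then show ?thesis
      using oseen_field_eq_0[OF outside_support, of t0 "snd p" t "fst p" x0 e] True assms
      by (simp add: case_prod_unfold)
  next
    case False
    then show ?thesis using window_eq_0[OF assms(4) False] by (simp add: case_prod_unfold)
  qed
  ultimately show ?thesis
    unfolding test_functions_def smooth_on_def by blast
qed

lemma continuous_on_oseen_field:
  "continuous_on (UNIV \<times> {..<t}) (\<lambda>(x, s). oseen_field e x0 t s x)"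
  using Ck_on_oseen_field[of 0] by simp

lemma oseen_field_measurable:
  assumes "s < t" shows "oseen_field e x0 t s \<in> borel_measurable lebesgue"
proof (rule continuous_imp_lebesgue_measurable)
  have "continuous_on UNIV (\<lambda>x. (\<lambda>(x, s). oseen_field e x0 t s x) (x, s))"
    by (rule continuous_on_compose2[OF continuous_on_oseen_field])
       (use assms in \<open>auto intro!: continuous_intros\<close>)
  then show "continuous_on UNIV (oseen_field e x0 t s)" by simp
qed

lemma defect_field_measurable: "defect_field e x0 t s \<in> borel_measurable lebesgue"
proof -
  have [measurable]: "G j \<in> borel_measurable borel" for j
    using Ck_on_G[of 0 j] by (intro borel_measurable_continuous_onI) simp
  have "(\<lambda>x. defect_field e x0 t s x) \<in> borel_measurable borel"
    unfolding defect_field_def axial_field_def heat_defect_def heat_defect'_def by measurable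
  then show ?thesis by (intro measurable_completion) simp
qed

lemma continuous_on_l2inner_oseen_field:
  fixes u :: "real \<Rightarrow> R3 \<Rightarrow> R3"
  assumes "0 \<le> t0" "t1 < t"
    and u: "\<And>s. s \<ge> 0 \<Longrightarrow> u s \<in> L2" "\<And>s. s \<ge> 0 \<Longrightarrow> l2norm (u s) \<le> C"
    and weak: "\<And>h. h \<in> L2 \<Longrightarrow> continuous_on {0..} (\<lambda>s. l2inner (u s) h)"
  shows "continuous_on {t0..t1} (\<lambda>s. l2inner (u s) (oseen_field e x0 t s))"
proof -
  have "continuous_on {t0..t1} (\<lambda>s. l2inner (u s) (\<lambda>x. (\<lambda>(x, s). oseen_field e x0 t s x) (x, s)))"
  proof (rule continuous_on_l2inner[where ?x0.0=x0 and r="sqrt (4 * L * (t - t0))" and C=C])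
    show "continuous_on {t0..t1} (\<lambda>s. l2inner (u s) h)" if "h \<in> L2" for h
      by (rule continuous_on_subset[OF weak[OF that]]) (use assms in auto)
    show "continuous_on (UNIV \<times> {t0..t1}) (\<lambda>(x, s). oseen_field e x0 t s x)"
      by (rule continuous_on_subset[OF continuous_on_oseen_field]) (use assms in auto)
    show "(\<lambda>(x, s). oseen_field e x0 t s x) (x, s) = 0"
      if "s \<in> {t0..t1}" "x \<notin> cball x0 (sqrt (4 * L * (t - t0)))" for x s
      using that assms oseen_field_eq_0[OF outside_support[OF _ _ that(2)]] by simp
  qed (use u assms in auto)
  then show ?thesis by simp
qed

text \<open>
  Tested with \<open>window * oseen_field\<close>, the momentum equation reads
  \<open>0 = \<integral> - window' * \<langle>u, oseen_field\<rangle> + window * (\<langle>Du u, oseen_field\<rangle> - \<langle>u, defect_field\<rangle>)\<close>.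
  The term with \<open>window'\<close> thus inherits the bound of the other one, in which \<open>\<langle>Du u, oseen_field\<rangle>\<close> is at
  most the supremum of the kernel times the \<open>L\<^sup>2\<close> norms of \<open>Du\<close> and \<open>u\<close>.
\<close>
lemma window_average_le:
  fixes u :: "real \<Rightarrow> R3 \<Rightarrow> R3"
  assumes times: "0 \<le> t0" "t0 < t1" "t1 < t" and \<epsilon>: "0 < \<epsilon>" and e: "norm e = 1"
    and u: "\<And>s. s \<ge> 0 \<Longrightarrow> u s \<in> L2" "\<And>s. s \<ge> 0 \<Longrightarrow> l2norm (u s) \<le> C"
    and weak: "\<And>h. h \<in> L2 \<Longrightarrow> continuous_on {0..} (\<lambda>s. l2inner (u s) h)"
    and mom: "momentum_equation u Du"
    and Du: "AE s in lebesgue. s \<in> {t0<..<t1} \<longrightarrow> Du s \<in> L2"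
    and int: "integrable lebesgue (\<lambda>s. indicator {t0<..<t1} s * (K * l2norm (Du s) + E))"
    and K: "\<And>s x. s \<in> {t0..t1} \<Longrightarrow> norm (oseen_field e x0 t s x) \<le> B" "B * C \<le> K"
    and E: "\<And>s. s \<in> {t0..t1} \<Longrightarrow> C * l2norm (defect_field e x0 t s) \<le> E"
    and defect_bounded: "\<And>s x. s \<in> {t0..t1} \<Longrightarrow> norm (defect_field e x0 t s x) \<le> B'"
  shows "\<bar>integral {t0..t1} (\<lambda>s. window' t0 t1 \<epsilon> s * l2inner (u s) (oseen_field e x0 t s))\<bar>
    \<le> (\<integral>s. indicator {t0<..<t1} s * (K * l2norm (Du s) + E) \<partial>lebesgue)"
proof -
  let ?I = "{t0<..<t1}"
  let ?r = "sqrt (4 * L * (t - t0))"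
  define \<phi> where "\<phi> = (\<lambda>(x, s). window t0 t1 \<epsilon> s *\<^sub>R oseen_field e x0 t s x)"
  define F where "F s = (\<integral>x. - (u s x \<bullet> vector_derivative (\<lambda>s. \<phi> (x, s)) (at s))
        + (Du s x *v u s x) \<bullet> \<phi> (x, s) - u s x \<bullet> laplacian (\<lambda>y. \<phi> (y, s)) x \<partial>lebesgue)" for s
  define A where "A s = l2inner (u s) (oseen_field e x0 t s)" for s
  have oL2: "oseen_field e x0 t s \<in> L2" if "s \<in> {t0..t1}" for s
    by (rule L2_bounded_support(1)[where ?x0.0=x0 and r="?r", OF oseen_field_measurable K(1)[OF that]])
       (use that times oseen_field_eq_0[OF outside_support] in auto)
  have dL2: "defect_field e x0 t s \<in> L2" if "s \<in> {t0..t1}" for s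
    by (rule L2_bounded_support(1)[where ?x0.0=x0 and r="?r", OF defect_field_measurable defect_bounded[OF that]])
       (use that times defect_field_eq_0[OF outside_support] in auto)
  have "has_bochner_integral (lebesgue_on {0<..}) F 0"
    unfolding F_def
  proof (rule momentum_equation_solenoidal[OF mom])
    show "\<phi> \<in> test_functions (UNIV \<times> {0<..})"
      unfolding \<phi>_def by (rule window_oseen_test_function[OF times \<epsilon>])
    show "divergence (\<lambda>y. \<phi> (y, s)) x = 0" for s x
      unfolding \<phi>_def by (simp add: divergence_scaleR_oseen_field)
  qed
  then have F_int: "integrable lebesgue (\<lambda>s. indicator {0<..} s * F s)"
    and F_0: "(\<integral>s. indicator {0<..} s * F s \<partial>lebesgue) = 0"
    by (auto simp: has_bochner_integral_iff integrable_restrict_space integral_restrict_space)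
  have F_out: "F s = 0" if "s \<notin> ?I" for s
  proof -
    have "vector_derivative (\<lambda>s. \<phi> (x, s)) (at s) = 0" for x
    proof (rule vector_derivative_at)
      have "((\<lambda>s. 0 :: R3) has_vector_derivative 0) (at s)" by simp
      then show "((\<lambda>s. \<phi> (x, s)) has_vector_derivative 0) (at s)"
        by (rule has_vector_derivative_transform_within_open[where S="- {t0 + \<epsilon>..t1 - \<epsilon>}"])
           (use that \<epsilon> window_eq_0[OF \<epsilon>, of _ t0 t1] in \<open>auto simp: \<phi>_def\<close>)
    qed
    moreover have "\<phi> (x, s) = 0" for x
      using that \<epsilon> window_eq_0[OF \<epsilon>, of s t0 t1] by (auto simp: \<phi>_def)
    moreover have "laplacian (\<lambda>y. 0 :: R3) x = 0" for x
    proof -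
      have z: "pderiv3 j (\<lambda>y. 0 :: R3) = (\<lambda>y. 0)" for j
        using pderiv3_eqI[OF has_derivative_const] by blast
      show ?thesis by (simp add: laplacian_def z)
    qed
    ultimately show ?thesis by (simp add: F_def)
  qed
  have F_in: "\<bar>F s + window' t0 t1 \<epsilon> s * A s\<bar> \<le> K * l2norm (Du s) + E"
    if s: "s \<in> ?I" and Ds: "Du s \<in> L2" for s
  proof -
    let ?w = "window t0 t1 \<epsilon> s" and ?w' = "window' t0 t1 \<epsilon> s"
    have s': "s \<in> {t0..t1}" "s < t" "0 \<le> s" using s times by auto
    have "((\<lambda>s. \<phi> (x, s)) has_vector_derivative
        ?w *\<^sub>R (defect_field e x0 t s x - laplacian (oseen_field e x0 t s) x)
        + ?w' *\<^sub>R oseen_field e x0 t s x) (at s)" for x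
      unfolding \<phi>_def case_prod_conv
      by (rule has_vector_derivative_scaleR[OF DERIV_window DERIV_oseen_field[OF s'(2)]])
    then have dt: "vector_derivative (\<lambda>s. \<phi> (x, s)) (at s) =
        ?w *\<^sub>R (defect_field e x0 t s x - laplacian (oseen_field e x0 t s) x)
        + ?w' *\<^sub>R oseen_field e x0 t s x" for x
      by (rule vector_derivative_at)
    have dx: "laplacian (\<lambda>y. \<phi> (y, s)) x = ?w *\<^sub>R laplacian (oseen_field e x0 t s) x" for x
      unfolding \<phi>_def case_prod_conv by (rule laplacian_scaleR_oseen_field)
    have "F s = (\<integral>x. ?w * ((Du s x *v u s x) \<bullet> oseen_field e x0 t s x)
        - ?w * (u s x \<bullet> defect_field e x0 t s x) - ?w' * (u s x \<bullet> oseen_field e x0 t s x) \<partial>lebesgue)"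
      unfolding F_def dt dx
      by (intro Bochner_Integration.integral_cong)
         (auto simp: \<phi>_def inner_add_right inner_diff_right algebra_simps)
    also have "\<dots> = ?w * (\<integral>x. (Du s x *v u s x) \<bullet> oseen_field e x0 t s x \<partial>lebesgue)
        - ?w * l2inner (u s) (defect_field e x0 t s) - ?w' * A s"
      using matrix_vector_pairing(1)[OF Ds u(1)[OF s'(3)] oseen_field_measurable[OF s'(2)] K(1)[OF s'(1)]]
        L2_inner(1)[OF u(1)[OF s'(3)] oL2[OF s'(1)]] L2_inner(1)[OF u(1)[OF s'(3)] dL2[OF s'(1)]]
      by (simp add: A_def l2inner_def)
    finally have "F s + ?w' * A s = ?w * ((\<integral>x. (Du s x *v u s x) \<bullet> oseen_field e x0 t s x \<partial>lebesgue)
        - l2inner (u s) (defect_field e x0 t s))" (is "_ = ?w * (?X - ?Y)")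
      by (simp add: algebra_simps)
    moreover have "\<bar>?X\<bar> \<le> K * l2norm (Du s)"
    proof -
      have B0: "0 \<le> B" using K(1)[OF s'(1), of x0] norm_ge_zero order_trans by blast
      have "\<bar>?X\<bar> \<le> B * (l2norm (Du s) * l2norm (u s))"
        by (rule matrix_vector_pairing(2)[OF Ds u(1)[OF s'(3)] oseen_field_measurable[OF s'(2)] K(1)[OF s'(1)]])
      also have "\<dots> \<le> B * (l2norm (Du s) * C)"
        by (intro mult_left_mono u(2) l2norm_nonneg B0 s')
      also have "\<dots> = (B * C) * l2norm (Du s)" by simp
      also have "\<dots> \<le> K * l2norm (Du s)" by (intro mult_right_mono K(2) l2norm_nonneg)
      finally show ?thesis .
    qed
    moreover have "\<bar>?Y\<bar> \<le> E"
    proof -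
      have "\<bar>?Y\<bar> \<le> l2norm (u s) * l2norm (defect_field e x0 t s)"
        by (rule L2_inner(2)[OF u(1)[OF s'(3)] dL2[OF s'(1)]])
      also have "\<dots> \<le> C * l2norm (defect_field e x0 t s)"
        by (intro mult_right_mono u(2) l2norm_nonneg s')
      also have "\<dots> \<le> E" by (rule E[OF s'(1)])
      finally show ?thesis .
    qed
    ultimately have XY: "\<bar>?X - ?Y\<bar> \<le> K * l2norm (Du s) + E" by linarith
    have "\<bar>?w * (?X - ?Y)\<bar> \<le> 1 * (K * l2norm (Du s) + E)"
      by (rule abs_mult_le[OF _ XY]) (use window_bounds[of t0 t1 \<epsilon> s] in simp)
    with \<open>F s + ?w' * A s = ?w * (?X - ?Y)\<close> show ?thesis by simp
  qed
  have A_cont: "continuous_on {t0..t1} A"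
    unfolding A_def[abs_def]
    by (rule continuous_on_l2inner_oseen_field[OF times(1,3) u weak])
  have wA: "continuous_on {t0..t1} (\<lambda>s. window' t0 t1 \<epsilon> s * A s)"
    by (intro continuous_intros continuous_window' A_cont)
  have wA_int: "integrable lebesgue (\<lambda>s. indicator {t0..t1} s * (window' t0 t1 \<epsilon> s * A s))"
    and wA_eq: "(\<integral>s. indicator {t0..t1} s * (window' t0 t1 \<epsilon> s * A s) \<partial>lebesgue)
      = integral {t0..t1} (\<lambda>s. window' t0 t1 \<epsilon> s * A s)"
  proof -
    have b: "set_integrable lborel {t0..t1} (\<lambda>s. window' t0 t1 \<epsilon> s * A s)"
      by (rule borel_integrable_atLeastAtMost') (rule wA)
    then have b': "set_integrable lebesgue {t0..t1} (\<lambda>s. window' t0 t1 \<epsilon> s * A s)"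
      unfolding set_integrable_def by (simp add: integrable_completion)
    then show "integrable lebesgue (\<lambda>s. indicator {t0..t1} s * (window' t0 t1 \<epsilon> s * A s))"
      by (simp add: set_integrable_def)
    show "(\<integral>s. indicator {t0..t1} s * (window' t0 t1 \<epsilon> s * A s) \<partial>lebesgue)
      = integral {t0..t1} (\<lambda>s. window' t0 t1 \<epsilon> s * A s)"
      using set_lebesgue_integral_eq_integral(2)[OF b'] by (simp add: set_lebesgue_integral_def)
  qed
  have "integral {t0..t1} (\<lambda>s. window' t0 t1 \<epsilon> s * A s)
      = (\<integral>s. indicator {0<..} s * F s + indicator {t0..t1} s * (window' t0 t1 \<epsilon> s * A s) \<partial>lebesgue)"
    using F_int wA_int by (simp add: F_0 wA_eq)
  also have "\<bar>\<dots>\<bar> \<le> (\<integral>s. indicator ?I s * (K * l2norm (Du s) + E) \<partial>lebesgue)"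
  proof (rule order_trans[OF integral_abs_bound integral_mono_AE])
    show "integrable lebesgue (\<lambda>s. \<bar>indicator {0<..} s * F s + indicator {t0..t1} s * (window' t0 t1 \<epsilon> s * A s)\<bar>)"
      using F_int wA_int by simp
    show "AE s in lebesgue. \<bar>indicator {0<..} s * F s + indicator {t0..t1} s * (window' t0 t1 \<epsilon> s * A s)\<bar>
        \<le> indicator ?I s * (K * l2norm (Du s) + E)"
      using Du
    proof eventually_elim
      case (elim s)
      show ?case
      proof (cases "s \<in> ?I")
        case True
        then show ?thesis using F_in elim times by simp
      next
        case False
        have "window' t0 t1 \<epsilon> s = 0" if "s \<in> {t0, t1}"
          using that \<epsilon> times step_deriv_outside[of "(t0 - t0) / \<epsilon>" 0] step_deriv_outside[of "(t1 - t1) / \<epsilon>" 0]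
          by (auto simp: window'_def step_eq_0)
        with False have "indicator {t0..t1} s * (window' t0 t1 \<epsilon> s * A s) = 0"
          by (cases "s \<in> {t0..t1}") auto
        then show ?thesis using F_out[OF False] False by simp
      qed
    qed
  qed (rule int)
  finally show ?thesis by (simp add: A_def)
qed

text \<open>
  Height and rate of the Gaussian increase with \<open>s\<close>, so that the values at \<open>t1\<close> serve for the whole
  interval. The last term bounds the defect, in \<open>L\<^sup>2\<close>, by its supremum and the volume of the support.
\<close>
lemma pairing_increment_le:
  fixes u :: "real \<Rightarrow> R3 \<Rightarrow> R3"
  assumes times: "0 \<le> t0" "t0 < t1" "t1 < t" and e: "norm e = 1"
    and u: "\<And>s. s \<ge> 0 \<Longrightarrow> u s \<in> L2" "\<And>s. s \<ge> 0 \<Longrightarrow> l2norm (u s) \<le> C"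
    and weak: "\<And>h. h \<in> L2 \<Longrightarrow> continuous_on {0..} (\<lambda>s. l2inner (u s) h)"
    and mom: "momentum_equation u Du"
    and Du: "AE s in lebesgue. s \<in> {t0<..<t1} \<longrightarrow> Du s \<in> L2"
    and int: "integrable lebesgue (\<lambda>s. indicator {t0<..<t1} s * l2norm (Du s))"
    and B: "\<And>a. 0 \<le> a \<Longrightarrow> 2 * \<bar>G 0 a\<bar> \<le> B" "\<And>a. 0 \<le> a \<Longrightarrow> 2 * \<bar>G 0 a + a * G 1 a\<bar> \<le> B"
    and d: "\<And>a. 0 \<le> a \<Longrightarrow> \<bar>heat_defect a\<bar> \<le> d" "\<And>a. 0 \<le> a \<Longrightarrow> \<bar>a * heat_defect' a\<bar> \<le> d"
  shows "\<bar>l2inner (u t0) (oseen_field e x0 t t0) - l2inner (u t1) (oseen_field e x0 t t1)\<bar>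
    \<le> gauss_height t t1 * B * C * (\<integral>s. indicator {t0<..<t1} s * l2norm (Du s) \<partial>lebesgue)
      + C * (16 * gauss_rate t t1 * gauss_height t t1 * d
          * sqrt (measure lebesgue (cball x0 (sqrt (4 * L * (t - t0)))))) * (t1 - t0)"
proof -
  let ?V = "sqrt (measure lebesgue (cball x0 (sqrt (4 * L * (t - t0)))))"
  define D where "D = 16 * gauss_rate t t1 * gauss_height t t1 * d"
  define K where "K = gauss_height t t1 * B * C"
  define E where "E = C * (D * ?V)"
  have B0: "0 \<le> B" using B(1)[of 0] by simp
  have d0: "0 \<le> d" using d(1)[of 0] by simp
  have C0: "0 \<le> C" using u(2)[of 0] l2norm_nonneg order_trans by blast
  have o: "norm (oseen_field e x0 t s x) \<le> gauss_height t t1 * B" if "s \<in> {t0..t1}" for s x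
    by (rule order_trans[OF norm_oseen_field_le[OF e _ B] mult_right_mono[OF gauss_height_mono B0]])
       (use that times in auto)
  have de: "norm (defect_field e x0 t s x) \<le> D" if "s \<in> {t0..t1}" for s x
  proof -
    have st: "s < t" "s \<le> t1" using that times by auto
    have "norm (defect_field e x0 t s x) \<le> 4 * gauss_rate t s * gauss_height t s * (4 * d)"
      by (rule norm_defect_field_le[OF e st(1) d])
    also have "\<dots> = (16 * d) * (gauss_rate t s * gauss_height t s)" by simp
    also have "\<dots> \<le> (16 * d) * (gauss_rate t t1 * gauss_height t t1)"
      using gauss_rate_mono[OF st(2) times(3)] gauss_height_mono[OF st(2) times(3)]
        gauss_rate_pos[OF st(1)] gauss_height_pos[OF st(1)] gauss_rate_pos[OF times(3)] d0
      by (intro mult_left_mono mult_mono) auto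
    finally show ?thesis by (simp add: D_def mult.commute mult.left_commute)
  qed
  have dn: "C * l2norm (defect_field e x0 t s) \<le> E" if "s \<in> {t0..t1}" for s
    unfolding E_def
    by (rule mult_left_mono[OF L2_bounded_support(2)[OF defect_field_measurable de[OF that]] C0])
       (use that times defect_field_eq_0[OF outside_support] in auto)
  have ind: "integrable lebesgue (indicator {t0<..<t1} :: real \<Rightarrow> real)"
    using emeasure_bounded_finite[of "{t0<..<t1}"] by (intro integrable_real_indicator) auto
  have split: "(\<lambda>s. indicator {t0<..<t1} s * (K * l2norm (Du s) + E))
     = (\<lambda>s. K * (indicator {t0<..<t1} s * l2norm (Du s)) + E * indicator {t0<..<t1} s)"
    by (auto simp: algebra_simps)
  have int': "integrable lebesgue (\<lambda>s. indicator {t0<..<t1} s * (K * l2norm (Du s) + E))"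
    unfolding split using int ind by simp
  have "\<bar>l2inner (u t0) (oseen_field e x0 t t0) - l2inner (u t1) (oseen_field e x0 t t1)\<bar>
      \<le> (\<integral>s. indicator {t0<..<t1} s * (K * l2norm (Du s) + E) \<partial>lebesgue)"
  proof (rule endpoint_difference_le[OF times(2)])
    show "continuous_on {t0..t1} (\<lambda>s. l2inner (u s) (oseen_field e x0 t s))"
      by (rule continuous_on_l2inner_oseen_field[OF times(1,3) u weak])
    show "\<bar>integral {t0..t1} (\<lambda>s. window' t0 t1 \<epsilon> s * l2inner (u s) (oseen_field e x0 t s))\<bar>
      \<le> (\<integral>s. indicator {t0<..<t1} s * (K * l2norm (Du s) + E) \<partial>lebesgue)"
      if "0 < \<epsilon>" for \<epsilon>
      by (rule window_average_le[OF times that e u weak mom Du int' o _ dn de]) (simp_all add: K_def)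
  qed
  also have "\<dots> = K * (\<integral>s. indicator {t0<..<t1} s * l2norm (Du s) \<partial>lebesgue) + E * (t1 - t0)"
    unfolding split using int ind times by simp
  finally show ?thesis by (simp add: K_def E_def D_def)
qed

end

section \<open>The heat kernel\<close>

text \<open>
  By Fubini the integral is a product of integrals of normal densities on the line.
\<close>
lemma integrable_gaussian:
  fixes x0 :: R3
  assumes "0 < c"
  shows "integrable lebesgue (\<lambda>x. exp (- (c * ((x - x0) \<bullet> (x - x0)))))"
proof -
  define \<sigma> where "\<sigma> = 1 / sqrt (2 * c)"
  have \<sigma>2: "\<sigma>\<^sup>2 = 1 / (2 * c)" using assms by (simp add: \<sigma>_def power_divide)
  have \<sigma>0: "0 < \<sigma>" using assms by (simp add: \<sigma>_def)
  have one: "(\<integral>\<^sup>+r. ennreal (exp (- (c * (r - m)\<^sup>2))) \<partial>lborel) < \<infinity>" for m :: real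
  proof -
    have "exp (- (c * (r - m)\<^sup>2)) = sqrt (2 * pi * \<sigma>\<^sup>2) * normal_density m \<sigma> r" for r
      using assms by (simp add: normal_density_def \<sigma>2 field_simps)
    then have "integrable lborel (\<lambda>r. exp (- (c * (r - m)\<^sup>2)))"
      using integrable_normal_density[OF \<sigma>0, of m] by simp
    then show ?thesis by (simp add: integrable_iff_bounded)
  qed
  have "(\<integral>\<^sup>+x. ennreal (exp (- (c * ((x - x0) \<bullet> (x - x0))))) \<partial>lborel)
      = (\<integral>\<^sup>+x. (\<Prod>b\<in>Basis. ennreal (exp (- (c * (x \<bullet> b - x0 \<bullet> b)\<^sup>2)))) \<partial>lborel)"
  proof (rule nn_integral_cong)
    fix x :: R3
    have "exp (- (c * ((x - x0) \<bullet> (x - x0)))) = (\<Prod>b\<in>Basis. exp (- (c * (x \<bullet> b - x0 \<bullet> b)\<^sup>2)))"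
      by (subst euclidean_inner)
         (simp add: inner_diff_left sum_distrib_left power2_eq_square exp_sum sum_negf[symmetric])
    then show "ennreal (exp (- (c * ((x - x0) \<bullet> (x - x0)))))
        = (\<Prod>b\<in>Basis. ennreal (exp (- (c * (x \<bullet> b - x0 \<bullet> b)\<^sup>2))))"
      by (simp add: prod_ennreal)
  qed
  also have "\<dots> = (\<Prod>b\<in>(Basis :: R3 set). \<integral>\<^sup>+r. ennreal (exp (- (c * (r - x0 \<bullet> b)\<^sup>2))) \<partial>lborel)"
    by (rule nn_integral_lborel_prod) auto
  also have "\<dots> < \<infinity>"
  proof -
    have "(\<integral>\<^sup>+r. ennreal (exp (- (c * (r - m)\<^sup>2))) \<partial>lborel) \<noteq> top" for m
      using one[of m] by (simp add: less_top)
    then have "(\<Prod>b\<in>(Basis :: R3 set). \<integral>\<^sup>+r. ennreal (exp (- (c * (r - x0 \<bullet> b)\<^sup>2))) \<partial>lborel) \<noteq> top"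
      by (subst ennreal_prod_eq_top) blast
    then show ?thesis by (simp add: less_top)
  qed
  finally have "integrable lborel (\<lambda>x. exp (- (c * ((x - x0) \<bullet> (x - x0)))))"
    by (simp add: integrable_iff_bounded)
  then show ?thesis by (simp add: integrable_completion)
qed

lemma heat_kernel_eq:
  assumes "s < t"
  shows "heat_kernel (t - s) (x0 - y) =
     gauss_height t s * exp (- (gauss_rate t s * ((y - x0) \<bullet> (y - x0))))"
  by (simp add: heat_kernel_def gauss_height_def gauss_rate_def norm_minus_commute[of x0 y]
      power2_norm_eq_inner)

lemma heat_kernel_L2:
  fixes e :: R3
  assumes "0 < \<tau>" shows "(\<lambda>y. heat_kernel \<tau> (x0 - y) *\<^sub>R e) \<in> L2"
proof -
  have m: "(\<lambda>y. heat_kernel \<tau> (x0 - y) *\<^sub>R e) \<in> borel_measurable lebesgue"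
    unfolding heat_kernel_def
    by (rule continuous_imp_lebesgue_measurable) (use assms in \<open>auto intro!: continuous_intros\<close>)
  have "(norm (heat_kernel \<tau> (x0 - y) *\<^sub>R e))\<^sup>2 =
      ((4 * pi * \<tau>) powr (- 3 / 2) * norm e)\<^sup>2 * exp (- (1 / (2 * \<tau>) * ((y - x0) \<bullet> (y - x0))))" for y
  proof -
    have "(exp (- (norm (x0 - y))\<^sup>2 / (4 * \<tau>)))\<^sup>2 = exp (- (1 / (2 * \<tau>) * ((y - x0) \<bullet> (y - x0))))"
      using assms by (simp add: exp_double[symmetric] norm_minus_commute[of x0 y] power2_norm_eq_inner[symmetric])
    then show ?thesis by (simp add: heat_kernel_def power_mult_distrib algebra_simps)
  qed
  moreover have "integrable lebesgue (\<lambda>y. ((4 * pi * \<tau>) powr (- 3 / 2) * norm e)\<^sup>2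
      * exp (- (1 / (2 * \<tau>) * ((y - x0) \<bullet> (y - x0)))))"
    by (intro integrable_mult_right integrable_gaussian) (use assms in simp)
  ultimately show ?thesis using m by (simp add: L2_def)
qed

lemma heat_semigroup_nth:
  assumes "0 < \<tau>" "f \<in> L2"
  shows "heat_semigroup \<tau> f x $ i = l2inner f (\<lambda>y. heat_kernel \<tau> (x - y) *\<^sub>R axis i 1)"
    and "heat_semigroup \<tau> f x $ i = (\<integral>y. heat_kernel \<tau> (x - y) * f y $ i \<partial>lebesgue)"
proof -
  have m: "(\<lambda>y. heat_kernel \<tau> (x - y)) \<in> borel_measurable lebesgue"
    unfolding heat_kernel_def
    by (rule continuous_imp_lebesgue_measurable) (use assms in \<open>auto intro!: continuous_intros\<close>)
  have i: "integrable lebesgue (\<lambda>y. heat_kernel \<tau> (x - y) *\<^sub>R f y)"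
  proof (rule Bochner_Integration.integrable_bound)
    show "integrable lebesgue (\<lambda>y. norm (heat_kernel \<tau> (x - y) *\<^sub>R (axis i 1 :: R3)) * norm (f y))"
      by (rule L2_norm_product(1)[OF heat_kernel_L2[OF assms(1)] assms(2)])
    show "(\<lambda>y. heat_kernel \<tau> (x - y) *\<^sub>R f y) \<in> borel_measurable lebesgue"
      using m L2_D(1)[OF assms(2)] by (rule borel_measurable_scaleR)
  qed (auto simp: norm_eq_1 inner_axis_axis intro!: AE_I2)
  have "heat_semigroup \<tau> f x $ i = (\<integral>y. (heat_kernel \<tau> (x - y) *\<^sub>R f y) $ i \<partial>lebesgue)"
    using assms(1) integral_bounded_linear[OF bounded_linear_vec_nth i, of i]
    by (simp add: heat_semigroup_def Defs.convolution_def)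
  then show "heat_semigroup \<tau> f x $ i = (\<integral>y. heat_kernel \<tau> (x - y) * f y $ i \<partial>lebesgue)" by simp
  then show "heat_semigroup \<tau> f x $ i = l2inner f (\<lambda>y. heat_kernel \<tau> (x - y) *\<^sub>R axis i 1)"
    by (simp add: l2inner_def inner_axis)
qed

text \<open>
  With a Borel representative of the component of \<open>f\<close> the integrand is jointly measurable, so that
  Fubini's theorem applies.
\<close>
lemma heat_semigroup_measurable:
  assumes "0 < \<tau>" "f \<in> L2"
  shows "(\<lambda>x. heat_semigroup \<tau> f x $ i) \<in> borel_measurable lebesgue"
proof -
  have fi: "(\<lambda>y. f y $ i) \<in> borel_measurable lebesgue"
    using L2_D(1)[OF assms(2)] by (rule measurable_compose)
      (simp add: borel_measurable_continuous_onI continuous_on_component)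
  then obtain g where g[measurable]: "g \<in> borel_measurable lborel" and eq: "AE y in lborel. f y $ i = g y"
    using completion_ex_borel_measurable_real by blast
  have hk: "continuous_on UNIV (\<lambda>p :: R3 \<times> R3. heat_kernel \<tau> (fst p - snd p))"
    unfolding heat_kernel_def using assms by (auto intro!: continuous_intros)
  have hk_m[measurable]: "(\<lambda>p :: R3 \<times> R3. heat_kernel \<tau> (fst p - snd p)) \<in> borel_measurable (borel \<Otimes>\<^sub>M lborel)"
    using borel_measurable_continuous_onI[OF hk] by (simp add: borel_prod[symmetric] cong: measurable_cong_sets)
  have hk1: "(\<lambda>y. heat_kernel \<tau> (x - y)) \<in> borel_measurable borel" for x :: R3
    unfolding heat_kernel_def
    by (rule borel_measurable_continuous_onI) (use assms in \<open>auto intro!: continuous_intros\<close>)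
  have "heat_semigroup \<tau> f x $ i = (\<integral>y. heat_kernel \<tau> (x - y) * g y \<partial>lborel)" for x
  proof -
    have "heat_semigroup \<tau> f x $ i = (\<integral>y. heat_kernel \<tau> (x - y) * f y $ i \<partial>lebesgue)"
      by (rule heat_semigroup_nth(2)[OF assms])
    also have "\<dots> = (\<integral>y. heat_kernel \<tau> (x - y) * g y \<partial>lebesgue)"
    proof (rule integral_cong_AE)
      show "(\<lambda>y. heat_kernel \<tau> (x - y) * f y $ i) \<in> borel_measurable lebesgue"
        by (intro borel_measurable_times fi measurable_completion) (use hk1 in simp)
      show "(\<lambda>y. heat_kernel \<tau> (x - y) * g y) \<in> borel_measurable lebesgue"
        by (intro borel_measurable_times measurable_completion g) (use hk1 in simp)
      show "AE y in lebesgue. heat_kernel \<tau> (x - y) * f y $ i = heat_kernel \<tau> (x - y) * g y"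
        using AE_completion[OF eq] by eventually_elim simp
    qed
    also have "\<dots> = (\<integral>y. heat_kernel \<tau> (x - y) * g y \<partial>lborel)"
      by (rule integral_completion) (use hk1 g in \<open>auto intro!: borel_measurable_times\<close>)
    finally show ?thesis .
  qed
  moreover have "(\<lambda>x. \<integral>y. heat_kernel \<tau> (x - y) * g y \<partial>lborel) \<in> borel_measurable borel"
  proof (rule lborel.borel_measurable_lebesgue_integral)
    have "(\<lambda>p :: R3 \<times> R3. heat_kernel \<tau> (fst p - snd p) * g (snd p)) \<in> borel_measurable (borel \<Otimes>\<^sub>M lborel)"
      by measurable
    then show "(\<lambda>(x, y). heat_kernel \<tau> (x - y) * g y) \<in> borel_measurable (borel \<Otimes>\<^sub>M lborel)"
      by (simp add: case_prod_unfold)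
  qed
  ultimately have "(\<lambda>x. heat_semigroup \<tau> f x $ i) \<in> borel_measurable borel" by simp
  then show ?thesis by (intro measurable_completion) simp
qed

section \<open>From the truncated kernel to the heat flow\<close>

lemma radial_profile_cut_profile: "1 \<le> N \<Longrightarrow> radial_profile (cut_profile N) (2 * N)"
  by unfold_locales (use DERIV_cut_profile Ck_on_cut_profile cut_profile_eq_0 in auto)

text \<open>
  The cutoff parameter is taken to be \<open>(n + 1) ^ 4\<close>, because then the square roots that occur are
  powers of \<open>n + 1\<close>.
\<close>
lemma truncation_volume:
  fixes x0 :: R3
  assumes "0 \<le> b"
  shows "sqrt (measure lebesgue (cball x0 (sqrt (4 * (2 * real (Suc n) ^ 4) * b))))
    = real (Suc n) ^ 3 * sqrt (measure lebesgue (cball x0 (sqrt (8 * b))))"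
proof -
  have sq: "sqrt (p\<^sup>2 * q) = p * sqrt q" if "0 \<le> p" for p q :: real
    using that by (simp add: real_sqrt_mult)
  have "4 * (2 * real (Suc n) ^ 4) * b = (real (Suc n) ^ 2)\<^sup>2 * (8 * b)"
    by (simp flip: power_mult)
  then have r: "sqrt (4 * (2 * real (Suc n) ^ 4) * b) = real (Suc n) ^ 2 * sqrt (8 * b)"
    by (simp only: sq zero_le_power of_nat_0_le_iff)
  have "measure lebesgue (cball x0 (sqrt (4 * (2 * real (Suc n) ^ 4) * b)))
      = (real (Suc n) ^ 3)\<^sup>2 * measure lebesgue (cball x0 (sqrt (8 * b)))"
    unfolding r using assms by (simp add: content_cball power_mult_distrib flip: power_mult)
  then show ?thesis by (simp only: sq zero_le_power of_nat_0_le_iff)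
qed

context radial_profile
begin

text \<open>
  The coefficient of \<open>e\<close> in \<open>oseen_field_plus_grad\<close>.
\<close>
definition scalar_kernel :: "R3 \<Rightarrow> real \<Rightarrow> real \<Rightarrow> R3 \<Rightarrow> real" where
  "scalar_kernel x0 t s x = (let a = gauss_rate t s * ((x - x0) \<bullet> (x - x0))
     in gauss_height t s * (3 * G 0 a + 2 * a * G 1 a))"

lemma oseen_potential_test_function:
  assumes "s < t" shows "oseen_potential e x0 t s \<in> test_functions UNIV"
proof -
  have "oseen_potential e x0 t s x = 0" if "x \<notin> cball x0 (sqrt (4 * L * (t - s)))" for x
    using outside_support[OF order_refl assms that] by (simp add: oseen_potential_def G_eq_0)
  then show ?thesis
    unfolding test_functions_def smooth_on_def using Ck_on_oseen_potential
    by (auto intro!: exI[of _ "cball x0 (sqrt (4 * L * (t - s)))"])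
qed

lemma scalar_kernel_eq_0:
  "s < t \<Longrightarrow> x \<notin> cball x0 (sqrt (4 * L * (t - s))) \<Longrightarrow> scalar_kernel x0 t s x = 0"
  using outside_support[OF order_refl, of s t x x0] by (simp add: scalar_kernel_def Let_def G_eq_0)

lemma scalar_kernel_measurable: "scalar_kernel x0 t s \<in> borel_measurable lebesgue"
proof -
  have [measurable]: "G j \<in> borel_measurable borel" for j
    using Ck_on_G[of 0 j] by (intro borel_measurable_continuous_onI) simp
  have "scalar_kernel x0 t s \<in> borel_measurable borel"
    unfolding scalar_kernel_def[abs_def] Let_def by measurable
  then show ?thesis by (intro measurable_completion) simp
qed

text \<open>
  A solenoidal field is orthogonal to gradients, so a suitable gradient may be added to the kernel.
\<close>
lemma l2inner_oseen_field:
  assumes f: "f \<in> L2_sigma" and "s < t" and e: "norm e = 1"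
    and B: "\<And>a. 0 \<le> a \<Longrightarrow> 2 * \<bar>G 0 a\<bar> \<le> B" "\<And>a. 0 \<le> a \<Longrightarrow> 2 * \<bar>G 0 a + a * G 1 a\<bar> \<le> B"
  shows "l2inner f (oseen_field e x0 t s) = (\<integral>x. scalar_kernel x0 t s x * (f x \<bullet> e) \<partial>lebesgue)"
proof -
  let ?r = "sqrt (4 * L * (t - s))"
  have fL2: "f \<in> L2" using f by (simp add: L2_sigma_def)
  have o: "oseen_field e x0 t s \<in> L2"
    by (rule L2_bounded_support(1)[where ?x0.0=x0 and r="?r", OF oseen_field_measurable[OF assms(2)]
          norm_oseen_field_le[OF e assms(2) B]])
       (use assms(2) oseen_field_eq_0[OF outside_support[OF order_refl]] in auto)
  have k: "(\<lambda>x. scalar_kernel x0 t s x *\<^sub>R e) \<in> L2"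
  proof (rule L2_bounded_support(1)[where ?x0.0=x0 and r="?r" and B="gauss_height t s * (2 * B)"])
    show "(\<lambda>x. scalar_kernel x0 t s x *\<^sub>R e) \<in> borel_measurable lebesgue"
      using scalar_kernel_measurable by (rule borel_measurable_scaleR) simp
    show "norm (scalar_kernel x0 t s x *\<^sub>R e) \<le> gauss_height t s * (2 * B)" for x
    proof -
      define a where "a = gauss_rate t s * ((x - x0) \<bullet> (x - x0))"
      have a: "0 \<le> a" using gauss_rate_pos[OF assms(2)] by (simp add: a_def)
      have "\<bar>3 * G 0 a + 2 * a * G 1 a\<bar> = \<bar>2 * (G 0 a + a * G 1 a) + G 0 a\<bar>" by (simp add: algebra_simps)
      also have "\<dots> \<le> 2 * B"
      proof -
        have "\<bar>2 * p + q\<bar> \<le> 2 * B" if "2 * \<bar>q\<bar> \<le> B" "2 * \<bar>p\<bar> \<le> B" for p q :: real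
          using that by linarith
        then show ?thesis using B[OF a] by blast
      qed
      finally have "\<bar>3 * G 0 a + 2 * a * G 1 a\<bar> \<le> 2 * B" .
      then show ?thesis
        using gauss_height_pos[OF assms(2)] e
        by (simp add: scalar_kernel_def Let_def a_def[symmetric] abs_mult mult_left_mono)
    qed
  qed (use scalar_kernel_eq_0[OF assms(2)] in auto)
  have sum: "(\<lambda>x. oseen_field e x0 t s x + grad (oseen_potential e x0 t s) x)
      = (\<lambda>x. scalar_kernel x0 t s x *\<^sub>R e)"
    by (simp add: oseen_field_plus_grad scalar_kernel_def Let_def)
  have "grad (oseen_potential e x0 t s) x = scalar_kernel x0 t s x *\<^sub>R e - oseen_field e x0 t s x" for x
    using fun_cong[OF sum, of x] by (simp add: algebra_simps)
  then have g: "grad (oseen_potential e x0 t s) \<in> L2"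
    using L2_diff[OF k o] by presburger
  have "l2inner f (\<lambda>x. scalar_kernel x0 t s x *\<^sub>R e)
      = l2inner f (oseen_field e x0 t s) + l2inner f (grad (oseen_potential e x0 t s))"
    unfolding sum[symmetric] by (rule l2inner_add_right[OF fL2 o g])
  moreover have "l2inner f (grad (oseen_potential e x0 t s)) = 0"
    using f oseen_potential_test_function[OF assms(2)] by (simp add: L2_sigma_def)
  ultimately show ?thesis by (simp add: l2inner_def)
qed

end

text \<open>
  Up to an error of order \<open>1 / N\<close> on a ball of volume of order \<open>N powr (3/2)\<close>, the scalar kernel is the
  cut off heat kernel. The error is of order \<open>N powr (-1/4)\<close> in \<open>L\<^sup>2\<close>, and dominated convergence
  applies to the cut off heat kernel.
\<close>
lemma truncated_pairing_tendsto:
  fixes f :: "R3 \<Rightarrow> R3"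
  assumes f: "f \<in> L2" and st: "s < t" and e: "norm e = 1"
  shows "(\<lambda>n. \<integral>x. radial_profile.scalar_kernel (cut_profile (real (Suc n) ^ 4)) x0 t s x * (f x \<bullet> e) \<partial>lebesgue)
    \<longlonglongrightarrow> l2inner f (\<lambda>y. heat_kernel (t - s) (x0 - y) *\<^sub>R e)"
proof -
  obtain C where C0: "0 \<le> C" and C: "\<And>N a. 1 \<le> N \<Longrightarrow> 0 \<le> a \<Longrightarrow>
      \<bar>3 * cut_profile N 0 a + 2 * a * cut_profile N 1 a - cutoff N 0 a * exp (- a)\<bar> \<le> C / N"
    using cut_profile_bounds by blast
  define a where "a x = gauss_rate t s * ((x - x0) \<bullet> (x - x0))" for x
  define h where "h = gauss_height t s"
  define N where "N n = real (Suc n) ^ 4" for n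
  define k where "k n = radial_profile.scalar_kernel (cut_profile (N n)) x0 t s" for n
  define K where "K n x = cutoff (N n) 0 (a x) * (h * exp (- a x))" for n x
  define V where "V = sqrt (measure lebesgue (cball x0 (sqrt (8 * (t - s)))))"
  have N1: "1 \<le> N n" for n by (simp add: N_def)
  note rp = radial_profile_cut_profile[OF N1]
  have a0: "0 \<le> a x" for x using gauss_rate_pos[OF st] by (simp add: a_def)
  have h0: "0 < h" using gauss_height_pos[OF st] by (simp add: h_def)
  have k_eq: "k n x = h * (3 * cut_profile (N n) 0 (a x) + 2 * a x * cut_profile (N n) 1 (a x))" for n x
    by (simp add: k_def radial_profile.scalar_kernel_def[OF rp] Let_def a_def h_def)
  have a_cont: "continuous_on UNIV a"
    unfolding a_def[abs_def] by (intro continuous_intros)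
  have "continuous_on UNIV (\<lambda>x. cutoff (N n) 0 (a x))" for n
    using Ck_on_cutoff[of 0 "N n" 0] by (intro continuous_on_compose2[OF _ a_cont]) auto
  then have K_meas: "K n \<in> borel_measurable lebesgue" for n
    unfolding K_def[abs_def]
    by (intro continuous_imp_lebesgue_measurable continuous_intros a_cont) auto
  have k_meas: "k n \<in> borel_measurable lebesgue" for n
    unfolding k_def by (rule radial_profile.scalar_kernel_measurable[OF rp])
  have far: "2 * N n < a x" if "x \<notin> cball x0 (sqrt (4 * (2 * N n) * (t - s)))" for n x
    using radial_profile.outside_support[OF rp order_refl st that] by (simp add: a_def)
  define D where "D n x = (k n x - K n x) *\<^sub>R e" for n x
  have D_le: "norm (D n x) \<le> h * (C / N n)" for n x
  proof -
    have "k n x - K n x = h * (3 * cut_profile (N n) 0 (a x) + 2 * a x * cut_profile (N n) 1 (a x)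
        - cutoff (N n) 0 (a x) * exp (- a x))"
      by (simp add: k_eq K_def algebra_simps)
    then have "norm (D n x) = h * \<bar>3 * cut_profile (N n) 0 (a x) + 2 * a x * cut_profile (N n) 1 (a x)
        - cutoff (N n) 0 (a x) * exp (- a x)\<bar>"
      using h0 e by (simp add: D_def abs_mult)
    also have "\<dots> \<le> h * (C / N n)" using C[OF N1 a0] h0 by (intro mult_left_mono) auto
    finally show ?thesis .
  qed
  have D_meas: "D n \<in> borel_measurable lebesgue" for n
    unfolding D_def[abs_def] by (intro borel_measurable_scaleR borel_measurable_diff k_meas K_meas) simp
  have D_0: "D n x = 0" if "x \<notin> cball x0 (sqrt (4 * (2 * N n) * (t - s)))" for n x
    using far[OF that] N1[of n] by (simp add: D_def k_eq K_def cut_profile_eq_0 cutoff_eq_0)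
  have D_L2: "D n \<in> L2"
    "l2norm (D n) \<le> h * (C / N n) * sqrt (measure lebesgue (cball x0 (sqrt (4 * (2 * N n) * (t - s)))))" for n
    using L2_bounded_support[OF D_meas[of n] D_le D_0[of _ n]] by blast+
  have vol: "sqrt (measure lebesgue (cball x0 (sqrt (4 * (2 * N n) * (t - s))))) = real (Suc n) ^ 3 * V" for n
    unfolding N_def V_def by (rule truncation_volume) (use st in simp)
  have D_int: "\<bar>l2inner f (D n)\<bar> \<le> l2norm f * (h * C * V) * inverse (real (Suc n))" for n
  proof -
    have "\<bar>l2inner f (D n)\<bar> \<le> l2norm f * l2norm (D n)" by (rule L2_inner(2)[OF f D_L2(1)])
    also have "\<dots> \<le> l2norm f * (h * (C / N n) * (real (Suc n) ^ 3 * V))"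
      using D_L2(2)[of n] by (intro mult_left_mono l2norm_nonneg) (simp only: vol)
    also have "\<dots> = l2norm f * (h * C * V) * (real (Suc n) ^ 3 / N n)" by simp
    also have "real (Suc n) ^ 3 / N n = inverse (real (Suc n))"
      by (simp add: N_def inverse_eq_divide divide_eq_eq del: of_nat_Suc) (simp add: eval_nat_numeral)
    finally show ?thesis .
  qed
  have lim_D: "(\<lambda>n. l2inner f (D n)) \<longlonglongrightarrow> 0"
    using D_int
    by (intro Lim_null_comparison[OF always_eventually
          tendsto_mult_right_zero[OF LIMSEQ_inverse_real_of_nat, of "l2norm f * (h * C * V)"]])
       (simp del: of_nat_Suc)
  have hkL2: "(\<lambda>y. heat_kernel (t - s) (x0 - y) *\<^sub>R e) \<in> L2"
    using heat_kernel_L2[of "t - s"] st by simp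
  have hk: "heat_kernel (t - s) (x0 - y) = h * exp (- a y)" for y
    by (simp add: heat_kernel_eq[OF st] h_def a_def)
  have lim_K: "(\<lambda>n. \<integral>x. K n x * (f x \<bullet> e) \<partial>lebesgue) \<longlonglongrightarrow> (\<integral>x. (h * exp (- a x)) * (f x \<bullet> e) \<partial>lebesgue)"
  proof (rule integral_dominated_convergence)
    show "integrable lebesgue (\<lambda>x. norm (heat_kernel (t - s) (x0 - x) *\<^sub>R e) * norm (f x))"
      by (rule L2_norm_product(1)[OF hkL2 f])
    have fe: "(\<lambda>x. f x \<bullet> e) \<in> borel_measurable lebesgue"
      using L2_D(1)[OF f] by (intro borel_measurable_inner) auto
    then show "(\<lambda>x. K n x * (f x \<bullet> e)) \<in> borel_measurable lebesgue" for n
      by (intro borel_measurable_times K_meas)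
    have "(\<lambda>x. h * exp (- a x)) \<in> borel_measurable lebesgue"
      by (intro continuous_imp_lebesgue_measurable continuous_intros a_cont)
    from this fe show "(\<lambda>x. (h * exp (- a x)) * (f x \<bullet> e)) \<in> borel_measurable lebesgue"
      by (rule borel_measurable_times)
    have "(\<lambda>n. K n x * (f x \<bullet> e)) \<longlonglongrightarrow> (h * exp (- a x)) * (f x \<bullet> e)" for x
    proof (rule tendsto_eventually)
      obtain n0 where n0: "a x \<le> real n0" using real_arch_simple by blast
      have "eventually (\<lambda>n. a x \<le> real n) sequentially"
        using eventually_ge_at_top[of n0] by eventually_elim (use n0 in linarith)
      then show "eventually (\<lambda>n. K n x * (f x \<bullet> e) = (h * exp (- a x)) * (f x \<bullet> e)) sequentially"
      proof eventually_elim
        case (elim n)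
        have "real (Suc n) ^ 1 \<le> N n" unfolding N_def by (intro power_increasing) auto
        then have "a x \<le> N n" using elim by simp
        then show ?case using N1[of n] by (simp add: K_def cutoff_eq_1)
      qed
    qed
    then show "AE x in lebesgue. (\<lambda>n. K n x * (f x \<bullet> e)) \<longlonglongrightarrow> (h * exp (- a x)) * (f x \<bullet> e)" by simp
    have "norm (K n x * (f x \<bullet> e)) \<le> norm (heat_kernel (t - s) (x0 - x) *\<^sub>R e) * norm (f x)" for n x
    proof -
      have "\<bar>cutoff (N n) 0 (a x) * (h * exp (- a x))\<bar> \<le> 1 * (h * exp (- a x))"
        using cutoff_0_bounds[of "N n" "a x"] h0 by (intro abs_mult_le) auto
      moreover have "\<bar>f x \<bullet> e\<bar> \<le> norm (f x)" using Cauchy_Schwarz_ineq2[of "f x" e] e by simp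
      ultimately have "\<bar>K n x * (f x \<bullet> e)\<bar> \<le> 1 * (h * exp (- a x)) * norm (f x)"
        unfolding K_def by (rule abs_mult_le)
      then show ?thesis using e h0 by (simp add: hk)
    qed
    then show "AE x in lebesgue. norm (K n x * (f x \<bullet> e))
        \<le> norm (heat_kernel (t - s) (x0 - x) *\<^sub>R e) * norm (f x)" for n by simp
  qed
  have KL2: "(\<lambda>x. K n x *\<^sub>R e) \<in> L2" for n
  proof (rule L2_bounded_support(1)[where ?x0.0=x0 and r="sqrt (4 * (2 * N n) * (t - s))" and B=h])
    show "(\<lambda>x. K n x *\<^sub>R e) \<in> borel_measurable lebesgue"
      using K_meas by (rule borel_measurable_scaleR) simp
    have "\<bar>cutoff (N n) 0 (a x) * (h * exp (- a x))\<bar> \<le> 1 * (h * 1)" for x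
      using cutoff_0_bounds[of "N n" "a x"] h0 a0[of x] by (intro abs_mult_le) auto
    then show "norm (K n x *\<^sub>R e) \<le> h" for x using e by (simp add: K_def)
    show "K n x *\<^sub>R e = 0" if "x \<notin> cball x0 (sqrt (4 * (2 * N n) * (t - s)))" for x
      using far[OF that] N1[of n] by (simp add: K_def cutoff_eq_0)
  qed
  have "(\<integral>x. k n x * (f x \<bullet> e) \<partial>lebesgue) = l2inner f (D n) + (\<integral>x. K n x * (f x \<bullet> e) \<partial>lebesgue)" for n
  proof -
    have "(\<lambda>x. D n x + K n x *\<^sub>R e) = (\<lambda>x. k n x *\<^sub>R e)"
      by (simp add: D_def scaleR_left_diff_distrib)
    then show ?thesis
      using l2inner_add_right[OF f D_L2(1)[of n] KL2[of n]] by (simp add: l2inner_def)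
  qed
  then have "(\<lambda>n. \<integral>x. k n x * (f x \<bullet> e) \<partial>lebesgue) \<longlonglongrightarrow> 0 + (\<integral>x. (h * exp (- a x)) * (f x \<bullet> e) \<partial>lebesgue)"
    using tendsto_add[OF lim_D lim_K] by simp
  then show ?thesis by (simp add: k_def N_def l2inner_def hk)
qed

text \<open>
  The limit \<open>N \<rightarrow> \<infinity>\<close> of \<open>pairing_increment_le\<close>: the eigenvalue bound tends to \<open>1\<close>, and the defect, of order
  \<open>1 / N\<close> on a ball of volume of order \<open>N powr (3/2)\<close>, tends to \<open>0\<close> in \<open>L\<^sup>2\<close>.
\<close>
lemma heat_pairing_increment_le:
  fixes u :: "real \<Rightarrow> R3 \<Rightarrow> R3"
  assumes times: "0 \<le> t0" "t0 < t1" "t1 < t" and e: "norm e = 1"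
    and u: "\<And>s. s \<ge> 0 \<Longrightarrow> u s \<in> L2_sigma" "\<And>s. s \<ge> 0 \<Longrightarrow> l2norm (u s) \<le> C"
    and weak: "\<And>h. h \<in> L2 \<Longrightarrow> continuous_on {0..} (\<lambda>s. l2inner (u s) h)"
    and mom: "momentum_equation u Du"
    and Du: "AE s in lebesgue. s \<in> {t0<..<t1} \<longrightarrow> Du s \<in> L2"
    and int: "integrable lebesgue (\<lambda>s. indicator {t0<..<t1} s * l2norm (Du s))"
  shows "\<bar>l2inner (u t0) (\<lambda>y. heat_kernel (t - t0) (x0 - y) *\<^sub>R e)
      - l2inner (u t1) (\<lambda>y. heat_kernel (t - t1) (x0 - y) *\<^sub>R e)\<bar>
    \<le> gauss_height t t1 * C * (\<integral>s. indicator {t0<..<t1} s * l2norm (Du s) \<partial>lebesgue)"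
proof -
  obtain c where c0: "0 \<le> c" and c: "\<And>N a. 1 \<le> N \<Longrightarrow> 0 \<le> a \<Longrightarrow>
     2 * \<bar>cut_profile N 0 a\<bar> \<le> 1 \<and>
     2 * \<bar>cut_profile N 0 a + a * cut_profile N 1 a\<bar> \<le> 1 + c / N \<and>
     \<bar>a * cut_profile N 2 a + (a + 5/2) * cut_profile N 1 a + 3/2 * cut_profile N 0 a\<bar> \<le> c / N \<and>
     \<bar>a * (a * cut_profile N 3 a + (a + 7/2) * cut_profile N 2 a + 5/2 * cut_profile N 1 a)\<bar> \<le> c / N"
    using cut_profile_bounds by blast
  define N where "N n = real (Suc n) ^ 4" for n
  define P where "P n s = (\<integral>x. radial_profile.scalar_kernel (cut_profile (N n)) x0 t s x * (u s x \<bullet> e) \<partial>lebesgue)" for n s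
  define J where "J = (\<integral>s. indicator {t0<..<t1} s * l2norm (Du s) \<partial>lebesgue)"
  define V where "V = sqrt (measure lebesgue (cball x0 (sqrt (8 * (t - t0)))))"
  define h where "h = gauss_height t t1"
  define r where "r = gauss_rate t t1"
  define i where "i n = inverse (real (Suc n))" for n
  have N1: "1 \<le> N n" for n by (simp add: N_def)
  note rp = radial_profile_cut_profile[OF N1]
  have uL2: "u s \<in> L2" if "0 \<le> s" for s using u(1)[OF that] by (simp add: L2_sigma_def)
  have B: "2 * \<bar>cut_profile (N n) 0 a\<bar> \<le> 1 + c / N n" "2 * \<bar>cut_profile (N n) 0 a + a * cut_profile (N n) 1 a\<bar> \<le> 1 + c / N n"
    if "0 \<le> a" for n a
  proof -
    have "0 \<le> c / N n" using c0 N1[of n] by simp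
    then show "2 * \<bar>cut_profile (N n) 0 a\<bar> \<le> 1 + c / N n" using c[OF N1 that, of n] by linarith
    show "2 * \<bar>cut_profile (N n) 0 a + a * cut_profile (N n) 1 a\<bar> \<le> 1 + c / N n" using c[OF N1 that, of n] by blast
  qed
  have d: "\<bar>radial_profile.heat_defect (cut_profile (N n)) a\<bar> \<le> c / N n"
    "\<bar>a * radial_profile.heat_defect' (cut_profile (N n)) a\<bar> \<le> c / N n" if "0 \<le> a" for n a
    unfolding radial_profile.heat_defect_def[OF rp] radial_profile.heat_defect'_def[OF rp]
    using c[OF N1 that, of n] by blast+
  have bound: "\<bar>P n t0 - P n t1\<bar>
      \<le> h * (1 + c * i n ^ 4) * C * J + C * (16 * r * h * (c * i n) * V) * (t1 - t0)" for n
  proof -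
    have "P n s = l2inner (u s) (radial_profile.oseen_field (cut_profile (N n)) e x0 t s)"
      if "0 \<le> s" "s < t" for s
      unfolding P_def by (rule radial_profile.l2inner_oseen_field[OF rp u(1)[OF that(1)] that(2) e B, symmetric])
    then have "\<bar>P n t0 - P n t1\<bar> \<le> h * (1 + c / N n) * C * J
      + C * (16 * r * h * (c / N n) * sqrt (measure lebesgue (cball x0 (sqrt (4 * (2 * N n) * (t - t0)))))) * (t1 - t0)"
      using radial_profile.pairing_increment_le[OF rp times e uL2 u(2) weak mom Du int B d] times
      by (simp add: h_def r_def J_def)
    also have "sqrt (measure lebesgue (cball x0 (sqrt (4 * (2 * N n) * (t - t0))))) = real (Suc n) ^ 3 * V"
      unfolding N_def V_def using times by (intro truncation_volume) simp
    also have "c / N n = c * i n ^ 4" by (simp add: N_def i_def field_simps)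
    also have "16 * r * h * (c * i n ^ 4) * (real (Suc n) ^ 3 * V) = 16 * r * h * (c * i n) * V"
    proof -
      have "i n * real (Suc n) = 1" by (simp add: i_def)
      then have "i n ^ 4 * real (Suc n) ^ 3 = i n"
        using power_mult_distrib[of "i n" "real (Suc n)" 3] by (simp add: eval_nat_numeral)
      then have "16 * r * h * c * V * (i n ^ 4 * real (Suc n) ^ 3) = 16 * r * h * c * V * i n"
        by (simp only:)
      then show ?thesis by (simp only: mult_ac)
    qed
    finally show ?thesis .
  qed
  have i_lim: "i \<longlonglongrightarrow> 0"
    unfolding i_def[abs_def] by (rule LIMSEQ_inverse_real_of_nat)
  have "(\<lambda>n. h * (1 + c * i n ^ 4) * C * J + C * (16 * r * h * (c * i n) * V) * (t1 - t0))
      \<longlonglongrightarrow> h * (1 + c * 0 ^ 4) * C * J + C * (16 * r * h * (c * 0) * V) * (t1 - t0)"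
    by (intro tendsto_intros i_lim)
  then have R: "(\<lambda>n. h * (1 + c * i n ^ 4) * C * J + C * (16 * r * h * (c * i n) * V) * (t1 - t0))
      \<longlonglongrightarrow> h * C * J" by simp
  have lim: "(\<lambda>n. P n s) \<longlonglongrightarrow> l2inner (u s) (\<lambda>y. heat_kernel (t - s) (x0 - y) *\<^sub>R e)"
    if "0 \<le> s" "s < t" for s
    unfolding P_def N_def by (rule truncated_pairing_tendsto[OF uL2[OF that(1)] that(2) e])
  have "(\<lambda>n. \<bar>P n t0 - P n t1\<bar>) \<longlonglongrightarrow> \<bar>l2inner (u t0) (\<lambda>y. heat_kernel (t - t0) (x0 - y) *\<^sub>R e)
      - l2inner (u t1) (\<lambda>y. heat_kernel (t - t1) (x0 - y) *\<^sub>R e)\<bar>"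
    using times by (intro tendsto_intros lim) auto
  from LIMSEQ_le[OF this R] bound show ?thesis by (auto simp: h_def J_def)
qed

theorem theorem2p3:
  fixes u0 :: "real^3 \<Rightarrow> real^3"
    and u :: "real \<Rightarrow> real^3 \<Rightarrow> real^3"
    and t0 t0' :: real
  assumes "u0 \<in> L2_sigma"
    and "leray_hopf_solution u0 u"
    and "0 \<le> t0" and "t0 < t0'"
  shows "let \<Gamma> = (4 * pi) powr (-3/2);
             v = (\<lambda>t. heat_semigroup (t - t0) (u t0));
             v' = (\<lambda>t. heat_semigroup (t - t0') (u t0'))
         in \<forall>t>t0'. linf_norm (\<lambda>x. v t x - v' t x)
              \<le> ereal (\<Gamma> / sqrt 2 * (l2norm u0)\<^sup>2 * (t0' - t0) powr (1/2) * (t - t0') powr (-3/2))"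
proof -
  let ?U = "l2norm u0" and ?I = "{t0<..<t0'}"
  have t0'0: "0 \<le> t0'" using assms by simp
  note lh = assms(2)[unfolded leray_hopf_solution_def]
  have u: "u s \<in> L2_sigma" if "0 \<le> s" for s using lh that by blast
  have uL2: "u s \<in> L2" if "0 \<le> s" for s using u[OF that] by (simp add: L2_sigma_def)
  have weak: "continuous_on {0..} (\<lambda>s. l2inner (u s) h)" if "h \<in> L2" for h using lh that by blast
  obtain Du where Du: "AE s in lebesgue_on {0..}. has_weak_jacobian (u s) (Du s) \<and> Du s \<in> L2"
    and Du2: "integrable (lebesgue_on {0..}) (\<lambda>s. (l2norm (Du s))\<^sup>2)"
    and mom: "momentum_equation u Du"
    and energy: "\<And>s. 0 \<le> s \<Longrightarrow> (l2norm (u s))\<^sup>2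
        + 2 * (\<integral>r. (l2norm (Du r))\<^sup>2 \<partial>lebesgue_on {0..s}) \<le> ?U\<^sup>2"
    using lh by blast
  have u_le: "l2norm (u s) \<le> ?U" if "0 \<le> s" for s
  proof -
    have "0 \<le> (\<integral>r. (l2norm (Du r))\<^sup>2 \<partial>lebesgue_on {0..s})" by simp
    then have "(l2norm (u s))\<^sup>2 \<le> ?U\<^sup>2" using energy[OF that] by linarith
    then show ?thesis by (rule power2_le_imp_le) (rule l2norm_nonneg)
  qed
  have AE_Du: "AE s in lebesgue. s \<in> ?I \<longrightarrow> Du s \<in> L2"
  proof -
    have "AE s in lebesgue. s \<in> {0..} \<longrightarrow> has_weak_jacobian (u s) (Du s) \<and> Du s \<in> L2"
      using Du by (subst (asm) AE_restrict_space_iff) auto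
    then show ?thesis by eventually_elim (use assms(3) in auto)
  qed
  define g where "g s = indicator ?I s * l2norm (Du s)" for s
  have g2: "(g s)\<^sup>2 = indicator ?I s * (l2norm (Du s))\<^sup>2" for s
    by (simp add: g_def indicator_def)
  have int0: "set_integrable lebesgue {0..} (\<lambda>s. (l2norm (Du s))\<^sup>2)"
    using Du2 unfolding set_integrable_def by (subst (asm) integrable_restrict_space) auto
  have g2_int: "integrable lebesgue (\<lambda>s. (g s)\<^sup>2)"
  proof -
    have "?I \<subseteq> {0..}" using assms(3) by auto
    from set_integrable_subset[OF int0 _ this] show ?thesis by (simp add: set_integrable_def g2)
  qed
  have g_eq: "g = (\<lambda>s. sqrt ((g s)\<^sup>2))" by (auto simp: g_def l2norm_nonneg)
  have g_meas: "g \<in> borel_measurable lebesgue"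
    by (subst g_eq) (rule measurable_compose[OF borel_measurable_integrable[OF g2_int] borel_measurable_sqrt])
  have ind_meas: "(indicator ?I :: real \<Rightarrow> real) \<in> borel_measurable lebesgue"
    by (rule borel_measurable_indicator) simp
  have ind_sq: "(indicator ?I s :: real)\<^sup>2 = indicator ?I s" for s by (cases "s \<in> ?I") auto
  have ind_int: "integrable lebesgue (\<lambda>s. (indicator ?I s :: real)\<^sup>2)"
    unfolding ind_sq using emeasure_bounded_finite[of ?I] by (intro integrable_real_indicator) auto
  have g_ind: "g s * indicator ?I s = g s" for s by (cases "s \<in> ?I") (auto simp: g_def)
  have g_int: "integrable lebesgue g"
    using integrable_product[OF g_meas ind_meas g2_int ind_int] by (simp add: g_ind)
  \<comment> \<open>the energy inequality at time \<open>t0'\<close>; the factor \<open>2\<close> in it produces \<open>sqrt 2\<close>\<close>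
  have g2_le: "(\<integral>s. (g s)\<^sup>2 \<partial>lebesgue) \<le> ?U\<^sup>2 / 2"
  proof -
    have "(\<integral>s. (g s)\<^sup>2 \<partial>lebesgue) \<le> (\<integral>s. indicator {0..t0'} s * (l2norm (Du s))\<^sup>2 \<partial>lebesgue)"
    proof (rule integral_mono[OF g2_int])
      show "integrable lebesgue (\<lambda>s. indicator {0..t0'} s * (l2norm (Du s))\<^sup>2)"
        using set_integrable_subset[OF int0, of "{0..t0'}"] by (auto simp: set_integrable_def subset_iff)
      show "(g s)\<^sup>2 \<le> indicator {0..t0'} s * (l2norm (Du s))\<^sup>2" for s
        using assms(3) by (auto simp: g2 indicator_def)
    qed
    also have "\<dots> = (\<integral>s. (l2norm (Du s))\<^sup>2 \<partial>lebesgue_on {0..t0'})"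
      by (subst integral_restrict_space) auto
    also have "\<dots> \<le> ?U\<^sup>2 / 2"
      using energy[OF t0'0] zero_le_power2[of "l2norm (u t0')"] by linarith
    finally show ?thesis .
  qed
  have J: "(\<integral>s. g s \<partial>lebesgue) \<le> ?U / sqrt 2 * sqrt (t0' - t0)"
  proof -
    have "(\<integral>s. g s \<partial>lebesgue) \<le> sqrt (\<integral>s. (g s)\<^sup>2 \<partial>lebesgue) * sqrt (\<integral>s. (indicator ?I s :: real)\<^sup>2 \<partial>lebesgue)"
      using Cauchy_Schwarz_integral(2)[OF g_meas ind_meas g2_int ind_int] by (simp add: g_ind)
    also have "(\<integral>s. (indicator ?I s :: real)\<^sup>2 \<partial>lebesgue) = t0' - t0"
      unfolding ind_sq using assms(4) by simp
    also have "sqrt (\<integral>s. (g s)\<^sup>2 \<partial>lebesgue) * sqrt (t0' - t0) \<le> sqrt (?U\<^sup>2 / 2) * sqrt (t0' - t0)"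
      using g2_le assms(4) by (intro mult_right_mono real_sqrt_le_mono) auto
    also have "sqrt (?U\<^sup>2 / 2) = ?U / sqrt 2" by (simp add: real_sqrt_divide l2norm_nonneg)
    finally show ?thesis .
  qed
  have main: "linf_norm (\<lambda>x. heat_semigroup (t - t0) (u t0) x - heat_semigroup (t - t0') (u t0') x)
      \<le> ereal ((4 * pi) powr (-3/2) / sqrt 2 * ?U\<^sup>2 * (t0' - t0) powr (1/2) * (t - t0') powr (-3/2))"
    if t: "t0' < t" for t
  proof -
    let ?d = "\<lambda>x. heat_semigroup (t - t0) (u t0) x - heat_semigroup (t - t0') (u t0') x"
    have pos: "0 < t - t0" "0 < t - t0'" using t assms(4) by auto
    have pt: "\<bar>?d x $ i\<bar> \<le> (4 * pi) powr (-3/2) / sqrt 2 * ?U\<^sup>2 * (t0' - t0) powr (1/2) * (t - t0') powr (-3/2)" for x i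
    proof -
      have "\<bar>?d x $ i\<bar> \<le> gauss_height t t0' * ?U * (\<integral>s. g s \<partial>lebesgue)"
        using heat_pairing_increment_le[where e="axis i 1" and ?x0.0=x, OF assms(3,4) t norm_axis_1
            u u_le weak mom AE_Du g_int[unfolded g_def[abs_def]]]
        by (simp add: heat_semigroup_nth(1)[OF pos(1) uL2[OF assms(3)]] heat_semigroup_nth(1)[OF pos(2) uL2[OF t0'0]] g_def)
      also have "\<dots> \<le> gauss_height t t0' * ?U * (?U / sqrt 2 * sqrt (t0' - t0))"
        using gauss_height_pos[OF t] by (intro mult_left_mono J mult_nonneg_nonneg l2norm_nonneg) simp
      also have "\<dots> = (4 * pi) powr (-3/2) / sqrt 2 * ?U\<^sup>2 * (t0' - t0) powr (1/2) * (t - t0') powr (-3/2)"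
        using pos assms(4)
        by (simp add: gauss_height_def powr_mult powr_half_sqrt power2_eq_square)
      finally show ?thesis .
    qed
    have "esssup lebesgue (\<lambda>x. ereal \<bar>?d x $ i\<bar>)
        \<le> ereal ((4 * pi) powr (-3/2) / sqrt 2 * ?U\<^sup>2 * (t0' - t0) powr (1/2) * (t - t0') powr (-3/2))" for i
    proof (rule esssup_I)
      have "(\<lambda>x. \<bar>?d x $ i\<bar>) \<in> borel_measurable lebesgue"
        using heat_semigroup_measurable[OF pos(1) uL2[OF assms(3)]]
          heat_semigroup_measurable[OF pos(2) uL2[OF t0'0]]
        by (simp add: borel_measurable_abs borel_measurable_diff)
      then show "(\<lambda>x. ereal \<bar>?d x $ i\<bar>) \<in> borel_measurable lebesgue" by (rule borel_measurable_ereal)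
    qed (use pt in \<open>auto intro!: AE_I2\<close>)
    then show ?thesis unfolding linf_norm_def by (subst Max_le_iff) auto
  qed
  then show ?thesis unfolding Let_def by blast
qed

end
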